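(* Let $s_{\min},s_{\max},\gamma_{\min},\gamma_{\max}$ be given positive real numbers with $\gamma_{\min}>s_{\max}$, and let $n$ i.i.d. observations $O_i=(W_i,\mathbf X_i)\sim P$ be given as in the context. Then there exist estimators $\hat f$ and $\hat g$ of $f$ and $g$, depending (besides the data) only on $M,B_L,B_U,s_{\min},s_{\max},\gamma_{\min},\gamma_{\max}$ and the choice of wavelet bases $\psi^0_{0,0},\psi^1_{0,0}$, such that the following hold for every $(s,\gamma)\in(s_{\min},s_{\max})\times(\gamma_{\min},\gamma_{\max})$ with a large enough $C>0$ depending possibly on $M,B_L,B_U,\gamma_{\max}$: $$\sup_{P\in\mathcal P(s,\gamma)}\mathrm E_P\|\hat g-g\|_\infty\le C^{\frac d{2\gamma+d}}\Big(\frac n{\log n}\Big)^{-\frac\gamma{2\gamma+d}},$$ $$\sup_{P\in\mathcal P(s,\gamma)}\mathrm P_P\Big(\|\hat g-g\|_\infty\ge C^{\frac d{d+2\gamma}}\Big(\frac n{\log n}\Big)^{-\frac\gamma{2\gamma+d}}\Big)\le\frac{\log n}{n^3},$$ $$\sup_{P\in\mathcal P(s,\gamma)}\mathrm P_P\big(\hat g\notin H(\gamma,C)\big)\le\frac1{n^2},$$ $$\sup_{P\in\mathcal P(s,\gamma)}\mathrm E_P\|\hat f-f\|_\infty\le C^{\frac d{2s+d}}\Big(\frac n{\log n}\Big)^{-\frac s{2s+d}},$$ $$\sup_{P\in\mathcal P(s,\gamma)}\mathrm P_P\Big(\|\hat f-f\|_\infty\ge C^{\frac d{d+2s}}\Big(\frac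 n{\log n}\Big)^{-\frac s{2s+d}}\Big)\le\frac{\log n}{n^3},$$ $$\sup_{P\in\mathcal P(s,\gamma)}\mathrm P_P\big(\hat f\notin H(s,C)\big)\le\frac1{n^2},$$ $$|\hat f(\mathbf x)|\le2B_U\quad\text{and}\quad B_L/2\le\hat g(\mathbf x)\le2B_U\qquad\forall\,\mathbf x\in[0,1]^d.$$
   Context: **Model.** $O=(W,\mathbf X)\sim P$ with $W$ scalar, $|W|\le B_U$, $\mathrm E_P(W\mid\mathbf X)=f(\mathbf X)$ almost surely, and $\mathbf X\in[0,1]^d$ with Lebesgue density $g$ satisfying $0<B_L\le g(\mathbf x)\le B_U<\infty$ for all $\mathbf x\in[0,1]^d$. For smoothness indices $(s,\gamma)$, $$\mathcal P(s,\gamma)=\{P:(f,g)\in H(s,M)\times H(\gamma,M),\ |f(\mathbf x)|\le B_U,\ B_L\le g(\mathbf x)\le B_U\ \forall\mathbf x\in[0,1]^d\}.$$ $\|h\|_\infty=\sup_{\mathbf x\in[0,1]^d}|h(\mathbf x)|$. **Hölder balls.** On $[0,1]^d$ use the orthonormal, compactly supported, bounded, boundary-corrected Cohen–Daubechies–Vial tensor wavelets $\psi_{l,m}^v(\mathbf x)=\prod_{j=1}^d2^{l/2}\psi_{0,0}^{v_j}(2^lx_j-m_j)$, $v\in\{0,1\}^d$, where $\psi_{0,0}^0$ is the scaling function and $\psi_{0,0}^1$ the mother wavelet, of regularity $S$ larger than every smoothness index considered (here $S>\gamma_{\max}$). $\mathcal Z_l$ is the set of $O(2^{ld})$ indices $m$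 at level $l$, and $J_0=J_0(S)\ge1$ satisfies $2^{J_0}\ge S$. For $\beta>0$, $M>0$, $H(\beta,M)$ is the set of continuous $h:[0,1]^d\to\mathbb R$ with $$2^{J_0(\beta+\frac d2)}\max_{m\in\mathcal Z_{J_0}}|\langle h,\psi^0_{J_0,m}\rangle|+\sup_{l\ge J_0,\,m\in\mathcal Z_l,\,v\in\{0,1\}^d\setminus\{0\}^d}2^{l(\beta+\frac d2)}|\langle h,\psi^v_{l,m}\rangle|\le M$$ (inner products in $L_2([0,1]^d)$); this is a ball of the Hölder–Zygmund space of order $\beta$ in an equivalent norm.
   Formalization: C may also depend on s_min (no C depending only on M, B_L, B_U, γ_max can work: as s→0 the sup-norm risk over H(s,M) gains a factor of order 1/s); n≥2 is assumed so that n/log n makes sense, and 2^{J_0}≥2S so that the boundary-corrected wavelets fit. *)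

theory Defs
  imports "HOL-Probability.Probability" "HOL-Computational_Algebra.Polynomial"
begin

definition unit_cube :: "(real ^ 'd) set" where
  "unit_cube = {x. \<forall>j. x $ j \<in> {0..1}}"

definition sup_norm :: "(real ^ 'd \<Rightarrow> real) \<Rightarrow> real" where
  "sup_norm h = (SUP x\<in>unit_cube. \<bar>h x\<bar>)"

definition l2_inner :: "'a::euclidean_space set \<Rightarrow> ('a \<Rightarrow> real) \<Rightarrow> ('a \<Rightarrow> real) \<Rightarrow> real" where
  "l2_inner A h k = (LINT x:A|lborel. h x * k x)"

text \<open>
  Boolean arguments select the scaling function (False, upper index 0) or the mother wavelet
  (True, upper index 1).  The edge functions live on the half lines \<open>[0,\<infinity>)\<close> (left) and
  \<open>(-\<infinity>,0]\<close> (right), are numbered from the end point, and replace the generator at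
  the \<open>regularity\<close> left-most and the \<open>regularity\<close> right-most positions of each level.
\<close>

record wavelet_system =
  generator :: "bool \<Rightarrow> real \<Rightarrow> real"
  left_edge :: "bool \<Rightarrow> nat \<Rightarrow> real \<Rightarrow> real"
  right_edge :: "bool \<Rightarrow> nat \<Rightarrow> real \<Rightarrow> real"
  regularity :: nat   \<comment> \<open>the regularity \<open>S\<close>: number of null moments\<close>
  coarse_level :: nat \<comment> \<open>the level \<open>J\<^sub>0\<close>\<close>

definition wavelet1 :: "wavelet_system \<Rightarrow> bool \<Rightarrow> nat \<Rightarrow> nat \<Rightarrow> real \<Rightarrow> real" where
  "wavelet1 B a l k x = 2 powr (real l / 2) *
     (if k < regularity B then left_edge B a k (2 ^ l * x)
      else if k < 2 ^ l - regularity B then generator B a (2 ^ l * x - real k)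
      else right_edge B a (2 ^ l - 1 - k) (2 ^ l * (x - 1)))"

text \<open>
  Daubechies' compactly supported orthonormal pair with \<open>N\<close> null moments, in the normalization
  of Cohen, Daubechies and Vial, where both functions are supported in \<open>[1-N, N]\<close>.
  Continuity holds for every \<open>N \<ge> 2\<close>; it excludes only the Haar pair.
\<close>

definition daubechies_pair :: "nat \<Rightarrow> (real \<Rightarrow> real) \<Rightarrow> (real \<Rightarrow> real) \<Rightarrow> bool" where
  "daubechies_pair N \<phi> \<psi> \<longleftrightarrow>
     continuous_on UNIV \<phi> \<and> continuous_on UNIV \<psi> \<and>
     (\<forall>x. x \<notin> {1 - real N..real N} \<longrightarrow> \<phi> x = 0 \<and> \<psi> x = 0) \<and>
     (LINT x|lborel. \<phi> x) = 1 \<and>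
     (\<forall>k::int. l2_inner UNIV \<phi> (\<lambda>x. \<phi> (x - of_int k)) = (if k = 0 then 1 else 0)) \<and>
     (\<exists>h :: int \<Rightarrow> real.
        (\<forall>x. \<phi> x = sqrt 2 * (\<Sum>k\<in>{1 - int N..int N}. h k * \<phi> (2 * x - of_int k))) \<and>
        (\<forall>x. \<psi> x = sqrt 2 * (\<Sum>k\<in>{1 - int N..int N}.
                 (if even k then 1 else - 1) * h (1 - k) * \<phi> (2 * x - of_int k)))) \<and>
     (\<forall>p<N. (LINT x|lborel. x ^ p * \<psi> x) = 0)"

definition in_scaling_space :: "wavelet_system \<Rightarrow> nat \<Rightarrow> (real \<Rightarrow> real) \<Rightarrow> bool" where
  "in_scaling_space B l h \<longleftrightarrow>
     (\<exists>c. \<forall>x\<in>{0..1}. h x = (\<Sum>k<2 ^ l. c k * wavelet1 B False l k x))"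

text \<open>
  The Cohen--Daubechies--Vial construction on \<open>[0,1]\<close>.  Their unnormalized left edge functions are
  \<open>\<Sum>n. (n choose k) \<phi>(x + n - N + 1)\<close> with \<open>k < N\<close> and \<open>0 \<le> n \<le> 2N - 2\<close>, restricted to
  \<open>[0,\<infinity>)\<close>; their span consists of the combinations of translates of \<open>\<phi>\<close> whose coefficients
  are polynomials of degree less than \<open>N\<close> in the translation \<open>m = N - 1 - n\<close>.  The right edge is the
  mirror image.  The edge scaling functions are an orthonormal basis of this span, and
  the wavelets of level \<open>l\<close> span the orthogonal complement of the level \<open>l\<close> scaling space
  in that of level \<open>l + 1\<close> (inclusion and orthonormality suffice to say this, by dimension).
  The bound \<open>2N \<le> 2^J\<^sub>0\<close> makes room for the \<open>N\<close> functions at each of the two ends.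
\<close>

definition cdv_wavelets :: "wavelet_system \<Rightarrow> bool" where
  "cdv_wavelets B \<longleftrightarrow>
    (let N = regularity B; J0 = coarse_level B; \<phi> = generator B False in
     1 \<le> J0 \<and> 2 * N \<le> 2 ^ J0 \<and>
     daubechies_pair N \<phi> (generator B True) \<and>
     (\<forall>k<N. \<exists>q. degree q < N \<and>
        (\<forall>x\<ge>0. left_edge B False k x
           = (\<Sum>m\<in>{1 - int N..int N - 1}. poly q (of_int m) * \<phi> (x - of_int m)))) \<and>
     (\<forall>k<N. \<exists>q. degree q < N \<and>
        (\<forall>x\<le>0. right_edge B False k x
           = (\<Sum>m\<in>{- int N..int N - 2}. poly q (of_int m) * \<phi> (x - of_int m)))) \<and>
     (\<exists>R. \<forall>k<N. (\<forall>x>R. left_edge B True k x = 0) \<and> (\<forall>x. x < - R \<longrightarrow> right_edge B True k x = 0)) \<and>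
     (\<forall>l\<ge>J0. \<forall>a b. \<forall>k<2 ^ l. \<forall>k'<2 ^ l.
        l2_inner {0..1} (wavelet1 B a l k) (wavelet1 B b l k')
          = (if a = b \<and> k = k' then 1 else 0)) \<and>
     (\<forall>l\<ge>J0. \<forall>a. \<forall>k<2 ^ l. in_scaling_space B (Suc l) (wavelet1 B a l k)) \<and>
     (\<forall>l\<ge>J0. \<forall>p<N. in_scaling_space B l (\<lambda>x. x ^ p)) \<and>
     (\<forall>h. h \<in> borel_measurable borel \<and> set_integrable lborel {0..1} (\<lambda>x. (h x)\<^sup>2) \<and>
        (\<forall>k<2 ^ J0. l2_inner {0..1} h (wavelet1 B False J0 k) = 0) \<and>
        (\<forall>l\<ge>J0. \<forall>k<2 ^ l. l2_inner {0..1} h (wavelet1 B True l k) = 0)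
        \<longrightarrow> (AE x in lborel. x \<in> {0..1} \<longrightarrow> h x = 0)))"

definition wavelet :: "wavelet_system \<Rightarrow> bool ^ 'd \<Rightarrow> nat \<Rightarrow> nat ^ 'd \<Rightarrow> real ^ 'd \<Rightarrow> real" where
  "wavelet B v l m x = (\<Prod>j\<in>UNIV. wavelet1 B (v $ j) l (m $ j) (x $ j))"

definition level_indices :: "nat \<Rightarrow> (nat ^ 'd) set" where
  "level_indices l = {m. \<forall>j. m $ j < 2 ^ l}"

text \<open>The supremum is taken in the extended reals, so that it is infinite for unbounded families.\<close>

definition holder_ball :: "wavelet_system \<Rightarrow> real \<Rightarrow> real \<Rightarrow> (real ^ 'd \<Rightarrow> real) set" where
  "holder_ball B \<beta> M = {h. continuous_on unit_cube h \<and>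
     ereal (2 powr (real (coarse_level B) * (\<beta> + real CARD('d) / 2)) *
        Max ((\<lambda>m. \<bar>l2_inner unit_cube h (wavelet B (\<chi> j. False) (coarse_level B) m)\<bar>)
               ` level_indices (coarse_level B)))
     + (SUP (l, m, v)\<in>{(l, m, v). coarse_level B \<le> l \<and> m \<in> level_indices l \<and> v \<noteq> (\<chi> j. False)}.
          ereal (2 powr (real l * (\<beta> + real CARD('d) / 2))
                  * \<bar>l2_inner unit_cube h (wavelet B v l m)\<bar>))
     \<le> ereal M}"

text \<open>
  An observation is a pair \<open>(W, X)\<close> and \<open>P\<close> is its law.  On the cube the functions \<open>f\<close> and \<open>g\<close> are
  determined by \<open>P\<close>, because they are continuous and \<open>X\<close> has a positive density there; outside
  the cube their values are irrelevant.
\<close>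

definition model_class :: "wavelet_system \<Rightarrow> real \<Rightarrow> real \<Rightarrow> real \<Rightarrow> real \<Rightarrow> real \<Rightarrow>
    ((real \<times> (real ^ 'd)) measure \<times> (real ^ 'd \<Rightarrow> real) \<times> (real ^ 'd \<Rightarrow> real)) set" where
  "model_class B M B\<^sub>L B\<^sub>U s \<gamma> = {(P, f, g).
     prob_space P \<and> sets P = sets borel \<and>
     (AE z in P. \<bar>fst z\<bar> \<le> B\<^sub>U) \<and>
     (AE z in P. real_cond_exp P (vimage_algebra (space P) snd borel) fst z = f (snd z)) \<and>
     distributed P lborel snd (\<lambda>x. ennreal (indicator unit_cube x * g x)) \<and>
     f \<in> holder_ball B s M \<and> g \<in> holder_ball B \<gamma> M \<and>
     (\<forall>x\<in>unit_cube. \<bar>f x\<bar> \<le> B\<^sub>U \<and> B\<^sub>L \<le> g x \<and> g x \<le> B\<^sub>U)}"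

text \<open>Samples of size \<open>n\<close> are functions on \<open>{..<n}\<close>, extended by \<open>undefined\<close>.\<close>

definition sample_law :: "nat \<Rightarrow> 'a measure \<Rightarrow> (nat \<Rightarrow> 'a) measure" where
  "sample_law n P = PiM {..<n} (\<lambda>_. P)"

definition is_estimator ::
    "nat \<Rightarrow> ((nat \<Rightarrow> real \<times> (real ^ 'd)) \<Rightarrow> real ^ 'd \<Rightarrow> real) \<Rightarrow> bool" where
  "is_estimator n e \<longleftrightarrow>
     (\<lambda>(\<omega>, x). e \<omega> x) \<in> borel_measurable (sample_law n borel \<Otimes>\<^sub>M restrict_space borel unit_cube)"

definition rate :: "real \<Rightarrow> real \<Rightarrow> nat \<Rightarrow> real \<Rightarrow> real" where
  "rate d C n \<beta> = C powr (d / (2 * \<beta> + d)) * (real n / ln (real n)) powr (- (\<beta> / (2 * \<beta> + d)))"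

end

theory Submission
  imports Defs
begin

text \<open>
  Both estimators are the smoothest candidate whose tests against the scaling functions of all
  levels up to \<open>L\<close> agree with the data up to the noise level: for \<open>f\<close> a candidate \<open>h\<close> is tested
  through the empirical mean of \<open>(W - h(X)) \<phi>(X)\<close>, for \<open>g\<close> through the empirical mean of \<open>\<phi>(X)\<close>
  minus the integral of \<open>h \<phi>\<close>.  The truth passes its own tests with high probability, so the
  selected candidate is at least as smooth as the truth; this gives both the adaptation and
  the membership in the ball.  Two functions of smoothness \<open>s\<close> that pass the tests are close at
  every level \<open>l\<close>, with error of order \<open>2\<^bsup>ld/2\<^esup> (log n / n)\<^bsup>1/2\<^esup> + 2\<^bsup>-ls\<^esup>\<close>, and the best level
  gives the rate.  Since the residuals \<open>W - f(X)\<close> are centred given \<open>X\<close>, no smoothness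
  of \<open>f g\<close> or \<open>1/g\<close> enters: of \<open>g\<close> one uses only the bounds and a uniform modulus of continuity.
\<close>

subsection \<open>Wavelets on the unit interval\<close>

text \<open>The obstacle is the Gram matrix of the scaling functions under the design, known only
  through the sample: its entries at level l fluctuate by about (2^(ld) log n / n)^(1/2). The
  stability argument asks only that they be accurate up to a constant \<open>\<epsilon>\<close>: at
  a maximum point of |u| such an error costs at most half of max |u| and is absorbed. A fixed
  \<open>\<epsilon>\<close> permits tests up to a level L with 2^(Ld) of order n / log n, which is
  fine enough for every s > 0, since 2^(-Ls) is then of order (n / log n)^(-s/d). It is also why a
  modulus of continuity of g that is uniform over the class suffices. Smoothness is compared on a
  grid of mesh 1/L. Within one cell the weights 2^(ls) with l \<le> L change by at most a factor 2,
  so adaptation costs neither a logarithm nor a growing ball radius. A candidate that leaves the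
  prescribed range is replaced by a constant, not clipped, because clipping can destroy smoothness.
  On the good event this happens only if the error bound exceeds a fixed margin, and then the rate
  is trivial up to a constant.\<close>

lemma continuous_on_bounded_Icc:
  fixes h :: "real \<Rightarrow> real"
  assumes "continuous_on {a..b} h"
  shows "\<exists>A. \<forall>x\<in>{a..b}. \<bar>h x\<bar> \<le> A"
proof -
  have "bounded (h ` {a..b})"
    by (intro compact_imp_bounded compact_continuous_image assms compact_Icc)
  then show ?thesis
    by (auto simp: bounded_iff)
qed

text \<open>Counting rows and columns turns Bessel's inequality into an equality.\<close>

lemma orthonormal_rows_imp_orthonormal_columns:
  fixes A :: "'a \<Rightarrow> 'b \<Rightarrow> real"
  assumes fin: "finite I" "finite K" and card: "card I = card K"
    and ortho: "\<And>i j. i \<in> I \<Longrightarrow> j \<in> I \<Longrightarrow> (\<Sum>k\<in>K. A i k * A j k) = (if i = j then 1 else 0)"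
    and k: "k \<in> K" and k': "k' \<in> K"
  shows "(\<Sum>i\<in>I. A i k * A i k') = (if k = k' then 1 else 0)"
proof -
  \<comment> \<open>\<open>r\<close> is the identity minus the matrix of column inner products. Row
    \<open>p\<close> of \<open>r\<close> has squared length 1 minus the squared length of column
    \<open>p\<close>, and these lengths add up to \<open>card K - card I = 0\<close>.\<close>
  define r where "r p q = (if p = q then 1 else 0) - (\<Sum>i\<in>I. A i p * A i q)" for p q
  have *: "(\<Sum>q\<in>K. (r p q)\<^sup>2) = 1 - (\<Sum>i\<in>I. (A i p)\<^sup>2)" if p: "p \<in> K" for p
  proof -
    have "(\<Sum>q\<in>K. (\<Sum>i\<in>I. A i p * A i q)\<^sup>2)
        = (\<Sum>q\<in>K. \<Sum>i\<in>I. \<Sum>j\<in>I. (A i p * A j p) * (A i q * A j q))"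
      by (simp add: power2_eq_square sum_product mult_ac)
    also have "\<dots> = (\<Sum>i\<in>I. \<Sum>j\<in>I. (A i p * A j p) * (\<Sum>q\<in>K. A i q * A j q))"
      by (subst sum.swap, intro sum.cong refl, subst sum.swap) (simp add: sum_distrib_left)
    also have "\<dots> = (\<Sum>i\<in>I. (A i p)\<^sup>2)"
    proof (intro sum.cong refl)
      fix i assume i: "i \<in> I"
      have "(\<Sum>j\<in>I. (A i p * A j p) * (\<Sum>q\<in>K. A i q * A j q))
          = (\<Sum>j\<in>I. if i = j then (A i p * A j p) else 0)"
        using i by (intro sum.cong refl) (auto simp: ortho)
      then show "(\<Sum>j\<in>I. (A i p * A j p) * (\<Sum>q\<in>K. A i q * A j q)) = (A i p)\<^sup>2"
        using i fin by (simp add: power2_eq_square)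
    qed
    finally have sq: "(\<Sum>q\<in>K. (\<Sum>i\<in>I. A i p * A i q)\<^sup>2) = (\<Sum>i\<in>I. (A i p)\<^sup>2)" .
    have "(\<Sum>q\<in>K. (r p q)\<^sup>2)
        = (\<Sum>q\<in>K. (if p = q then 1 - 2 * (\<Sum>i\<in>I. A i p * A i q) else 0) + (\<Sum>i\<in>I. A i p * A i q)\<^sup>2)"
      by (intro sum.cong refl) (auto simp: r_def power2_eq_square algebra_simps)
    also have "\<dots> = 1 - 2 * (\<Sum>i\<in>I. A i p * A i p) + (\<Sum>i\<in>I. (A i p)\<^sup>2)"
      using p fin by (simp add: sum.distrib sq)
    finally show ?thesis
      by (simp add: power2_eq_square)
  qed
  have "(\<Sum>p\<in>K. \<Sum>q\<in>K. (r p q)\<^sup>2) = (\<Sum>p\<in>K. 1 - (\<Sum>i\<in>I. (A i p)\<^sup>2))"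
    using * by simp
  also have "\<dots> = real (card K) - (\<Sum>i\<in>I. \<Sum>p\<in>K. (A i p)\<^sup>2)"
    by (subst sum.swap) (simp add: sum_subtractf)
  also have "(\<Sum>i\<in>I. \<Sum>p\<in>K. (A i p)\<^sup>2) = (\<Sum>i\<in>I. 1)"
    using ortho by (intro sum.cong refl) (simp add: power2_eq_square)
  finally have "(\<Sum>p\<in>K. \<Sum>q\<in>K. (r p q)\<^sup>2) = 0"
    using card by simp
  then have "(\<Sum>q\<in>K. (r k q)\<^sup>2) = 0"
    using k fin by (subst (asm) sum_nonneg_eq_0_iff) (auto intro: sum_nonneg)
  then have "(r k k')\<^sup>2 = 0"
    using k' fin by (subst (asm) sum_nonneg_eq_0_iff) auto
  then show ?thesis
    by (simp add: r_def)
qed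

lemma set_integral_sum:
  fixes f :: "'i \<Rightarrow> 'a \<Rightarrow> real"
  assumes "\<And>i. i \<in> I \<Longrightarrow> set_integrable M A (f i)"
  shows "(LINT x:A|M. (\<Sum>i\<in>I. f i x)) = (\<Sum>i\<in>I. LINT x:A|M. f i x)"
  using assms unfolding set_lebesgue_integral_def set_integrable_def
  by (simp add: sum_distrib_left)

lemma abs_set_integral_le:
  fixes f h :: "'a \<Rightarrow> real"
  assumes "set_integrable M A f" "set_integrable M A h" "\<And>x. x \<in> A \<Longrightarrow> \<bar>f x\<bar> \<le> h x"
  shows "\<bar>LINT x:A|M. f x\<bar> \<le> (LINT x:A|M. h x)"
proof -
  have "(LINT x:A|M. f x) \<le> (LINT x:A|M. h x)"
    using assms by (intro set_integral_mono) (auto intro: abs_le_D1)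
  moreover have "(LINT x:A|M. - h x) \<le> (LINT x:A|M. f x)"
  proof (intro set_integral_mono assms)
    show "set_integrable M A (\<lambda>x. - h x)"
      using assms(2) by (simp add: set_integrable_def)
    show "- h x \<le> f x" if "x \<in> A" for x
      using assms(3)[OF that] by linarith
  qed
  moreover have "(LINT x:A|M. - h x) = - (LINT x:A|M. h x)"
    by (simp add: set_lebesgue_integral_def)
  ultimately show ?thesis by linarith
qed

lemma l2_inner_sum_left:
  assumes "\<And>i. i \<in> I \<Longrightarrow> set_integrable lborel A (\<lambda>x. f i x * k x)"
  shows "l2_inner A (\<lambda>x. \<Sum>i\<in>I. c i * f i x) k = (\<Sum>i\<in>I. c i * l2_inner A (f i) k)"
proof -
  have "l2_inner A (\<lambda>x. \<Sum>i\<in>I. c i * f i x) k = (LINT x:A|lborel. (\<Sum>i\<in>I. c i * (f i x * k x)))"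
    unfolding l2_inner_def by (simp add: sum_distrib_right mult.assoc)
  also have "\<dots> = (\<Sum>i\<in>I. LINT x:A|lborel. c i * (f i x * k x))"
    using assms by (intro set_integral_sum set_integrable_mult_right) auto
  finally show ?thesis
    by (simp add: l2_inner_def)
qed

lemma l2_inner_commute: "l2_inner A f g = l2_inner A g f"
  by (simp add: l2_inner_def mult.commute)

lemma l2_inner_cong:
  assumes "A \<in> sets borel" "\<And>x. x \<in> A \<Longrightarrow> f x = f' x" "\<And>x. x \<in> A \<Longrightarrow> g x = g' x"
  shows "l2_inner A f g = l2_inner A f' g'"
  unfolding l2_inner_def using assms by (intro set_lebesgue_integral_cong) auto

section \<open>Continuity, support and size of the one-dimensional functions\<close>

locale cdv =
  fixes B :: wavelet_system
  assumes cdv: "cdv_wavelets B" and regularity_pos: "0 < regularity B"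
begin

abbreviation "N \<equiv> regularity B"
abbreviation "J0 \<equiv> coarse_level B"
abbreviation "w \<equiv> wavelet1 B"

lemma
  shows J0_pos: "1 \<le> J0" and two_N_le: "2 * N \<le> 2 ^ J0"
    and daubechies: "daubechies_pair N (generator B False) (generator B True)"
    and left_False: "\<And>k. k < N \<Longrightarrow> \<exists>q. degree q < N \<and> (\<forall>x\<ge>0. left_edge B False k x
           = (\<Sum>m\<in>{1 - int N..int N - 1}. poly q (of_int m) * generator B False (x - of_int m)))"
    and right_False: "\<And>k. k < N \<Longrightarrow> \<exists>q. degree q < N \<and> (\<forall>x\<le>0. right_edge B False k x
           = (\<Sum>m\<in>{- int N..int N - 2}. poly q (of_int m) * generator B False (x - of_int m)))"
    and edge_True: "\<exists>R. \<forall>k<N. (\<forall>x>R. left_edge B True k x = 0) \<and> (\<forall>x. x < - R \<longrightarrow> right_edge B True k x = 0)"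
    and orthonormal1: "\<And>l a b k k'. J0 \<le> l \<Longrightarrow> k < 2 ^ l \<Longrightarrow> k' < 2 ^ l \<Longrightarrow>
        l2_inner {0..1} (w a l k) (w b l k') = (if a = b \<and> k = k' then 1 else 0)"
    and in_scaling_space_Suc: "\<And>l a k. J0 \<le> l \<Longrightarrow> k < 2 ^ l \<Longrightarrow> in_scaling_space B (Suc l) (w a l k)"
    and in_scaling_space_power: "\<And>l p. J0 \<le> l \<Longrightarrow> p < N \<Longrightarrow> in_scaling_space B l (\<lambda>x. x ^ p)"
  using cdv by (simp_all add: cdv_wavelets_def Let_def)

lemma generator_continuous: "continuous_on UNIV (generator B a)"
  and generator_support: "x \<notin> {1 - real N..real N} \<Longrightarrow> generator B a x = 0"
  using daubechies by (cases a; simp add: daubechies_pair_def)+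

lemma two_N_le_power: "J0 \<le> l \<Longrightarrow> 2 * N \<le> 2 ^ l"
  using two_N_le power_increasing[of J0 l "2::nat"] by linarith

lemma wavelet1_left: "k < N \<Longrightarrow> w a l k x = 2 powr (real l / 2) * left_edge B a k (2 ^ l * x)"
  by (simp add: wavelet1_def)

lemma wavelet1_mid: "N \<le> k \<Longrightarrow> k < 2 ^ l - N \<Longrightarrow>
    w a l k x = 2 powr (real l / 2) * generator B a (2 ^ l * x - real k)"
  by (simp add: wavelet1_def)

lemma wavelet1_right:
  assumes "J0 \<le> l" "k' < N" "k = 2 ^ l - 1 - k'"
  shows "w a l k x = 2 powr (real l / 2) * right_edge B a k' (2 ^ l * (x - 1))"
proof -
  have "\<not> k < N" "\<not> k < 2 ^ l - N" "2 ^ l - 1 - k = k'"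
    using assms(2,3) two_N_le_power[OF assms(1)] by auto
  then show ?thesis by (simp add: wavelet1_def)
qed

lemma index_cases:
  assumes "J0 \<le> l" "k < 2 ^ l"
  obtains "k < N" | "N \<le> k" "k < 2 ^ l - N" | k' where "k' < N" "k = 2 ^ l - 1 - k'"
proof -
  have "k = 2 ^ l - 1 - (2 ^ l - 1 - k)" "\<not> k < 2 ^ l - N \<Longrightarrow> 2 ^ l - 1 - k < N"
    using assms regularity_pos by auto
  then show ?thesis
    using that by (metis not_less)
qed

lemma generator_comp_continuous:
  assumes "continuous_on S h" shows "continuous_on S (\<lambda>x. generator B a (h x))"
  using continuous_on_compose2[OF generator_continuous assms] by simp

lemma wavelet1_False_continuous:
  assumes l: "J0 \<le> l" and k: "k < 2 ^ l"
  shows "continuous_on {0..1} (w False l k)"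
proof (cases rule: index_cases[OF l k])
  case 1
  obtain q where q: "\<forall>x\<ge>0. left_edge B False k x
           = (\<Sum>m\<in>{1 - int N..int N - 1}. poly q (of_int m) * generator B False (x - of_int m))"
    using left_False[OF 1] by blast
  have "continuous_on {0..1} (\<lambda>x. 2 powr (real l / 2) *
      (\<Sum>m\<in>{1 - int N..int N - 1}. poly q (of_int m) * generator B False (2 ^ l * x - of_int m)))"
    by (intro continuous_intros generator_comp_continuous)
  then show ?thesis
    by (rule continuous_on_cong[THEN iffD1, rotated -1]) (auto simp: wavelet1_left[OF 1] q)
next
  case 2
  have "continuous_on {0..1} (\<lambda>x. 2 powr (real l / 2) * generator B False (2 ^ l * x - real k))"
    by (intro continuous_intros generator_comp_continuous)
  then show ?thesis
    by (rule continuous_on_cong[THEN iffD1, rotated -1]) (auto simp: wavelet1_mid[OF 2])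
next
  case (3 k')
  obtain q where q: "\<forall>x\<le>0. right_edge B False k' x
           = (\<Sum>m\<in>{- int N..int N - 2}. poly q (of_int m) * generator B False (x - of_int m))"
    using right_False[OF 3(1)] by blast
  have "continuous_on {0..1} (\<lambda>x. 2 powr (real l / 2) *
      (\<Sum>m\<in>{- int N..int N - 2}. poly q (of_int m) * generator B False (2 ^ l * (x - 1) - of_int m)))"
    by (intro continuous_intros generator_comp_continuous)
  then show ?thesis
    by (rule continuous_on_cong[THEN iffD1, rotated -1])
      (auto simp: wavelet1_right[OF l 3] q mult_nonneg_nonpos)
qed

text \<open>The edge wavelets come without a formula. They lie in the next scaling space, hence are
  finite combinations of functions whose continuity is already known.\<close>

lemma wavelet1_continuous:
  assumes l: "J0 \<le> l" and k: "k < 2 ^ l"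
  shows "continuous_on {0..1} (w a l k)"
proof -
  obtain c where c: "\<forall>x\<in>{0..1}. w a l k x = (\<Sum>i<2 ^ Suc l. c i * w False (Suc l) i x)"
    using in_scaling_space_Suc[OF l k, of a] unfolding in_scaling_space_def by blast
  have "continuous_on {0..1} (\<lambda>x. \<Sum>i<2 ^ Suc l. c i * w False (Suc l) i x)"
    using l by (intro continuous_intros wavelet1_False_continuous) auto
  then show ?thesis
    by (rule continuous_on_cong[THEN iffD1, rotated -1]) (auto simp: c)
qed

lemma edge_support:
  "\<exists>R\<ge>0. \<forall>a. \<forall>k<N. (\<forall>x>R. left_edge B a k x = 0) \<and> (\<forall>x. x < - R \<longrightarrow> right_edge B a k x = 0)"
proof -
  obtain R where R: "\<And>k x. k < N \<Longrightarrow> x > R \<Longrightarrow> left_edge B True k x = 0"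
      "\<And>k x. k < N \<Longrightarrow> x < - R \<Longrightarrow> right_edge B True k x = 0"
    using edge_True by blast
  \<comment> \<open>An edge scaling function uses translates by at most \<open>N - 1\<close> of a
    generator supported up to \<open>N\<close>, so it vanishes beyond \<open>2 * N\<close>;
    \<open>R\<close> does the same for the edge wavelets.\<close>
  define R' where "R' = max R (2 * real N)"
  have L: "left_edge B False k x = 0" if k: "k < N" and x: "x > R'" for k x
  proof -
    have x': "x > 2 * real N" using x by (simp add: R'_def)
    obtain q where q: "\<forall>x\<ge>0. left_edge B False k x
           = (\<Sum>m\<in>{1 - int N..int N - 1}. poly q (of_int m) * generator B False (x - of_int m))"
      using left_False[OF k] by blast
    have "left_edge B False k x = (\<Sum>m\<in>{1 - int N..int N - 1}. poly q (of_int m) * generator B False (x - of_int m))"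
      using q x' by auto
    also have "\<dots> = 0"
    proof (intro sum.neutral ballI)
      fix m assume "m \<in> {1 - int N..int N - 1}"
      then have "real_of_int m \<le> real N - 1" by (simp; linarith)
      then have "x - of_int m \<notin> {1 - real N..real N}" using x' by auto
      then show "poly q (of_int m) * generator B False (x - of_int m) = 0"
        by (simp add: generator_support)
    qed
    finally show ?thesis .
  qed
  have Rt: "right_edge B False k x = 0" if k: "k < N" and x: "x < - R'" for k x
  proof -
    have x': "x < - 2 * real N" using x by (simp add: R'_def)
    obtain q where q: "\<forall>x\<le>0. right_edge B False k x
           = (\<Sum>m\<in>{- int N..int N - 2}. poly q (of_int m) * generator B False (x - of_int m))"
      using right_False[OF k] by blast
    have "right_edge B False k x = (\<Sum>m\<in>{- int N..int N - 2}. poly q (of_int m) * generator B False (x - of_int m))"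
      using q x' by auto
    also have "\<dots> = 0"
    proof (intro sum.neutral ballI)
      fix m assume "m \<in> {- int N..int N - 2}"
      then have "real_of_int m \<ge> - real N" by (simp; linarith)
      then have "x - of_int m \<notin> {1 - real N..real N}" using x' by auto
      then show "poly q (of_int m) * generator B False (x - of_int m) = 0"
        by (simp add: generator_support)
    qed
    finally show ?thesis .
  qed
  show ?thesis
  proof (intro exI[of _ R'] conjI allI impI)
    fix a k x assume "k < N" "R' < x"
    then show "left_edge B a k x = 0"
      using L R(1) by (cases a) (auto simp: R'_def)
  next
    fix a k x assume "k < N" "x < - R'"
    then show "right_edge B a k x = 0"
      using Rt R(2) by (cases a) (auto simp: R'_def)
  qed (simp add: R'_def)
qed

lemma generator_bounded: "\<exists>A. \<forall>x. \<bar>generator B a x\<bar> \<le> A"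
proof -
  obtain A where A: "\<forall>x\<in>{1 - real N..real N}. \<bar>generator B a x\<bar> \<le> A"
    using continuous_on_bounded_Icc continuous_on_subset[OF generator_continuous] by (meson subset_UNIV)
  have "\<bar>generator B a x\<bar> \<le> max A 0" for x
    using A by (cases "x \<in> {1 - real N..real N}") (auto simp: generator_support le_max_iff_disj)
  then show ?thesis by blast
qed

text \<open>An edge wavelet is accessible only through \<open>w a l k\<close> on the unit interval.
  At a level with \<open>2 ^ l\<close> beyond the support radius the whole half-line profile is
  visible there, and continuity on a compact interval bounds it.\<close>

lemma left_edge_bounded:
  assumes k: "k < N"
  shows "\<exists>A. \<forall>x\<ge>0. \<bar>left_edge B a k x\<bar> \<le> A"
proof -
  obtain R where R: "\<And>x. x > R \<Longrightarrow> left_edge B a k x = 0"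
    using edge_support k by blast
  obtain l0 where l0: "R < 2 ^ l0"
    using real_arch_pow[of 2 R] by auto
  define l where "l = max l0 J0"
  have l: "J0 \<le> l" "R < 2 ^ l"
    using l0 by (auto simp: l_def intro: less_le_trans[OF _ power_increasing[of l0 _ "2::real"]])
  have k2: "k < 2 ^ l" using two_N_le_power[OF l(1)] k by linarith
  obtain A where A: "\<forall>x\<in>{0..1}. \<bar>w a l k x\<bar> \<le> A"
    using continuous_on_bounded_Icc[OF wavelet1_continuous[OF l(1) k2]] by blast
  have "\<bar>left_edge B a k x\<bar> \<le> max 0 (A / 2 powr (real l / 2))" if "x \<ge> 0" for x
  proof (cases "x > R")
    case False
    then have "x / 2 ^ l \<in> {0..1}" using that l by (auto simp: field_simps)
    then have "\<bar>w a l k (x / 2 ^ l)\<bar> \<le> A" using A by blast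
    then show ?thesis
      unfolding wavelet1_left[OF k] by (auto simp: abs_mult field_simps le_max_iff_disj)
  qed (simp add: R)
  then show ?thesis by blast
qed

lemma right_edge_bounded:
  assumes k: "k < N"
  shows "\<exists>A. \<forall>x\<le>0. \<bar>right_edge B a k x\<bar> \<le> A"
proof -
  obtain R where R: "\<And>x. x < - R \<Longrightarrow> right_edge B a k x = 0"
    using edge_support k by blast
  obtain l0 where l0: "R < 2 ^ l0"
    using real_arch_pow[of 2 R] by auto
  define l where "l = max l0 J0"
  have l: "J0 \<le> l" "R < 2 ^ l"
    using l0 by (auto simp: l_def intro: less_le_trans[OF _ power_increasing[of l0 _ "2::real"]])
  have k2: "2 ^ l - 1 - k < (2::nat) ^ l" by (simp add: less_imp_diff_less)
  obtain A where A: "\<forall>x\<in>{0..1}. \<bar>w a l (2 ^ l - 1 - k) x\<bar> \<le> A"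
    using continuous_on_bounded_Icc[OF wavelet1_continuous[OF l(1) k2]] by blast
  have "\<bar>right_edge B a k x\<bar> \<le> max 0 (A / 2 powr (real l / 2))" if "x \<le> 0" for x
  proof (cases "x < - R")
    case False
    then have "1 + x / 2 ^ l \<in> {0..1}" using that l by (auto simp: field_simps)
    then have "\<bar>w a l (2 ^ l - 1 - k) (1 + x / 2 ^ l)\<bar> \<le> A" using A by blast
    then show ?thesis
      unfolding wavelet1_right[OF l(1) k refl] by (auto simp: abs_mult field_simps le_max_iff_disj)
  qed (simp add: R)
  then show ?thesis by blast
qed

text \<open>All levels are dilations of finitely many profiles: two generators and the edge
  functions at both ends. This makes the constant independent of the level.\<close>

lemma wavelet1_bounded:
  "\<exists>A\<ge>0. \<forall>a. \<forall>l\<ge>J0. \<forall>k<2 ^ l. \<forall>x\<in>{0..1}. \<bar>w a l k x\<bar> \<le> A * 2 powr (real l / 2)"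
proof -
  obtain G where G: "\<And>a x. \<bar>generator B a x\<bar> \<le> G a"
    using generator_bounded by metis
  have "\<forall>a k. \<exists>A. k < N \<longrightarrow> (\<forall>x\<ge>0. \<bar>left_edge B a k x\<bar> \<le> A)"
    using left_edge_bounded by blast
  then obtain L where L: "\<And>a k x. k < N \<Longrightarrow> x \<ge> 0 \<Longrightarrow> \<bar>left_edge B a k x\<bar> \<le> L a k"
    by metis
  have "\<forall>a k. \<exists>A. k < N \<longrightarrow> (\<forall>x\<le>0. \<bar>right_edge B a k x\<bar> \<le> A)"
    using right_edge_bounded by blast
  then obtain R where R: "\<And>a k x. k < N \<Longrightarrow> x \<le> 0 \<Longrightarrow> \<bar>right_edge B a k x\<bar> \<le> R a k"
    by metis
  define A where "A = (\<Sum>a\<in>UNIV. \<bar>G a\<bar> + (\<Sum>k<N. \<bar>L a k\<bar> + \<bar>R a k\<bar>))"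
  have A1: "\<bar>G a\<bar> + (\<Sum>k<N. \<bar>L a k\<bar> + \<bar>R a k\<bar>) \<le> A" for a
    unfolding A_def by (rule member_le_sum) (auto intro!: add_nonneg_nonneg sum_nonneg)
  have A2: "\<bar>L a k\<bar> + \<bar>R a k\<bar> \<le> (\<Sum>k<N. \<bar>L a k\<bar> + \<bar>R a k\<bar>)" if "k < N" for a k
    by (rule member_le_sum) (use that in auto)
  have A3: "0 \<le> (\<Sum>k<N. \<bar>L a k\<bar> + \<bar>R a k\<bar>)" for a by (intro sum_nonneg) auto
  have "\<bar>w a l k x\<bar> \<le> A * 2 powr (real l / 2)"
    if l: "J0 \<le> l" and k: "k < 2 ^ l" and x: "x \<in> {0..1}" for a l k x
  proof (cases rule: index_cases[OF l k])
    case 1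
    have "\<bar>left_edge B a k (2 ^ l * x)\<bar> \<le> A"
      using L[OF 1, of "2 ^ l * x" a] x A1[of a] A2[OF 1, of a] by auto
    then show ?thesis by (simp add: wavelet1_left[OF 1] abs_mult mult.commute)
  next
    case 2
    have "\<bar>generator B a (2 ^ l * x - real k)\<bar> \<le> A"
      using G[of a "2 ^ l * x - real k"] A1[of a] A3[of a] by auto
    then show ?thesis by (simp add: wavelet1_mid[OF 2] abs_mult mult.commute)
  next
    case (3 k')
    have "\<bar>right_edge B a k' (2 ^ l * (x - 1))\<bar> \<le> A"
      using R[OF 3(1), of "2 ^ l * (x - 1)" a] x A1[of a] A2[OF 3(1), of a]
      by (auto simp: mult_nonneg_nonpos)
    then show ?thesis by (simp add: wavelet1_right[OF l 3] abs_mult mult.commute)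
  qed
  moreover have "0 \<le> A" unfolding A_def by (intro sum_nonneg add_nonneg_nonneg) auto
  ultimately show ?thesis by blast
qed

lemma wavelet1_support:
  "\<exists>R::nat. \<forall>a. \<forall>l\<ge>J0. \<forall>k<2 ^ l. \<forall>x\<in>{0..1}. w a l k x \<noteq> 0 \<longrightarrow> \<bar>2 ^ l * x - real k\<bar> \<le> real R"
proof -
  obtain R0 where R0: "R0 \<ge> 0" "\<And>a k x. k < N \<Longrightarrow> x > R0 \<Longrightarrow> left_edge B a k x = 0"
      "\<And>a k x. k < N \<Longrightarrow> x < - R0 \<Longrightarrow> right_edge B a k x = 0"
    using edge_support by blast
  define R where "R = nat \<lceil>R0\<rceil> + N"
  have R: "R0 + real N \<le> real R" unfolding R_def using R0(1) by linarith
  have "\<bar>2 ^ l * x - real k\<bar> \<le> real R"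
    if l: "J0 \<le> l" and k: "k < 2 ^ l" and x: "x \<in> {0..1}" and nz: "w a l k x \<noteq> 0" for a l k x
  proof (cases rule: index_cases[OF l k])
    case 1
    have "2 ^ l * x \<le> R0" using nz R0(2)[OF 1, of "2 ^ l * x" a]
      by (auto simp: wavelet1_left[OF 1] not_less[symmetric])
    moreover have "0 \<le> 2 ^ l * x" using x by simp
    ultimately show ?thesis using R 1 by (simp add: abs_le_iff)
  next
    case 2
    have "2 ^ l * x - real k \<in> {1 - real N..real N}"
      using nz generator_support[of "2 ^ l * x - real k" a] by (auto simp: wavelet1_mid[OF 2])
    then show ?thesis using R R0(1) by (auto simp: abs_le_iff)
  next
    case (3 k')
    have "2 ^ l * (x - 1) \<ge> - R0" using nz R0(3)[OF 3(1), of "2 ^ l * (x - 1)" a]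
      by (auto simp: wavelet1_right[OF l 3] not_less[symmetric])
    moreover have "2 ^ l * (x - 1) \<le> 0" using x by (auto simp: mult_nonneg_nonpos)
    \<comment> \<open>Right edge functions are counted from the right end starting at 0, so
      \<open>k\<close> and \<open>k'\<close> add up to \<open>2 ^ l - 1\<close>; the subtraction on
      \<open>nat\<close> is not truncated here.\<close>
    moreover have "real k = 2 ^ l - 1 - real k'"
    proof -
      have "k + 1 + k' = 2 ^ l" using 3 k two_N_le_power[OF l] by auto
      then have "real (k + 1 + k') = 2 ^ l" by simp
      then show ?thesis by simp
    qed
    moreover have "2 ^ l * x - real k = 2 ^ l * (x - 1) + 1 + real k'"
      using calculation by (simp add: algebra_simps)
    ultimately show ?thesis using R 3(1) unfolding abs_le_iff by linarith
  qed
  then show ?thesis by blast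
qed

text \<open>Everything follows from height \<open>A * 2 powr (l / 2)\<close> and support within
  \<open>R\<close> index units of \<open>k\<close>. One constant for all four bounds keeps the later
  constants powers of \<open>Q\<close>.\<close>

lemma wavelet1_bounds:
  "\<exists>Q\<ge>1. \<forall>l\<ge>J0. \<forall>a.
     (\<forall>x\<in>{0..1}. (\<Sum>k<2 ^ l. \<bar>w a l k x\<bar>) \<le> Q * 2 powr (real l / 2)) \<and>
     (\<forall>k<2 ^ l. (LINT x:{0..1}|lborel. \<bar>w a l k x\<bar>) \<le> Q * 2 powr (- (real l / 2)) \<and>
       real (card {k'. k' < 2 ^ l \<and> (\<exists>x\<in>{0..1}. w a l k x \<noteq> 0 \<and> w a l k' x \<noteq> 0)}) \<le> Q \<and>
       (\<forall>x\<in>{0..1}. \<forall>y\<in>{0..1}. w a l k x \<noteq> 0 \<longrightarrow> w a l k y \<noteq> 0 \<longrightarrow> \<bar>x - y\<bar> \<le> Q / 2 ^ l))"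
proof -
  obtain A where A: "A \<ge> 0" "\<And>a l k x. J0 \<le> l \<Longrightarrow> k < 2 ^ l \<Longrightarrow> x \<in> {0..1} \<Longrightarrow> \<bar>w a l k x\<bar> \<le> A * 2 powr (real l / 2)"
    using wavelet1_bounded by blast
  obtain R :: nat where R: "\<And>a l k x. J0 \<le> l \<Longrightarrow> k < 2 ^ l \<Longrightarrow> x \<in> {0..1} \<Longrightarrow> w a l k x \<noteq> 0 \<Longrightarrow> \<bar>2 ^ l * x - real k\<bar> \<le> real R"
    using wavelet1_support by blast
  have cnt: "finite {k::nat. \<bar>y - real k\<bar> \<le> real r}" "card {k::nat. \<bar>y - real k\<bar> \<le> real r} \<le> 2 * r + 1" for y r
  proof -
    have sub: "int ` {k::nat. \<bar>y - real k\<bar> \<le> real r} \<subseteq> {\<lceil>y\<rceil> - int r .. \<lceil>y\<rceil> + int r}"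
      by (auto; linarith)
    have inj: "inj_on int X" for X by auto
    show fin: "finite {k::nat. \<bar>y - real k\<bar> \<le> real r}"
      using finite_subset[OF sub] finite_imageD[OF _ inj] by auto
    have "card {k::nat. \<bar>y - real k\<bar> \<le> real r} = card (int ` {k::nat. \<bar>y - real k\<bar> \<le> real r})"
      by (simp add: card_image)
    also have "\<dots> \<le> card {\<lceil>y\<rceil> - int r .. \<lceil>y\<rceil> + int r}"
      by (intro card_mono sub) auto
    finally show "card {k::nat. \<bar>y - real k\<bar> \<le> real r} \<le> 2 * r + 1" by simp
  qed
  \<comment> \<open>Two supports can meet only if the indices differ by at most
    \<open>2 * R\<close>, which leaves \<open>4 * R + 1\<close> indices; the factor
    \<open>A + 1\<close> pays for the heights in the sum and in the integral.\<close>
  define Q where "Q = (4 * real R + 1) * (A + 1)"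
  have Q1: "4 * real R + 1 \<le> Q" "1 \<le> Q" and Q2: "(4 * real R + 1) * A \<le> Q"
    using mult_left_mono[of 1 "A + 1" "4 * real R + 1"] A(1) by (auto simp: Q_def distrib_left)
  show ?thesis
  proof (intro exI[of _ Q] conjI allI impI ballI)
    fix l a x assume l: "J0 \<le> l" and x: "x \<in> {0..1::real}"
    let ?S = "{k. k < 2 ^ l \<and> w a l k x \<noteq> 0}"
    have "(\<Sum>k<2 ^ l. \<bar>w a l k x\<bar>) = (\<Sum>k\<in>?S. \<bar>w a l k x\<bar>)"
      by (intro sum.mono_neutral_right) auto
    also have "\<dots> \<le> (\<Sum>k\<in>?S. A * 2 powr (real l / 2))"
      using A(2)[OF l _ x] by (intro sum_mono) auto
    also have "\<dots> = real (card ?S) * (A * 2 powr (real l / 2))" by simp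
    also have "\<dots> \<le> (4 * real R + 1) * (A * 2 powr (real l / 2))"
    proof (intro mult_right_mono)
      have "card ?S \<le> card {k::nat. \<bar>2 ^ l * x - real k\<bar> \<le> real R}"
        using R[OF l _ x] by (intro card_mono cnt) auto
      also have "\<dots> \<le> 2 * R + 1" by (rule cnt)
      finally show "real (card ?S) \<le> 4 * real R + 1" by linarith
    qed (use A in auto)
    also have "\<dots> \<le> Q * 2 powr (real l / 2)"
      using mult_right_mono[OF Q2, of "2 powr (real l / 2)"] by (simp add: mult_ac)
    finally show "(\<Sum>k<2 ^ l. \<bar>w a l k x\<bar>) \<le> Q * 2 powr (real l / 2)" .
  next
    fix l a k assume l: "J0 \<le> l" and k: "k < (2::nat) ^ l"
    let ?I = "{(real k - real R) / 2 ^ l .. (real k + real R) / 2 ^ l}"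
    have "(LINT x:{0..1}|lborel. \<bar>w a l k x\<bar>) \<le> (LINT x|lborel. indicator ?I x * (A * 2 powr (real l / 2)))"
      unfolding set_lebesgue_integral_def
    proof (intro integral_mono)
      show "integrable lborel (\<lambda>x. indicator {0..1} x *\<^sub>R \<bar>w a l k x\<bar>)"
        using borel_integrable_atLeastAtMost'[of 0 1 "\<lambda>x. \<bar>w a l k x\<bar>"] wavelet1_continuous[OF l k, of a]
        unfolding set_integrable_def by (simp add: continuous_on_rabs)
      show "integrable lborel (\<lambda>x. indicator ?I x * (A * 2 powr (real l / 2)))"
        by (intro integrable_mult_left integrable_real_indicator)
          (auto simp: emeasure_lborel_Icc_eq)
      fix x :: real
      show "indicator {0..1} x *\<^sub>R \<bar>w a l k x\<bar> \<le> indicator ?I x * (A * 2 powr (real l / 2))"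
        using A R[OF l k, of x a]
        by (cases "x \<in> {0..1}"; cases "w a l k x = 0"; auto simp: indicator_def abs_le_iff field_simps l k)
    qed
    also have "\<dots> = 2 * real R / 2 ^ l * (A * 2 powr (real l / 2))"
      by (simp add: field_simps)
    also have "\<dots> = (2 * real R * A) * 2 powr (- (real l / 2))"
    proof -
      have "2 powr (real l / 2) * (2 powr (real l / 2)) = 2 ^ l"
        by (simp add: powr_add[symmetric] powr_realpow)
      then show ?thesis by (simp add: powr_minus field_simps)
    qed
    also have "\<dots> \<le> Q * 2 powr (- (real l / 2))"
    proof (intro mult_right_mono)
      have "2 * real R * A \<le> (4 * real R + 1) * A" using A by (intro mult_right_mono) auto
      then show "2 * real R * A \<le> Q" using Q2 by linarith
    qed auto
    finally show "(LINT x:{0..1}|lborel. \<bar>w a l k x\<bar>) \<le> Q * 2 powr (- (real l / 2))" .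
  next
    fix l a k assume l: "J0 \<le> l" and k: "k < (2::nat) ^ l"
    have "card {k'. k' < 2 ^ l \<and> (\<exists>x\<in>{0..1}. w a l k x \<noteq> 0 \<and> w a l k' x \<noteq> 0)}
        \<le> card {k'::nat. \<bar>real k - real k'\<bar> \<le> real (2 * R)}"
    proof (intro card_mono cnt subsetI)
      fix k' assume "k' \<in> {k'. k' < 2 ^ l \<and> (\<exists>x\<in>{0..1}. w a l k x \<noteq> 0 \<and> w a l k' x \<noteq> 0)}"
      then obtain x where "k' < 2 ^ l" "x \<in> {0..1}" "w a l k x \<noteq> 0" "w a l k' x \<noteq> 0" by auto
      then have "\<bar>2 ^ l * x - real k\<bar> \<le> real R" "\<bar>2 ^ l * x - real k'\<bar> \<le> real R"
        using R l k by auto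
      then show "k' \<in> {k'. \<bar>real k - real k'\<bar> \<le> real (2 * R)}" by (simp; linarith)
    qed
    also have "\<dots> \<le> 2 * (2 * R) + 1" by (rule cnt)
    finally show "real (card {k'. k' < 2 ^ l \<and> (\<exists>x\<in>{0..1}. w a l k x \<noteq> 0 \<and> w a l k' x \<noteq> 0)}) \<le> Q"
      using Q1 by linarith
  next
    fix l a k and x y :: real
    assume l: "J0 \<le> l" and k: "k < (2::nat) ^ l" and xy: "x \<in> {0..1}" "y \<in> {0..1}" "w a l k x \<noteq> 0" "w a l k y \<noteq> 0"
    have "\<bar>2 ^ l * x - real k\<bar> \<le> real R" "\<bar>2 ^ l * y - real k\<bar> \<le> real R"
      using R l k xy by auto
    then have "\<bar>2 ^ l * x - 2 ^ l * y\<bar> \<le> Q" using Q1 by linarith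
    moreover have "\<bar>2 ^ l * x - 2 ^ l * y\<bar> = 2 ^ l * \<bar>x - y\<bar>"
      by (simp add: right_diff_distrib[symmetric] abs_mult)
    ultimately show "\<bar>x - y\<bar> \<le> Q / 2 ^ l" by (simp add: field_simps)
  qed (use Q1 in auto)
qed

lemma w_integrable:
  assumes "continuous_on {0..1} h" "continuous_on {0..1} h'"
  shows "set_integrable lborel {0..1} (\<lambda>x::real. h x * h' x :: real)"
  by (intro borel_integrable_atLeastAtMost' continuous_intros assms)

section \<open>Scaling spaces: reproduction, orthogonality, nesting, two-scale kernel\<close>

lemma scaling_space_reproduce:
  assumes l: "J0 \<le> l" and h: "in_scaling_space B l h" and x: "x \<in> {0..1}"
  shows "h x = (\<Sum>k<2 ^ l. l2_inner {0..1} h (w False l k) * w False l k x)"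
proof -
  obtain c where c: "\<forall>x\<in>{0..1}. h x = (\<Sum>k<2 ^ l. c k * w False l k x)"
    using h unfolding in_scaling_space_def by blast
  have "l2_inner {0..1} h (w False l k) = c k" if k: "k < 2 ^ l" for k
  proof -
    have "l2_inner {0..1} h (w False l k) = l2_inner {0..1} (\<lambda>x. \<Sum>k<2 ^ l. c k * w False l k x) (w False l k)"
      using c by (intro l2_inner_cong) auto
    also have "\<dots> = (\<Sum>i<2 ^ l. c i * l2_inner {0..1} (w False l i) (w False l k))"
      using l k by (intro l2_inner_sum_left w_integrable wavelet1_continuous) auto
    also have "\<dots> = (\<Sum>i<2 ^ l. if i = k then c i else 0)"
      using l k by (intro sum.cong refl) (auto simp: orthonormal1)
    finally show ?thesis using k by simp
  qed
  then show ?thesis using c x by simp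
qed

lemma scaling_space_orthogonal:
  assumes l: "J0 \<le> l" and h: "in_scaling_space B l h" and k: "k < 2 ^ l"
  shows "l2_inner {0..1} h (w True l k) = 0"
proof -
  obtain c where c: "\<forall>x\<in>{0..1}. h x = (\<Sum>k<2 ^ l. c k * w False l k x)"
    using h unfolding in_scaling_space_def by blast
  have "l2_inner {0..1} h (w True l k) = l2_inner {0..1} (\<lambda>x. \<Sum>k<2 ^ l. c k * w False l k x) (w True l k)"
    using c by (intro l2_inner_cong) auto
  also have "\<dots> = (\<Sum>i<2 ^ l. c i * l2_inner {0..1} (w False l i) (w True l k))"
    using l k by (intro l2_inner_sum_left w_integrable wavelet1_continuous) auto
  also have "\<dots> = 0"
    using l k by (intro sum.neutral) (auto simp: orthonormal1)
  finally show ?thesis .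
qed

lemma scaling_space_mono_Suc:
  assumes l: "J0 \<le> l" and h: "in_scaling_space B l h"
  shows "in_scaling_space B (Suc l) h"
proof -
  obtain c where c: "\<forall>x\<in>{0..1}. h x = (\<Sum>k<2 ^ l. c k * w False l k x)"
    using h unfolding in_scaling_space_def by blast
  have "\<forall>k. \<exists>d. k < 2 ^ l \<longrightarrow> (\<forall>x\<in>{0..1}. w False l k x = (\<Sum>i<2 ^ Suc l. d i * w False (Suc l) i x))"
    using in_scaling_space_Suc[OF l] unfolding in_scaling_space_def by blast
  then obtain d where d: "\<And>k x. k < 2 ^ l \<Longrightarrow> x \<in> {0..1} \<Longrightarrow>
      w False l k x = (\<Sum>i<2 ^ Suc l. d k i * w False (Suc l) i x)"
    by metis
  have "h x = (\<Sum>i<2 ^ Suc l. (\<Sum>k<2 ^ l. c k * d k i) * w False (Suc l) i x)" if x: "x \<in> {0..1}" for x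
  proof -
    have "h x = (\<Sum>k<2 ^ l. c k * (\<Sum>i<2 ^ Suc l. d k i * w False (Suc l) i x))"
      using c x d by (auto intro!: sum.cong)
    also have "\<dots> = (\<Sum>k<2 ^ l. \<Sum>i<2 ^ Suc l. c k * d k i * w False (Suc l) i x)"
      by (simp add: sum_distrib_left mult_ac)
    also have "\<dots> = (\<Sum>i<2 ^ Suc l. \<Sum>k<2 ^ l. c k * d k i * w False (Suc l) i x)"
      by (rule sum.swap)
    finally show ?thesis by (simp add: sum_distrib_right)
  qed
  then show ?thesis unfolding in_scaling_space_def by (intro exI[of _ "\<lambda>i. \<Sum>k<2 ^ l. c k * d k i"] ballI)
qed

lemma scaling_space_mono:
  assumes "J0 \<le> l" "l \<le> l'" "in_scaling_space B l h"
  shows "in_scaling_space B l' h"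
  using assms(2)
proof (induction rule: dec_induct)
  case (step n)
  then show ?case using scaling_space_mono_Suc assms(1) by simp
qed (rule assms(3))

lemma wavelet1_scaling_space:
  assumes "J0 \<le> l" "l < l'" "k < 2 ^ l"
  shows "in_scaling_space B l' (w a l k)"
  using scaling_space_mono[of "Suc l" l'] in_scaling_space_Suc assms by simp

lemma scaling1_scaling_space:
  assumes "J0 \<le> l" "l \<le> l'" "k < 2 ^ l"
  shows "in_scaling_space B l' (w False l k)"
proof -
  have "in_scaling_space B l (w False l k)"
    unfolding in_scaling_space_def
  proof (intro exI[of _ "\<lambda>i. if i = k then 1 else 0"] ballI)
    fix x :: real
    have "(\<Sum>i<2 ^ l. (if i = k then 1 else 0) * w False l i x) = (\<Sum>i<2 ^ l. if i = k then w False l i x else 0)"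
      by (intro sum.cong) auto
    then show "w False l k x = (\<Sum>i<2 ^ l. (if i = k then 1 else 0) * w False l i x)"
      using assms by simp
  qed
  then show ?thesis using scaling_space_mono assms by blast
qed

lemma one_scaling_space: "J0 \<le> l \<Longrightarrow> in_scaling_space B l (\<lambda>x. 1)"
  using in_scaling_space_power[of l 0] regularity_pos by simp

text \<open>The \<open>2 * 2 ^ l\<close> functions of level \<open>l\<close>, of both types, are
  orthonormal and lie in the span of the \<open>2 ^ Suc l\<close> orthonormal scaling functions of
  the next level. The coefficient matrix \<open>A\<close> is thus square with orthonormal rows, so
  its columns are orthonormal too and both bases have the same kernel.\<close>

lemma kernel1_Suc:
  assumes l: "J0 \<le> l" and x: "x \<in> {0..1}" and y: "y \<in> {0..1}"
  shows "(\<Sum>k<2 ^ Suc l. w False (Suc l) k x * w False (Suc l) k y)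
       = (\<Sum>a\<in>UNIV. \<Sum>k<2 ^ l. w a l k x * w a l k y)"
proof -
  let ?I = "UNIV \<times> {..<(2::nat) ^ l} :: (bool \<times> nat) set" and ?K = "{..<(2::nat) ^ Suc l}"
  define A where "A i k = l2_inner {0..1} (w (fst i) l (snd i)) (w False (Suc l) k)" for i :: "bool \<times> nat" and k
  have rep: "w (fst i) l (snd i) x = (\<Sum>k\<in>?K. A i k * w False (Suc l) k x)"
    if "i \<in> ?I" "x \<in> {0..1}" for i x
    unfolding A_def using that l
    by (intro scaling_space_reproduce wavelet1_scaling_space) auto
  have ortho: "(\<Sum>k\<in>?K. A i k * A j k) = (if i = j then 1 else 0)" if ij: "i \<in> ?I" "j \<in> ?I" for i j
  proof -
    have "l2_inner {0..1} (w (fst i) l (snd i)) (w (fst j) l (snd j))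
        = l2_inner {0..1} (\<lambda>x. \<Sum>k\<in>?K. A i k * w False (Suc l) k x) (w (fst j) l (snd j))"
      using rep[OF ij(1)] by (intro l2_inner_cong) auto
    also have "\<dots> = (\<Sum>k\<in>?K. A i k * l2_inner {0..1} (w False (Suc l) k) (w (fst j) l (snd j)))"
      using l ij by (intro l2_inner_sum_left w_integrable wavelet1_continuous) auto
    also have "\<dots> = (\<Sum>k\<in>?K. A i k * A j k)"
      by (simp add: A_def l2_inner_commute[of _ "w False (Suc l) _"])
    finally show ?thesis
      using ij l by (auto simp: orthonormal1 prod_eq_iff)
  qed
  have "(\<Sum>a\<in>UNIV. \<Sum>k<2 ^ l. w a l k x * w a l k y) = (\<Sum>i\<in>?I. w (fst i) l (snd i) x * w (fst i) l (snd i) y)"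
    by (subst sum.cartesian_product) (simp add: case_prod_beta)
  also have "\<dots> = (\<Sum>i\<in>?I. (\<Sum>k\<in>?K. A i k * w False (Suc l) k x) * (\<Sum>k\<in>?K. A i k * w False (Suc l) k y))"
    using rep x y by (intro sum.cong refl arg_cong2[where f = "(*)"]) auto
  also have "\<dots> = (\<Sum>i\<in>?I. \<Sum>k\<in>?K. \<Sum>k'\<in>?K. (A i k * A i k') * (w False (Suc l) k x * w False (Suc l) k' y))"
    by (simp add: sum_product mult_ac)
  also have "\<dots> = (\<Sum>k\<in>?K. \<Sum>k'\<in>?K. (\<Sum>i\<in>?I. A i k * A i k') * (w False (Suc l) k x * w False (Suc l) k' y))"
    by (subst sum.swap, intro sum.cong refl, subst sum.swap) (simp add: sum_distrib_right)
  also have "\<dots> = (\<Sum>k\<in>?K. \<Sum>k'\<in>?K. if k = k' then w False (Suc l) k x * w False (Suc l) k' y else 0)"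
  proof (intro sum.cong refl)
    fix k k' assume kk: "k \<in> ?K" "k' \<in> ?K"
    have "(\<Sum>i\<in>?I. A i k * A i k') = (if k = k' then 1 else 0)"
      by (rule orthonormal_rows_imp_orthonormal_columns[where K = ?K]) (use kk ortho in \<open>auto simp: card_cartesian_product\<close>)
    then show "(\<Sum>i\<in>?I. A i k * A i k') * (w False (Suc l) k x * w False (Suc l) k' y)
        = (if k = k' then w False (Suc l) k x * w False (Suc l) k' y else 0)"
      by simp
  qed
  also have "\<dots> = (\<Sum>k\<in>?K. w False (Suc l) k x * w False (Suc l) k y)"
    by simp
  finally show ?thesis by simp
qed

end

subsection \<open>Tensor wavelets on the unit cube\<close>

lemma finite_vec_set:
  fixes S :: "'d::finite \<Rightarrow> 'a set"
  assumes "\<And>j. finite (S j)"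
  shows "finite {m :: 'a ^ 'd. \<forall>j. m $ j \<in> S j}"
proof -
  have "{m :: 'a ^ 'd. \<forall>j. m $ j \<in> S j} \<subseteq> vec_lambda ` (Pi\<^sub>E UNIV S)"
  proof
    fix m :: "'a ^ 'd" assume "m \<in> {m. \<forall>j. m $ j \<in> S j}"
    then show "m \<in> vec_lambda ` (Pi\<^sub>E UNIV S)"
      by (intro image_eqI[of _ _ "vec_nth m"]) auto
  qed
  then show ?thesis
    using assms by (meson finite_PiE finite_imageI finite_subset finite)
qed

lemma sum_vec_prod:
  fixes F :: "'d::finite \<Rightarrow> 'a \<Rightarrow> 'b::comm_semiring_1"
  assumes "\<And>j. finite (S j)"
  shows "(\<Sum>m\<in>{m. \<forall>j. m $ j \<in> S j}. \<Prod>j\<in>UNIV. F j (m $ j)) = (\<Prod>j\<in>UNIV. \<Sum>k\<in>S j. F j k)"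
proof -
  have "(\<Prod>j\<in>UNIV. \<Sum>k\<in>S j. F j k) = (\<Sum>g\<in>Pi\<^sub>E UNIV S. \<Prod>j\<in>UNIV. F j (g j))"
    using assms by (intro prod_sum_PiE) auto
  also have "\<dots> = (\<Sum>m\<in>{m. \<forall>j. m $ j \<in> S j}. \<Prod>j\<in>UNIV. F j (m $ j))"
    by (rule sum.reindex_bij_witness[of _ vec_nth vec_lambda]) auto
  finally show ?thesis by simp
qed

lemma card_vec_set:
  fixes S :: "'d::finite \<Rightarrow> 'a set"
  assumes "\<And>j. finite (S j)"
  shows "card {m. \<forall>j. m $ j \<in> S j} = (\<Prod>j\<in>UNIV. card (S j))"
  using sum_vec_prod[OF assms, of "\<lambda>_ _. 1::nat"] by simp

lemma level_indices_alt: "level_indices l = {m. \<forall>j. m $ j \<in> {..<2 ^ l}}"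
  by (auto simp: level_indices_def)

lemma finite_level_indices [simp]: "finite (level_indices l)"
  unfolding level_indices_alt by (rule finite_vec_set) simp

lemma card_level_indices: "card (level_indices l :: (nat ^ 'd) set) = 2 ^ (l * CARD('d))"
  unfolding level_indices_alt by (subst card_vec_set) (simp_all add: power_mult)

lemma level_indices_nonempty: "level_indices l \<noteq> {}"
proof -
  have "(\<chi> j. 0) \<in> level_indices l" by (simp add: level_indices_def)
  then show ?thesis by blast
qed

lemma unit_cube_cbox: "unit_cube = cbox 0 1"
  by (auto simp: unit_cube_def mem_box_cart)

lemma compact_unit_cube: "compact unit_cube"
  by (simp add: unit_cube_cbox)

lemma unit_cube_borel [measurable]: "unit_cube \<in> sets borel"
  by (simp add: unit_cube_cbox)

lemma unit_cube_nonempty: "0 \<in> unit_cube"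
  by (simp add: unit_cube_def)

lemma unit_cubeD: "x \<in> unit_cube \<Longrightarrow> x $ j \<in> {0..1}"
  by (simp add: unit_cube_def)

lemma unit_cube_integrable:
  fixes h :: "real ^ 'd \<Rightarrow> real"
  assumes "continuous_on unit_cube h"
  shows "set_integrable lborel unit_cube h"
  unfolding set_integrable_def
  using borel_integrable_compact[OF compact_unit_cube assms] by simp

lemma unit_cube_bounded:
  fixes h :: "real ^ 'd \<Rightarrow> real"
  assumes "continuous_on unit_cube h"
  obtains U where "0 \<le> U" "\<And>x. x \<in> unit_cube \<Longrightarrow> \<bar>h x\<bar> \<le> U"
proof -
  have "bounded (h ` unit_cube)"
    by (intro compact_imp_bounded compact_continuous_image assms compact_unit_cube)
  then obtain a where "\<And>x. x \<in> unit_cube \<Longrightarrow> \<bar>h x\<bar> \<le> a"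
    by (auto simp: bounded_iff)
  then show ?thesis
    using that[of "max 0 a"] by (auto simp: le_max_iff_disj)
qed

lemma set_integral_unit_cube_prod:
  fixes u :: "'d::finite \<Rightarrow> real \<Rightarrow> real"
  assumes u: "\<And>j. continuous_on {0..1} (u j)"
  shows "(LINT x:unit_cube|lborel. \<Prod>j\<in>UNIV. u j (x $ j)) = (\<Prod>j\<in>UNIV. LINT t:{0..1}|lborel. u j t)"
proof -
  define U where "U j t = indicator {0..1} t * u j t" for j t
  have Ui: "integrable lborel (U j)" for j
    using borel_integrable_atLeastAtMost'[OF u[of j]] by (simp add: set_integrable_def U_def[abs_def])
  then have Um [measurable]: "U j \<in> borel_measurable borel" for j
    by (simp add: integrable_iff_bounded)
  have ind: "indicator unit_cube x *\<^sub>R (\<Prod>j\<in>UNIV. u j (x $ j)) = (\<Prod>j\<in>UNIV. U j (x $ j))" for x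
    by (cases "x \<in> unit_cube") (auto simp: U_def unit_cube_def indicator_def intro!: prod.cong prod_zero)
  have inj: "inj (\<lambda>j::'d. axis j (1::real))"
    by (auto simp: inj_def axis_eq_axis)
  have Basis: "(Basis :: (real ^ 'd) set) = range (\<lambda>j. axis j 1)"
    by (auto simp: Basis_vec_def)
  have comp: "(\<Sum>b\<in>Basis. f b *\<^sub>R b) $ j = f (axis j 1)" for f :: "real ^ 'd \<Rightarrow> real" and j
  proof -
    have "(\<Sum>b\<in>Basis. f b *\<^sub>R b) $ j = (\<Sum>i\<in>UNIV. f (axis i 1) * axis i 1 $ j)"
      by (simp add: Basis sum.reindex[OF inj])
    also have "\<dots> = (\<Sum>i\<in>UNIV. if i = j then f (axis i 1) else 0)"
      by (intro sum.cong) (auto simp: axis_def)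
    finally show ?thesis by simp
  qed
  interpret P: product_sigma_finite "\<lambda>_ :: real ^ 'd. lborel :: real measure"
    by standard
  \<comment> \<open>Lebesgue measure on the vector space is a product indexed by basis vectors,
    whereas the factors are indexed by coordinates; \<open>V\<close> carries them over along
    \<open>axis\<close>.\<close>
  define V where "V b = U (inv (\<lambda>j. axis j (1::real)) b)" for b
  have V: "V (axis j 1) = U j" for j
    by (simp add: V_def inv_f_f[OF inj])
  have "(LINT x:unit_cube|lborel. \<Prod>j\<in>UNIV. u j (x $ j)) = (LINT x|lborel. (\<Prod>j\<in>UNIV. U j (x $ j)))"
    unfolding set_lebesgue_integral_def ind ..
  also have "\<dots> = (LINT f|PiM Basis (\<lambda>_ :: real ^ 'd. lborel). (\<Prod>j\<in>UNIV. U j ((\<Sum>b\<in>Basis. f b *\<^sub>R b) $ j)))"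
    by (subst lborel_eq, subst integral_distr) auto
  also have "\<dots> = (LINT f|PiM Basis (\<lambda>_ :: real ^ 'd. lborel). (\<Prod>b\<in>Basis. V b (f b)))"
    by (simp only: comp) (simp add: Basis prod.reindex[OF inj] V)
  also have "\<dots> = (\<Prod>b\<in>(Basis :: (real ^ 'd) set). (LINT t|lborel. V b t))"
    by (intro P.product_integral_prod) (auto simp: Basis V Ui)
  also have "\<dots> = (\<Prod>j\<in>UNIV. (LINT t|lborel. U j t))"
    by (simp add: Basis prod.reindex[OF inj] V)
  finally show ?thesis
    by (simp add: U_def set_lebesgue_integral_def)
qed

text \<open>Fixes one admissible constant, so that the tensor estimates depend on the wavelets
  through \<open>Q\<close> alone; \<open>1 \<le> Q\<close> lets smaller powers be bounded by larger
  ones.\<close>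

locale cdv_bounded = cdv +
  fixes Q :: real
  assumes Q_ge_1: "1 \<le> Q"
    and wavelet1_sum_le: "\<And>l a x. J0 \<le> l \<Longrightarrow> x \<in> {0..1} \<Longrightarrow> (\<Sum>k<2 ^ l. \<bar>w a l k x\<bar>) \<le> Q * 2 powr (real l / 2)"
    and wavelet1_L1: "\<And>l a k. J0 \<le> l \<Longrightarrow> k < 2 ^ l \<Longrightarrow> (LINT x:{0..1}|lborel. \<bar>w a l k x\<bar>) \<le> Q * 2 powr (- (real l / 2))"
    and wavelet1_overlap: "\<And>l a k. J0 \<le> l \<Longrightarrow> k < 2 ^ l \<Longrightarrow>
       real (card {k'. k' < 2 ^ l \<and> (\<exists>x\<in>{0..1}. w a l k x \<noteq> 0 \<and> w a l k' x \<noteq> 0)}) \<le> Q"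
    and wavelet1_local: "\<And>l a k x y. J0 \<le> l \<Longrightarrow> k < 2 ^ l \<Longrightarrow> x \<in> {0..1} \<Longrightarrow> y \<in> {0..1} \<Longrightarrow>
       w a l k x \<noteq> 0 \<Longrightarrow> w a l k y \<noteq> 0 \<Longrightarrow> \<bar>x - y\<bar> \<le> Q / 2 ^ l"

lemma (in cdv) ex_cdv_bounded: "\<exists>Q. cdv_bounded B Q"
proof -
  obtain Q where "Q \<ge> 1 \<and> (\<forall>l\<ge>J0. \<forall>a.
     (\<forall>x\<in>{0..1}. (\<Sum>k<2 ^ l. \<bar>w a l k x\<bar>) \<le> Q * 2 powr (real l / 2)) \<and>
     (\<forall>k<2 ^ l. (LINT x:{0..1}|lborel. \<bar>w a l k x\<bar>) \<le> Q * 2 powr (- (real l / 2)) \<and>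
       real (card {k'. k' < 2 ^ l \<and> (\<exists>x\<in>{0..1}. w a l k x \<noteq> 0 \<and> w a l k' x \<noteq> 0)}) \<le> Q \<and>
       (\<forall>x\<in>{0..1}. \<forall>y\<in>{0..1}. w a l k x \<noteq> 0 \<longrightarrow> w a l k y \<noteq> 0 \<longrightarrow> \<bar>x - y\<bar> \<le> Q / 2 ^ l)))"
    using wavelet1_bounds by blast
  then have "cdv_bounded B Q"
    by unfold_locales blast+
  then show ?thesis ..
qed

context cdv_bounded
begin

abbreviation scaling :: "nat \<Rightarrow> nat ^ 'd \<Rightarrow> real ^ 'd \<Rightarrow> real" where
  "scaling \<equiv> wavelet B (\<chi> j. False)"

lemma level_index_lt: "m \<in> level_indices l \<Longrightarrow> m $ j < 2 ^ l"
  by (simp add: level_indices_def)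

lemma wavelet_continuous:
  assumes "J0 \<le> l" "m \<in> level_indices l"
  shows "continuous_on unit_cube (wavelet B v l m)"
proof -
  have "continuous_on unit_cube (\<lambda>x. w (v $ j) l (m $ j) (x $ j))" for j
    by (rule continuous_on_compose2[OF wavelet1_continuous[of l "m $ j" "v $ j"]])
      (use assms in \<open>auto simp: level_index_lt unit_cubeD intro!: continuous_intros dest: unit_cubeD\<close>)
  then show ?thesis
    unfolding wavelet_def[abs_def] by (intro continuous_intros)
qed

lemma powr_prod_const: "(\<Prod>j\<in>(UNIV::'d::finite set). Q * 2 powr r) = Q ^ CARD('d) * 2 powr (real CARD('d) * r)"
  by (simp add: power_mult_distrib powr_realpow[symmetric] powr_powr mult.commute)

lemma wavelet_abs_sum:
  fixes x :: "real ^ 'd"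
  assumes "J0 \<le> l" "x \<in> unit_cube"
  shows "(\<Sum>m\<in>level_indices l. \<bar>wavelet B v l m x\<bar>) \<le> Q ^ CARD('d) * 2 powr (real l * real CARD('d) / 2)"
proof -
  have "(\<Sum>m\<in>level_indices l. \<bar>wavelet B v l m x\<bar>)
      = (\<Sum>m\<in>{m. \<forall>j. m $ j \<in> {..<2 ^ l}}. \<Prod>j\<in>UNIV. \<bar>w (v $ j) l (m $ j) (x $ j)\<bar>)"
    by (simp add: wavelet_def abs_prod level_indices_alt)
  also have "\<dots> = (\<Prod>j\<in>UNIV. \<Sum>k<2 ^ l. \<bar>w (v $ j) l k (x $ j)\<bar>)"
    by (rule sum_vec_prod) simp
  also have "\<dots> \<le> (\<Prod>j\<in>(UNIV::'d set). Q * 2 powr (real l / 2))"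
    using assms by (intro prod_mono conjI sum_nonneg wavelet1_sum_le unit_cubeD) auto
  finally show ?thesis by (simp add: powr_prod_const mult.commute del: prod_constant)
qed

lemma wavelet_abs_le:
  fixes x :: "real ^ 'd"
  assumes "J0 \<le> l" "x \<in> unit_cube" "m \<in> level_indices l"
  shows "\<bar>wavelet B v l m x\<bar> \<le> Q ^ CARD('d) * 2 powr (real l * real CARD('d) / 2)"
proof -
  have "\<bar>wavelet B v l m x\<bar> \<le> (\<Sum>m\<in>level_indices l. \<bar>wavelet B v l m x\<bar>)"
    using assms(3) by (intro member_le_sum) auto
  then show ?thesis using wavelet_abs_sum[OF assms(1,2), of v] by linarith
qed

lemma wavelet_L1:
  assumes "J0 \<le> l" "m \<in> level_indices l"
  shows "(LINT x:unit_cube|lborel. \<bar>wavelet B v l m (x :: real ^ 'd)\<bar>)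
    \<le> Q ^ CARD('d) * 2 powr (- (real l * real CARD('d) / 2))"
proof -
  have "(LINT x:unit_cube|lborel. \<bar>wavelet B v l m x\<bar>)
      = (\<Prod>j\<in>UNIV. LINT t:{0..1}|lborel. \<bar>w (v $ j) l (m $ j) t\<bar>)"
    unfolding wavelet_def abs_prod using assms
    by (intro set_integral_unit_cube_prod continuous_on_rabs wavelet1_continuous level_index_lt)
  also have "\<dots> \<le> (\<Prod>j\<in>(UNIV::'d set). Q * 2 powr (- (real l / 2)))"
    using assms by (intro prod_mono conjI wavelet1_L1 level_index_lt)
      (auto simp: set_lebesgue_integral_def)
  finally show ?thesis by (simp add: powr_prod_const mult.commute del: prod_constant)
qed

lemma l2_inner_wavelet_le:
  fixes h :: "real ^ 'd \<Rightarrow> real"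
  assumes "J0 \<le> l" "m \<in> level_indices l" "continuous_on unit_cube h" "\<And>x. x \<in> unit_cube \<Longrightarrow> \<bar>h x\<bar> \<le> U"
  shows "\<bar>l2_inner unit_cube h (wavelet B v l m)\<bar> \<le> U * (Q ^ CARD('d) * 2 powr (- (real l * real CARD('d) / 2)))"
proof -
  have U: "0 \<le> U" using assms(4)[OF unit_cube_nonempty] by linarith
  have "\<bar>l2_inner unit_cube h (wavelet B v l m)\<bar> \<le> (LINT x:unit_cube|lborel. U * \<bar>wavelet B v l m x\<bar>)"
    unfolding l2_inner_def using assms
    by (intro abs_set_integral_le unit_cube_integrable continuous_intros wavelet_continuous)
       (auto simp: abs_mult intro!: mult_right_mono)
  also have "\<dots> = U * (LINT x:unit_cube|lborel. \<bar>wavelet B v l m x\<bar>)"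
    by simp
  also have "\<dots> \<le> U * (Q ^ CARD('d) * 2 powr (- (real l * real CARD('d) / 2)))"
    using assms U by (intro mult_left_mono wavelet_L1)
  finally show ?thesis .
qed

text \<open>Each row of the level-\<open>l\<close> Gram matrix, for any weight, has at most
  \<open>Q ^ CARD('d)\<close> nonzero entries, a number free of \<open>l\<close>. Entrywise control
  of the matrix is enough for this reason.\<close>

lemma scaling_overlap:
  fixes m :: "nat ^ 'd"
  assumes l: "J0 \<le> l" and m: "m \<in> level_indices l"
  shows "real (card {m'\<in>level_indices l. \<exists>x\<in>unit_cube. scaling l m x \<noteq> 0 \<and> scaling l m' x \<noteq> 0}) \<le> Q ^ CARD('d)"
proof -
  let ?S = "\<lambda>j. {k'. k' < 2 ^ l \<and> (\<exists>x\<in>{0..1}. w False l (m $ j) x \<noteq> 0 \<and> w False l k' x \<noteq> 0)}"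
  have "card {m'\<in>level_indices l. \<exists>x\<in>unit_cube. scaling l m x \<noteq> 0 \<and> scaling l m' x \<noteq> 0}
      \<le> card {m' :: nat ^ 'd. \<forall>j. m' $ j \<in> ?S j}"
    by (intro card_mono finite_vec_set)
      (auto simp: level_indices_def wavelet_def dest: unit_cubeD)
  also have "\<dots> = (\<Prod>j\<in>UNIV. card (?S j))"
    by (rule card_vec_set) simp
  finally have "real (card {m'\<in>level_indices l. \<exists>x\<in>unit_cube. scaling l m x \<noteq> 0 \<and> scaling l m' x \<noteq> 0})
      \<le> real (\<Prod>j\<in>UNIV. card (?S j))"
    by (rule of_nat_mono)
  also have "\<dots> = (\<Prod>j\<in>UNIV. real (card (?S j)))"
    by (rule of_nat_prod)
  also have "\<dots> \<le> (\<Prod>j\<in>(UNIV::'d set). Q)"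
    using l m by (intro prod_mono conjI wavelet1_overlap level_index_lt) auto
  finally show ?thesis by simp
qed

lemma scaling_local:
  assumes "J0 \<le> l" "m \<in> level_indices l" "x \<in> unit_cube" "y \<in> unit_cube"
    "scaling l m x \<noteq> 0" "scaling l m y \<noteq> 0"
  shows "\<bar>x $ j - y $ j\<bar> \<le> Q / 2 ^ l"
proof (rule wavelet1_local[OF assms(1) level_index_lt[OF assms(2)] unit_cubeD[OF assms(3)] unit_cubeD[OF assms(4)]])
  show "w False l (m $ j) (x $ j) \<noteq> 0" "w False l (m $ j) (y $ j) \<noteq> 0"
    using assms(5,6) by (auto simp: wavelet_def)
qed

text \<open>Multiplying out the one-dimensional identity over the coordinates turns the product of
  sums over the two types into a sum over type vectors \<open>v\<close>.\<close>

lemma kernel_Suc: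
  fixes x y :: "real ^ 'd"
  assumes "J0 \<le> l" "x \<in> unit_cube" "y \<in> unit_cube"
  shows "(\<Sum>m\<in>level_indices (Suc l). scaling (Suc l) m x * scaling (Suc l) m y)
       = (\<Sum>v\<in>UNIV. \<Sum>m\<in>level_indices l. wavelet B v l m x * wavelet B v l m y)"
proof -
  have "(\<Sum>m\<in>level_indices (Suc l). scaling (Suc l) m x * scaling (Suc l) m y)
      = (\<Sum>m\<in>{m. \<forall>j. m $ j \<in> {..<2 ^ Suc l}}. \<Prod>j\<in>UNIV. w False (Suc l) (m $ j) (x $ j) * w False (Suc l) (m $ j) (y $ j))"
    by (simp add: wavelet_def prod.distrib level_indices_alt)
  also have "\<dots> = (\<Prod>j\<in>UNIV. \<Sum>k<2 ^ Suc l. w False (Suc l) k (x $ j) * w False (Suc l) k (y $ j))"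
    by (rule sum_vec_prod) simp
  also have "\<dots> = (\<Prod>j\<in>UNIV. \<Sum>a\<in>UNIV. \<Sum>k<2 ^ l. w a l k (x $ j) * w a l k (y $ j))"
    using assms by (intro prod.cong refl kernel1_Suc unit_cubeD)
  also have "\<dots> = (\<Sum>v\<in>{v. \<forall>j. v $ j \<in> UNIV}. \<Prod>j\<in>UNIV. \<Sum>k<2 ^ l. w (v $ j) l k (x $ j) * w (v $ j) l k (y $ j))"
    by (rule sum_vec_prod[symmetric]) simp
  also have "\<dots> = (\<Sum>v\<in>UNIV. \<Sum>m\<in>{m. \<forall>j. m $ j \<in> {..<2 ^ l}}. \<Prod>j\<in>UNIV. w (v $ j) l (m $ j) (x $ j) * w (v $ j) l (m $ j) (y $ j))"
    by (intro sum.cong sum_vec_prod[symmetric]) auto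
  finally show ?thesis
    by (simp add: wavelet_def prod.distrib level_indices_alt)
qed

lemma l2_inner_wavelet_wavelet:
  assumes "J0 \<le> l" "m \<in> level_indices l" "J0 \<le> l'" "m' \<in> level_indices l'"
  shows "l2_inner unit_cube (wavelet B v l m) (wavelet B v' l' m')
    = (\<Prod>j\<in>UNIV. l2_inner {0..1} (w (v $ j) l (m $ j)) (w (v' $ j) l' (m' $ j)))"
  unfolding l2_inner_def wavelet_def prod.distrib[symmetric] using assms
  by (intro set_integral_unit_cube_prod continuous_intros wavelet1_continuous level_index_lt)

lemma l2_inner_const_wavelet:
  assumes "J0 \<le> l" "m \<in> level_indices l"
  shows "l2_inner unit_cube (\<lambda>_. c) (wavelet B v l m)
    = c * (\<Prod>j\<in>UNIV. l2_inner {0..1} (\<lambda>_. 1) (w (v $ j) l (m $ j)))"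
proof -
  have "(LINT x:unit_cube|lborel. wavelet B v l m x) = (\<Prod>j\<in>UNIV. LINT t:{0..1}|lborel. w (v $ j) l (m $ j) t)"
    unfolding wavelet_def using assms
    by (intro set_integral_unit_cube_prod continuous_intros wavelet1_continuous level_index_lt)
  then show ?thesis by (simp add: l2_inner_def)
qed

text \<open>Some coordinate carries a mother wavelet, and constants lie in the scaling space, so
  that factor of the product vanishes.\<close>

lemma l2_inner_const_wavelet_eq_0:
  assumes "J0 \<le> l" "m \<in> level_indices l" "v \<noteq> (\<chi> j. False)"
  shows "l2_inner unit_cube (\<lambda>_. c) (wavelet B v l m) = 0"
proof -
  obtain j where "v $ j" using assms(3) by (auto simp: vec_eq_iff)
  then have "l2_inner {0..1} (\<lambda>_. 1) (w (v $ j) l (m $ j)) = 0"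
    using scaling_space_orthogonal one_scaling_space assms by (simp add: level_index_lt)
  then have "(\<Prod>j\<in>UNIV. l2_inner {0..1} (\<lambda>_. 1) (w (v $ j) l (m $ j))) = 0"
    by (intro prod_zero) auto
  then show ?thesis using assms by (simp add: l2_inner_const_wavelet)
qed

lemma l2_inner_scaling_wavelet_eq_0:
  assumes "J0 \<le> L" "L \<le> l" "m' \<in> level_indices L" "m \<in> level_indices l" "v \<noteq> (\<chi> j. False)"
  shows "l2_inner unit_cube (scaling L m') (wavelet B v l m) = 0"
proof -
  obtain j where "v $ j" using assms(5) by (auto simp: vec_eq_iff)
  then have "l2_inner {0..1} (w False L (m' $ j)) (w (v $ j) l (m $ j)) = 0"
    using assms scaling_space_orthogonal scaling1_scaling_space by (simp add: level_index_lt)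
  then have "(\<Prod>j\<in>UNIV. l2_inner {0..1} (w ((\<chi> j. False) $ j) L (m' $ j)) (w (v $ j) l (m $ j))) = 0"
    by (intro prod_zero) auto
  then show ?thesis using assms by (subst l2_inner_wavelet_wavelet) auto
qed

section \<open>Kernel projections onto the scaling spaces\<close>

definition proj :: "nat \<Rightarrow> (real ^ 'd \<Rightarrow> real) \<Rightarrow> real ^ 'd \<Rightarrow> real" where
  "proj l h x = (\<Sum>m\<in>level_indices l. l2_inner unit_cube h (scaling l m) * scaling l m x)"

lemma proj_continuous: "J0 \<le> l \<Longrightarrow> continuous_on unit_cube (proj l h)"
  unfolding proj_def[abs_def] by (intro continuous_intros wavelet_continuous) auto

lemma proj_one:
  fixes x :: "real ^ 'd"
  assumes "J0 \<le> l" "x \<in> unit_cube"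
  shows "proj l (\<lambda>_. 1) x = 1"
proof -
  have "proj l (\<lambda>_. 1) x = (\<Sum>m\<in>{m. \<forall>j. m $ j \<in> {..<2 ^ l}}.
      \<Prod>j\<in>UNIV. l2_inner {0..1} (\<lambda>_. 1) (w False l (m $ j)) * w False l (m $ j) (x $ j))"
    unfolding proj_def level_indices_alt
    by (intro sum.cong refl) (simp add: l2_inner_const_wavelet assms level_indices_alt wavelet_def prod.distrib)
  also have "\<dots> = (\<Prod>j\<in>UNIV. \<Sum>k<2 ^ l. l2_inner {0..1} (\<lambda>_. 1) (w False l k) * w False l k (x $ j))"
    by (rule sum_vec_prod) simp
  also have "\<dots> = (\<Prod>j\<in>(UNIV::'d set). 1)"
    using assms one_scaling_space
    by (intro prod.cong refl scaling_space_reproduce[of l "\<lambda>_. 1", symmetric] unit_cubeD) auto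
  finally show ?thesis by simp
qed

text \<open>Reproduction in each coordinate. A mother wavelet of level \<open>l\<close> belongs to
  the scaling spaces only from level \<open>l + 1\<close> on, a scaling function already from
  \<open>l\<close> on; hence the two cases of the level condition.\<close>

lemma proj_wavelet:
  fixes x :: "real ^ 'd"
  assumes l: "J0 \<le> l" and m: "m \<in> level_indices l" and x: "x \<in> unit_cube"
    and L: "l < L \<or> (l \<le> L \<and> v = (\<chi> j. False))"
  shows "proj L (wavelet B v l m) x = wavelet B v l m x"
proof -
  have L0: "J0 \<le> L" using l L by auto
  have "proj L (wavelet B v l m) x = (\<Sum>m'\<in>{m'. \<forall>j. m' $ j \<in> {..<2 ^ L}}.
      \<Prod>j\<in>UNIV. l2_inner {0..1} (w (v $ j) l (m $ j)) (w False L (m' $ j)) * w False L (m' $ j) (x $ j))"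
    unfolding proj_def level_indices_alt
    by (intro sum.cong refl) (subst l2_inner_wavelet_wavelet, auto simp: l m L0 level_indices_alt level_index_lt[OF m] wavelet_def prod.distrib)
  also have "\<dots> = (\<Prod>j\<in>UNIV. \<Sum>k<2 ^ L. l2_inner {0..1} (w (v $ j) l (m $ j)) (w False L k) * w False L k (x $ j))"
    by (rule sum_vec_prod) simp
  also have "\<dots> = (\<Prod>j\<in>UNIV. w (v $ j) l (m $ j) (x $ j))"
  proof (intro prod.cong refl)
    fix j
    have "in_scaling_space B L (w (v $ j) l (m $ j))"
      using L wavelet1_scaling_space[OF l _ level_index_lt[OF m]] scaling1_scaling_space[OF l _ level_index_lt[OF m]]
      by auto
    from scaling_space_reproduce[OF L0 this unit_cubeD[OF x]]
    show "(\<Sum>k<2 ^ L. l2_inner {0..1} (w (v $ j) l (m $ j)) (w False L k) * w False L k (x $ j)) = w (v $ j) l (m $ j) (x $ j)"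
      by simp
  qed
  finally show ?thesis by (simp add: wavelet_def)
qed

lemma l2_inner_proj:
  assumes L: "J0 \<le> L" and h: "continuous_on unit_cube h" and k: "continuous_on unit_cube k"
  shows "l2_inner unit_cube (proj L h) k = l2_inner unit_cube h (proj L k)"
proof -
  have "l2_inner unit_cube (proj L h) k = (\<Sum>m\<in>level_indices L. l2_inner unit_cube h (scaling L m) * l2_inner unit_cube (scaling L m) k)"
    unfolding proj_def using L k
    by (intro l2_inner_sum_left unit_cube_integrable continuous_intros wavelet_continuous)
  moreover have "l2_inner unit_cube (proj L k) h = (\<Sum>m\<in>level_indices L. l2_inner unit_cube k (scaling L m) * l2_inner unit_cube (scaling L m) h)"
    unfolding proj_def using L h
    by (intro l2_inner_sum_left unit_cube_integrable continuous_intros wavelet_continuous)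
  ultimately show ?thesis
    by (simp add: l2_inner_commute[of _ h] l2_inner_commute[of _ k] mult.commute)
qed

text \<open>The projection is self-adjoint and leaves the wavelet fixed, so it moves over to the
  wavelet and disappears.\<close>

lemma l2_inner_proj_wavelet:
  assumes "J0 \<le> l" "m \<in> level_indices l" "continuous_on unit_cube h" "l < L \<or> (l \<le> L \<and> v = (\<chi> j. False))"
  shows "l2_inner unit_cube (proj L h) (wavelet B v l m) = l2_inner unit_cube h (wavelet B v l m)"
proof -
  have "J0 \<le> L" using assms by auto
  then have "l2_inner unit_cube (proj L h) (wavelet B v l m) = l2_inner unit_cube h (proj L (wavelet B v l m))"
    using assms by (intro l2_inner_proj wavelet_continuous)
  also have "\<dots> = l2_inner unit_cube h (wavelet B v l m)"
    using assms by (intro l2_inner_cong proj_wavelet) auto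
  finally show ?thesis .
qed

lemma l2_inner_scaling_sum_wavelet_eq_0:
  assumes "J0 \<le> L" "L \<le> l" "m \<in> level_indices l" "v \<noteq> (\<chi> j. False)"
  shows "l2_inner unit_cube (\<lambda>x. \<Sum>m'\<in>level_indices L. c m' * scaling L m' x) (wavelet B v l m) = 0"
proof -
  have "l2_inner unit_cube (\<lambda>x. \<Sum>m'\<in>level_indices L. c m' * scaling L m' x) (wavelet B v l m)
      = (\<Sum>m'\<in>level_indices L. c m' * l2_inner unit_cube (scaling L m') (wavelet B v l m))"
    using assms by (intro l2_inner_sum_left unit_cube_integrable continuous_intros wavelet_continuous) auto
  then show ?thesis using assms by (simp add: l2_inner_scaling_wavelet_eq_0)
qed

text \<open>\<open>kernel_Suc\<close> integrated against \<open>h\<close>; the type vector without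
  mother wavelets contributes \<open>proj l h\<close>, and the others form the detail of level
  \<open>l\<close>.\<close>

lemma proj_Suc:
  fixes h :: "real ^ 'd \<Rightarrow> real"
  assumes l: "J0 \<le> l" and h: "continuous_on unit_cube h" and x: "x \<in> unit_cube"
  shows "proj (Suc l) h x = proj l h x +
    (\<Sum>v\<in>UNIV - {\<chi> j. False}. \<Sum>m\<in>level_indices l. l2_inner unit_cube h (wavelet B v l m) * wavelet B v l m x)"
proof -
  have *: "l2_inner unit_cube (\<lambda>y. \<Sum>m\<in>level_indices l. wavelet B v l m x * wavelet B v l m y) h
      = (\<Sum>m\<in>level_indices l. l2_inner unit_cube h (wavelet B v l m) * wavelet B v l m x)" if "J0 \<le> l" for v l
    using that h by (subst l2_inner_sum_left)
      (auto intro!: unit_cube_integrable continuous_intros wavelet_continuous simp: l2_inner_commute mult.commute)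
  have c: "continuous_on unit_cube (\<lambda>y. (\<Sum>m\<in>level_indices l. wavelet B v l m x * wavelet B v l m y) * h y)" for v
    using l h by (intro continuous_intros wavelet_continuous) auto
  have "proj (Suc l) h x = l2_inner unit_cube (\<lambda>y. \<Sum>m\<in>level_indices (Suc l). scaling (Suc l) m x * scaling (Suc l) m y) h"
    unfolding proj_def using l by (subst *) auto
  also have "\<dots> = l2_inner unit_cube (\<lambda>y. \<Sum>v\<in>UNIV. 1 * (\<Sum>m\<in>level_indices l. wavelet B v l m x * wavelet B v l m y)) h"
    using l x by (intro l2_inner_cong) (auto simp: kernel_Suc)
  also have "\<dots> = (\<Sum>v\<in>UNIV. 1 * l2_inner unit_cube (\<lambda>y. \<Sum>m\<in>level_indices l. wavelet B v l m x * wavelet B v l m y) h)"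
    by (intro l2_inner_sum_left unit_cube_integrable c)
  also have "\<dots> = (\<Sum>v\<in>UNIV. \<Sum>m\<in>level_indices l. l2_inner unit_cube h (wavelet B v l m) * wavelet B v l m x)"
    using l by (simp add: *)
  also have "\<dots> = proj l h x +
    (\<Sum>v\<in>UNIV - {\<chi> j. False}. \<Sum>m\<in>level_indices l. l2_inner unit_cube h (wavelet B v l m) * wavelet B v l m x)"
    by (subst sum.remove[of _ "\<chi> j. False"]) (auto simp: proj_def)
  finally show ?thesis .
qed

end

subsection \<open>Coefficient balls and stability of the tests\<close>

text \<open>The common frame for the empirical mean over the sample points in the cube and for the
  Lebesgue integral on the cube. Restricting to functions continuous on the cube removes all
  questions of integrability.\<close>

definition positive_functional :: "((real ^ 'd \<Rightarrow> real) \<Rightarrow> real) \<Rightarrow> bool" where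
  "positive_functional T \<longleftrightarrow>
     (\<forall>f g. continuous_on unit_cube f \<longrightarrow> continuous_on unit_cube g \<longrightarrow> T (\<lambda>x. f x + g x) = T f + T g) \<and>
     (\<forall>c f. continuous_on unit_cube f \<longrightarrow> T (\<lambda>x. c * f x) = c * T f) \<and>
     (\<forall>f g. continuous_on unit_cube f \<longrightarrow> continuous_on unit_cube g \<longrightarrow> (\<forall>x\<in>unit_cube. f x \<le> g x) \<longrightarrow> T f \<le> T g)"

context
  fixes T :: "(real ^ 'd \<Rightarrow> real) \<Rightarrow> real"
  assumes T: "positive_functional T"
begin

lemma pf_add: "continuous_on unit_cube f \<Longrightarrow> continuous_on unit_cube g \<Longrightarrow> T (\<lambda>x. f x + g x) = T f + T g"
  and pf_scale: "continuous_on unit_cube f \<Longrightarrow> T (\<lambda>x. c * f x) = c * T f"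
  and pf_mono: "continuous_on unit_cube f \<Longrightarrow> continuous_on unit_cube g \<Longrightarrow> (\<And>x. x \<in> unit_cube \<Longrightarrow> f x \<le> g x) \<Longrightarrow> T f \<le> T g"
  using T by (simp_all add: positive_functional_def)

lemma pf_zero: "T (\<lambda>x. 0) = 0"
  using pf_scale[of "\<lambda>x. 0" 0] by simp

lemma pf_diff:
  assumes "continuous_on unit_cube f" "continuous_on unit_cube g"
  shows "T (\<lambda>x. f x - g x) = T f - T g"
proof -
  have "T (\<lambda>x. f x + (- 1) * g x) = T f + (- 1) * T g"
    using assms by (subst pf_add) (auto intro!: continuous_intros pf_scale[of g "- 1", simplified] simp: pf_scale[of g "- 1", simplified])
  then show ?thesis by simp
qed

lemma pf_sum:
  assumes "finite I" "\<And>i. i \<in> I \<Longrightarrow> continuous_on unit_cube (f i)"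
  shows "T (\<lambda>x. \<Sum>i\<in>I. c i * f i x) = (\<Sum>i\<in>I. c i * T (f i))"
  using assms
proof (induction I rule: finite_induct)
  case (insert i I)
  have "T (\<lambda>x. \<Sum>i\<in>insert i I. c i * f i x) = T (\<lambda>x. c i * f i x + (\<Sum>i\<in>I. c i * f i x))"
    using insert by simp
  also have "\<dots> = T (\<lambda>x. c i * f i x) + T (\<lambda>x. \<Sum>i\<in>I. c i * f i x)"
    using insert by (intro pf_add continuous_intros) auto
  finally show ?case using insert by (simp add: pf_scale)
qed (simp add: pf_zero)

lemma pf_abs_le:
  assumes "continuous_on unit_cube f" "continuous_on unit_cube g" "\<And>x. x \<in> unit_cube \<Longrightarrow> \<bar>f x\<bar> \<le> g x"
  shows "\<bar>T f\<bar> \<le> T g"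
proof -
  have "T f \<le> T g" "T (\<lambda>x. (- 1) * f x) \<le> T g"
    using assms by (auto intro!: pf_mono continuous_intros simp: abs_le_iff)
  moreover have "T (\<lambda>x. (- 1) * f x) = (- 1) * T f"
    using assms by (intro pf_scale)
  ultimately show ?thesis by linarith
qed

end

lemma positive_functional_integral: "positive_functional (\<lambda>h. LINT x:unit_cube|lborel. h x)"
  unfolding positive_functional_def
  by (auto intro!: set_integral_mono unit_cube_integrable set_integral_add(2))

text \<open>Sample points lie in the cube only almost surely; the indicator makes positivity hold
  for every sample.\<close>

lemma positive_functional_empirical:
  fixes X :: "nat \<Rightarrow> real ^ 'd"
  shows "positive_functional (\<lambda>h. (\<Sum>i<n. indicator unit_cube (X i) * h (X i)) / real n)"
  unfolding positive_functional_def
proof (intro conjI allI impI)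
  fix f g :: "real ^ 'd \<Rightarrow> real" and c :: real
  show "(\<Sum>i<n. indicator unit_cube (X i) * (f (X i) + g (X i))) / real n
      = (\<Sum>i<n. indicator unit_cube (X i) * f (X i)) / real n + (\<Sum>i<n. indicator unit_cube (X i) * g (X i)) / real n"
    by (simp add: distrib_left sum.distrib add_divide_distrib)
  show "(\<Sum>i<n. indicator unit_cube (X i) * (c * f (X i))) / real n = c * ((\<Sum>i<n. indicator unit_cube (X i) * f (X i)) / real n)"
    by (simp only: times_divide_eq_right sum_distrib_left mult.left_commute)
  assume "\<forall>x\<in>unit_cube. f x \<le> g x"
  then show "(\<Sum>i<n. indicator unit_cube (X i) * f (X i)) / real n \<le> (\<Sum>i<n. indicator unit_cube (X i) * g (X i)) / real n"
    by (intro divide_right_mono sum_mono) (auto simp: indicator_def)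
qed

lemma l2_inner_diff_left:
  assumes "continuous_on unit_cube f" "continuous_on unit_cube g" "continuous_on unit_cube k"
  shows "l2_inner unit_cube (\<lambda>x. f x - g x) k = l2_inner unit_cube f k - l2_inner unit_cube g k"
  unfolding l2_inner_def left_diff_distrib
  using assms by (intro set_integral_diff(2) unit_cube_integrable continuous_intros)

lemma l2_inner_scale_left: "l2_inner A (\<lambda>x. c * f x) k = c * l2_inner A f k"
  by (simp add: l2_inner_def mult.assoc)

context cdv_bounded
begin

section \<open>Size and convergence of the projections\<close>

lemma proj_diff:
  assumes "J0 \<le> l" "continuous_on unit_cube f" "continuous_on unit_cube g"
  shows "proj l (\<lambda>x. f x - g x) x = proj l f x - proj l g x"
  unfolding proj_def sum_subtractf[symmetric]
  using assms by (intro sum.cong refl) (simp add: l2_inner_diff_left wavelet_continuous left_diff_distrib)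

lemma proj_scale: "proj l (\<lambda>x. c * f x) x = c * proj l f x"
  by (simp add: proj_def l2_inner_scale_left sum_distrib_left mult.assoc)

lemma proj_const: "J0 \<le> l \<Longrightarrow> x \<in> unit_cube \<Longrightarrow> proj l (\<lambda>_. c) x = c"
  using proj_scale[of l c "\<lambda>_. 1" x] by (simp add: proj_one)

lemma powr_half_cancel: "2 powr (a / 2) * (2 powr (- (a / 2)) * y) = (y::real)"
  by (simp add: mult.assoc[symmetric] powr_add[symmetric])

text \<open>The scale \<open>2 powr (- (l * d / 2))\<close> is that of the integral of
  |\<open>scaling l m\<close>|. It cancels the height of the scaling functions, and bounded overlap
  replaces the number of indices.\<close>

lemma proj_abs_le:
  fixes x :: "real ^ 'd"
  assumes l: "J0 \<le> l" and x: "x \<in> unit_cube"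
    and c: "\<And>m. m \<in> level_indices l \<Longrightarrow> scaling l m x \<noteq> 0 \<Longrightarrow>
      \<bar>l2_inner unit_cube u (scaling l m)\<bar> \<le> e * 2 powr (- (real l * real CARD('d) / 2))"
    and e: "0 \<le> e"
  shows "\<bar>proj l u x\<bar> \<le> Q ^ CARD('d) * e"
proof -
  have "\<bar>proj l u x\<bar> \<le> (\<Sum>m\<in>level_indices l. \<bar>l2_inner unit_cube u (scaling l m)\<bar> * \<bar>scaling l m x\<bar>)"
    unfolding proj_def by (rule order_trans[OF sum_abs]) (simp add: abs_mult)
  also have "\<dots> \<le> (\<Sum>m\<in>level_indices l. e * 2 powr (- (real l * real CARD('d) / 2)) * \<bar>scaling l m x\<bar>)"
    using c by (intro sum_mono) (metis abs_ge_zero abs_zero mult_right_mono mult_zero_right order_refl)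
  also have "\<dots> = e * 2 powr (- (real l * real CARD('d) / 2)) * (\<Sum>m\<in>level_indices l. \<bar>scaling l m x\<bar>)"
    by (simp add: sum_distrib_left)
  also have "\<dots> \<le> e * 2 powr (- (real l * real CARD('d) / 2)) * (Q ^ CARD('d) * 2 powr (real l * real CARD('d) / 2))"
    using e by (intro mult_left_mono wavelet_abs_sum l x) auto
  also have "\<dots> = Q ^ CARD('d) * e"
    using powr_half_cancel[of "real l * real CARD('d)" "Q ^ CARD('d) * e"] by (simp add: mult_ac)
  finally show ?thesis .
qed

text \<open>The projection kernel vanishes beyond distance \<open>Q / 2 ^ l\<close> in any
  coordinate. One power \<open>Q ^ CARD('d)\<close> comes from the integral of a scaling function,
  the other from summing them at \<open>x\<close>.\<close>

lemma proj_abs_le_local: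
  fixes x :: "real ^ 'd"
  assumes l: "J0 \<le> l" and x: "x \<in> unit_cube" and u: "continuous_on unit_cube u"
    and e: "0 \<le> e"
    and le: "\<And>y. y \<in> unit_cube \<Longrightarrow> (\<And>j. \<bar>x $ j - y $ j\<bar> \<le> Q / 2 ^ l) \<Longrightarrow> \<bar>u y\<bar> \<le> e"
  shows "\<bar>proj l u x\<bar> \<le> e * (Q ^ CARD('d))\<^sup>2"
proof -
  have "\<bar>proj l u x\<bar> \<le> Q ^ CARD('d) * (e * Q ^ CARD('d))"
  proof (rule proj_abs_le[OF l x])
    fix m :: "nat ^ 'd" assume m: "m \<in> level_indices l" and nz: "scaling l m x \<noteq> 0"
    have "\<bar>l2_inner unit_cube u (scaling l m)\<bar> \<le> (LINT y:unit_cube|lborel. e * \<bar>scaling l m y\<bar>)"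
      unfolding l2_inner_def
    proof (intro abs_set_integral_le unit_cube_integrable continuous_intros u wavelet_continuous l m)
      fix y :: "real ^ 'd" assume y: "y \<in> unit_cube"
      show "\<bar>u y * scaling l m y\<bar> \<le> e * \<bar>scaling l m y\<bar>"
      proof (cases "scaling l m y = 0")
        case False
        then have "\<bar>u y\<bar> \<le> e" using scaling_local[OF l m x y nz] le[OF y] by blast
        then show ?thesis by (simp add: abs_mult mult_right_mono)
      qed simp
    qed
    also have "\<dots> = e * (LINT y:unit_cube|lborel. \<bar>scaling l m y\<bar>)" by simp
    also have "\<dots> \<le> e * (Q ^ CARD('d) * 2 powr (- (real l * real CARD('d) / 2)))"
      using e by (intro mult_left_mono wavelet_L1 l m)
    finally show "\<bar>l2_inner unit_cube u (scaling l m)\<bar> \<le> e * Q ^ CARD('d) * 2 powr (- (real l * real CARD('d) / 2))"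
      by (simp add: mult.assoc)
  qed (use e Q_ge_1 in auto)
  then show ?thesis by (simp add: power2_eq_square mult_ac)
qed

lemma Q_power_ge_1: "1 \<le> Q ^ k"
  using Q_ge_1 by simp

lemma ex_level_within:
  assumes "0 < \<delta>"
  shows "\<exists>l0\<ge>J0. \<forall>l\<ge>l0. \<forall>x y :: real ^ 'd. (\<forall>j. \<bar>x $ j - y $ j\<bar> \<le> Q / 2 ^ l) \<longrightarrow> dist x y < \<delta>"
proof -
  obtain l1 where l1: "real CARD('d) * Q / \<delta> < 2 ^ l1"
    using real_arch_pow[of 2 "real CARD('d) * Q / \<delta>"] by auto
  have "dist x y < \<delta>" if l: "max l1 J0 \<le> l" and xy: "\<forall>j. \<bar>x $ j - y $ j\<bar> \<le> Q / 2 ^ l" for l and x y :: "real ^ 'd"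
  proof -
    have "dist x y \<le> (\<Sum>j\<in>UNIV. \<bar>(x - y) $ j\<bar>)"
      unfolding dist_norm by (rule norm_le_l1_cart)
    also have "\<dots> \<le> (\<Sum>j\<in>(UNIV::'d set). Q / 2 ^ l)"
      using xy by (intro sum_mono) auto
    also have "\<dots> = real CARD('d) * Q / 2 ^ l" by simp
    also have "\<dots> \<le> real CARD('d) * Q / 2 ^ l1"
      using l Q_ge_1 by (intro divide_left_mono power_increasing) auto
    also have "\<dots> < \<delta>" using l1 assms by (simp add: field_simps)
    finally show ?thesis .
  qed
  then show ?thesis by (intro exI[of _ "max l1 J0"]) auto
qed

text \<open>Constants are reproduced, so the error at \<open>x\<close> is the projection of
  \<open>h - h x\<close>, and only the values of this function near \<open>x\<close> count.\<close>

lemma proj_tendsto: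
  fixes x :: "real ^ 'd"
  assumes h: "continuous_on unit_cube h" and x: "x \<in> unit_cube"
  shows "(\<lambda>l. proj l h x) \<longlonglongrightarrow> h x"
proof (rule LIMSEQ_I)
  fix r :: real assume r: "0 < r"
  define e where "e = r / (2 * (Q ^ CARD('d))\<^sup>2)"
  have F: "0 < (Q ^ CARD('d))\<^sup>2" using Q_ge_1 by simp
  have e: "0 < e" "e * (Q ^ CARD('d))\<^sup>2 < r" using r F by (auto simp: e_def field_simps)
  have "uniformly_continuous_on unit_cube h"
    by (rule compact_uniformly_continuous[OF h compact_unit_cube])
  then obtain \<delta> where \<delta>: "0 < \<delta>" "\<And>y z. y \<in> unit_cube \<Longrightarrow> z \<in> unit_cube \<Longrightarrow> dist z y < \<delta> \<Longrightarrow> dist (h z) (h y) < e"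
    unfolding uniformly_continuous_on_def using e(1) by metis
  obtain l0 where l0: "J0 \<le> l0" "\<And>l x y. l0 \<le> l \<Longrightarrow> (\<forall>j. \<bar>x $ j - (y :: real ^ 'd) $ j\<bar> \<le> Q / 2 ^ l) \<Longrightarrow> dist x y < \<delta>"
    using ex_level_within[OF \<delta>(1)] by blast
  have "norm (proj l h x - h x) < r" if l: "l0 \<le> l" for l
  proof -
    have J: "J0 \<le> l" using l l0 by simp
    have "\<bar>proj l (\<lambda>y. h y - h x) x\<bar> \<le> e * (Q ^ CARD('d))\<^sup>2"
    proof (rule proj_abs_le_local[OF J x])
      fix y assume "y \<in> unit_cube" "\<And>j. \<bar>x $ j - y $ j\<bar> \<le> Q / 2 ^ l"
      then show "\<bar>h y - h x\<bar> \<le> e"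
        using \<delta>(2)[of y x] l0(2)[OF l, of x y] x by (auto simp: dist_real_def abs_minus_commute)
    qed (use e h in \<open>auto intro!: continuous_intros\<close>)
    then show ?thesis
      using e(2) J h x by (simp add: proj_diff proj_const)
  qed
  then show "\<exists>no. \<forall>l\<ge>no. norm (proj l h x - h x) < r" by blast
qed

text \<open>The Hoelder condition stated coefficient by coefficient in the reals. A maximum of the
  two parts stands in place of their sum, so going back to \<open>holder_ball\<close> costs a factor
  2.\<close>

definition coef_ball :: "real \<Rightarrow> real \<Rightarrow> (real ^ 'd \<Rightarrow> real) \<Rightarrow> bool" where
  "coef_ball s M h \<longleftrightarrow> continuous_on unit_cube h \<and>
     (\<forall>m\<in>level_indices J0. 2 powr (real J0 * (s + real CARD('d) / 2)) * \<bar>l2_inner unit_cube h (scaling J0 m)\<bar> \<le> M) \<and>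
     (\<forall>l\<ge>J0. \<forall>m\<in>level_indices l. \<forall>v. v \<noteq> (\<chi> j. False) \<longrightarrow>
        2 powr (real l * (s + real CARD('d) / 2)) * \<bar>l2_inner unit_cube h (wavelet B v l m)\<bar> \<le> M)"

lemma coef_ball_continuous: "coef_ball s M h \<Longrightarrow> continuous_on unit_cube h"
  by (simp add: coef_ball_def)

lemma holder_ball_imp_coef_ball:
  fixes h :: "real ^ 'd \<Rightarrow> real"
  assumes "h \<in> holder_ball B s M"
  shows "coef_ball s M h"
proof -
  let ?a = "2 powr (real J0 * (s + real CARD('d) / 2)) * Max ((\<lambda>m. \<bar>l2_inner unit_cube h (scaling J0 m)\<bar>) ` level_indices J0)"
  define I :: "(nat \<times> (nat ^ 'd) \<times> (bool ^ 'd)) set" where "I = {(l, m, v). J0 \<le> l \<and> m \<in> level_indices l \<and> v \<noteq> (\<chi> j. False)}"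
  define f :: "nat \<times> (nat ^ 'd) \<times> (bool ^ 'd) \<Rightarrow> ereal" where "f = (\<lambda>(l, m, v). ereal (2 powr (real l * (s + real CARD('d) / 2)) * \<bar>l2_inner unit_cube h (wavelet B v l m)\<bar>))"
  have h: "continuous_on unit_cube h" "ereal ?a + (SUP i\<in>I. f i) \<le> ereal M"
    using assms by (auto simp: holder_ball_def I_def f_def)
  obtain m0 :: "nat ^ 'd" where m0: "m0 \<in> level_indices J0" using level_indices_nonempty by blast
  have Max: "\<bar>l2_inner unit_cube h (scaling J0 m)\<bar> \<le> Max ((\<lambda>m. \<bar>l2_inner unit_cube h (scaling J0 m)\<bar>) ` level_indices J0)"
    if "m \<in> level_indices J0" for m
    using that by (intro Max_ge) auto
  then have "0 \<le> Max ((\<lambda>m. \<bar>l2_inner unit_cube h (scaling J0 m)\<bar>) ` level_indices J0)"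
    using m0 abs_ge_zero order_trans by blast
  then have a: "0 \<le> ?a" by simp
  have i0: "(J0, m0, (\<chi> j. True)) \<in> I" using m0 by (auto simp: vec_eq_iff I_def)
  have "0 \<le> f (J0, m0, (\<chi> j. True))" by (simp add: f_def)
  also have "\<dots> \<le> (SUP i\<in>I. f i)" by (rule SUP_upper[OF i0])
  finally have S: "0 \<le> (SUP i\<in>I. f i)" .
  have 1: "?a \<le> M"
  proof -
    have "ereal ?a = ereal ?a + 0" by simp
    also have "\<dots> \<le> ereal ?a + (SUP i\<in>I. f i)" using S by (rule add_left_mono)
    also note h(2)
    finally have "ereal ?a \<le> ereal M" .
    then show ?thesis by simp
  qed
  have 2: "f i \<le> ereal M" if "i \<in> I" for i
  proof -
    have "f i \<le> (SUP i\<in>I. f i)" using that by (rule SUP_upper)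
    also have "\<dots> = 0 + (SUP i\<in>I. f i)" by simp
    also have "\<dots> \<le> ereal ?a + (SUP i\<in>I. f i)" using a by (intro add_right_mono) simp
    also note h(2)
    finally show ?thesis .
  qed
  show ?thesis
    unfolding coef_ball_def
  proof (intro conjI h ballI allI impI)
    fix m :: "nat ^ 'd" assume "m \<in> level_indices J0"
    then have "2 powr (real J0 * (s + real CARD('d) / 2)) * \<bar>l2_inner unit_cube h (scaling J0 m)\<bar> \<le> ?a"
      by (intro mult_left_mono Max) auto
    then show "2 powr (real J0 * (s + real CARD('d) / 2)) * \<bar>l2_inner unit_cube h (scaling J0 m)\<bar> \<le> M"
      using 1 by linarith
  next
    fix l and m :: "nat ^ 'd" and v :: "bool ^ 'd"
    assume "J0 \<le> l" "m \<in> level_indices l" "v \<noteq> (\<chi> j. False)"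
    then show "2 powr (real l * (s + real CARD('d) / 2)) * \<bar>l2_inner unit_cube h (wavelet B v l m)\<bar> \<le> M"
      using 2[of "(l, m, v)"] by (simp add: f_def I_def)
  qed
qed

lemma coef_ball_imp_holder_ball:
  fixes h :: "real ^ 'd \<Rightarrow> real"
  assumes "coef_ball s M h" and C: "2 * M \<le> C"
  shows "h \<in> holder_ball B s C"
proof -
  have "2 powr (real J0 * (s + real CARD('d) / 2)) * Max ((\<lambda>m. \<bar>l2_inner unit_cube h (scaling J0 m)\<bar>) ` level_indices J0) \<le> M"
  proof -
    have "Max ((\<lambda>m. \<bar>l2_inner unit_cube h (scaling J0 m)\<bar>) ` level_indices J0) \<in> (\<lambda>m. \<bar>l2_inner unit_cube h (scaling J0 m)\<bar>) ` level_indices J0"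
      using level_indices_nonempty by (intro Max_in) auto
    then show ?thesis using assms(1) by (auto simp: coef_ball_def)
  qed
  moreover have "(SUP (l, m, v)\<in>{(l, m, v). J0 \<le> l \<and> m \<in> level_indices l \<and> v \<noteq> (\<chi> j. False)}.
          ereal (2 powr (real l * (s + real CARD('d) / 2)) * \<bar>l2_inner unit_cube h (wavelet B v l m)\<bar>)) \<le> ereal M"
    using assms(1) by (intro SUP_least) (auto simp: coef_ball_def)
  ultimately have "ereal (2 powr (real J0 * (s + real CARD('d) / 2)) * Max ((\<lambda>m. \<bar>l2_inner unit_cube h (scaling J0 m)\<bar>) ` level_indices J0))
    + (SUP (l, m, v)\<in>{(l, m, v). J0 \<le> l \<and> m \<in> level_indices l \<and> v \<noteq> (\<chi> j. False)}.
          ereal (2 powr (real l * (s + real CARD('d) / 2)) * \<bar>l2_inner unit_cube h (wavelet B v l m)\<bar>)) \<le> ereal M + ereal M"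
    by (intro add_mono) auto
  also have "\<dots> \<le> ereal C" using C by simp
  finally show ?thesis using assms(1) by (simp add: holder_ball_def coef_ball_continuous)
qed

lemma coef_ball_mono:
  fixes h :: "real ^ 'd \<Rightarrow> real"
  assumes "coef_ball s M h" "s' \<le> s" "M \<le> M'"
  shows "coef_ball s' M' h"
proof -
  have "2 powr (real l * (s' + real CARD('d) / 2)) * \<bar>a\<bar> \<le> M'"
    if "2 powr (real l * (s + real CARD('d) / 2)) * \<bar>a\<bar> \<le> M" for l a
  proof -
    have "2 powr (real l * (s' + real CARD('d) / 2)) * \<bar>a\<bar> \<le> 2 powr (real l * (s + real CARD('d) / 2)) * \<bar>a\<bar>"
      using assms(2) by (intro mult_right_mono powr_mono mult_left_mono) auto
    then show ?thesis using that assms(3) by linarith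
  qed
  then show ?thesis using assms(1) unfolding coef_ball_def by blast
qed

text \<open>At most \<open>2 ^ k\<close> type vectors, a factor \<open>Q ^ k\<close> from summing
  the wavelets of one level at a point, and the geometric series with ratio
  \<open>2 powr (- s0)\<close>. Taking the ratio at \<open>s0\<close> makes the constant uniform in
  \<open>s \<ge> s0\<close>.\<close>

definition tail_const :: "nat \<Rightarrow> real \<Rightarrow> real" where
  "tail_const k s0 = 2 ^ k * Q ^ k / (1 - 2 powr (- s0))"

lemma tail_const_pos: "0 < s0 \<Longrightarrow> 0 < tail_const k s0"
  using Q_power_ge_1[of k] powr_less_mono[of "- s0" 0 2]
  by (auto simp: tail_const_def intro!: divide_pos_pos)

text \<open>Telescoping over levels: the detail of level \<open>k\<close> is at most a constant
  times \<open>2 powr (- (k * s))\<close>, the geometric series sums these, and the projections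
  converge to \<open>h\<close>.\<close>

lemma proj_error:
  fixes h :: "real ^ 'd \<Rightarrow> real"
  assumes h: "coef_ball s M h" and s: "0 < s0" "s0 \<le> s" and l: "J0 \<le> l" and x: "x \<in> unit_cube"
  shows "\<bar>h x - proj l h x\<bar> \<le> tail_const CARD('d) s0 * M * 2 powr (- (real l * s))"
proof -
  let ?q = "2 powr (- s0)" and ?K = "2 ^ CARD('d) * Q ^ CARD('d) * M"
  have q: "0 < ?q" "?q < 1" using s powr_less_mono[of "- s0" 0 2] by auto
  have c: "continuous_on unit_cube h" using h by (rule coef_ball_continuous)
  obtain m0 :: "nat ^ 'd" where m0: "m0 \<in> level_indices J0" using level_indices_nonempty by blast
  have "0 \<le> 2 powr (real J0 * (s + real CARD('d) / 2)) * \<bar>l2_inner unit_cube h (scaling J0 m0)\<bar>" by simp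
  also have "\<dots> \<le> M" using h m0 by (simp add: coef_ball_def)
  finally have M: "0 \<le> M" .
  have K: "0 \<le> ?K" using M Q_power_ge_1[of "CARD('d)"] by simp
  have step: "\<bar>proj (Suc k) h x - proj k h x\<bar> \<le> ?K * 2 powr (- (real k * s))" if k: "J0 \<le> k" for k
  proof -
    have coef: "\<bar>l2_inner unit_cube h (wavelet B v k m)\<bar> \<le> M * 2 powr (- (real k * (s + real CARD('d) / 2)))"
      if "m \<in> level_indices k" "v \<noteq> (\<chi> j. False)" for m v
    proof -
      have "2 powr (real k * (s + real CARD('d) / 2)) * \<bar>l2_inner unit_cube h (wavelet B v k m)\<bar> \<le> M"
        using h k that by (simp add: coef_ball_def)
      then show ?thesis by (simp add: powr_minus field_simps)
    qed
    have "\<bar>proj (Suc k) h x - proj k h x\<bar> \<le> (\<Sum>v\<in>UNIV - {\<chi> j. False}. \<Sum>m\<in>level_indices k. \<bar>l2_inner unit_cube h (wavelet B v k m)\<bar> * \<bar>wavelet B v k m x\<bar>)"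
      unfolding proj_Suc[OF k c x]
      by (simp, rule order_trans[OF sum_abs], intro sum_mono, rule order_trans[OF sum_abs]) (simp add: abs_mult)
    also have "\<dots> \<le> (\<Sum>v\<in>UNIV - {\<chi> j. False}. \<Sum>m\<in>level_indices k. M * 2 powr (- (real k * (s + real CARD('d) / 2))) * \<bar>wavelet B v k m x\<bar>)"
      by (intro sum_mono mult_right_mono coef) auto
    also have "\<dots> = (\<Sum>v\<in>UNIV - {\<chi> j. False}. M * 2 powr (- (real k * (s + real CARD('d) / 2))) * (\<Sum>m\<in>level_indices k. \<bar>wavelet B v k m x\<bar>))"
      by (simp add: sum_distrib_left)
    also have "\<dots> \<le> (\<Sum>v\<in>(UNIV :: (bool ^ 'd) set) - {\<chi> j. False}. M * 2 powr (- (real k * (s + real CARD('d) / 2))) * (Q ^ CARD('d) * 2 powr (real k * real CARD('d) / 2)))"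
      using M by (intro sum_mono mult_left_mono wavelet_abs_sum k x) auto
    also have "\<dots> \<le> 2 ^ CARD('d) * (M * 2 powr (- (real k * (s + real CARD('d) / 2))) * (Q ^ CARD('d) * 2 powr (real k * real CARD('d) / 2)))"
    proof -
      have "card ((UNIV :: (bool ^ 'd) set) - {\<chi> j. False}) \<le> card (UNIV :: (bool ^ 'd) set)"
        by (intro card_mono) auto
      also have "\<dots> = 2 ^ CARD('d)"
        using card_vec_set[of "\<lambda>_::'d. UNIV :: bool set"] by simp
      finally have "real (card ((UNIV :: (bool ^ 'd) set) - {\<chi> j. False})) \<le> 2 ^ CARD('d)"
        by (metis of_nat_le_iff of_nat_numeral of_nat_power)
      then show ?thesis
        using M Q_power_ge_1[of "CARD('d)"] by (simp del: of_nat_diff card_Diff_insert add: mult_right_mono)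
    qed
    also have "\<dots> = ?K * 2 powr (- (real k * s))"
    proof -
      have "2 powr (- (real k * (s + real CARD('d) / 2))) * 2 powr (real k * real CARD('d) / 2) = 2 powr (- (real k * s))"
        by (simp add: powr_add[symmetric] algebra_simps)
      then show ?thesis by (simp add: mult_ac)
    qed
    finally show ?thesis .
  qed
  have bound: "\<bar>proj (l + k) h x - proj l h x\<bar> \<le> ?K * 2 powr (- (real l * s)) * (\<Sum>i<k. ?q ^ i)" for k
  proof (induction k)
    case (Suc k)
    have "\<bar>proj (Suc (l + k)) h x - proj (l + k) h x\<bar> \<le> ?K * 2 powr (- (real (l + k) * s))"
      using l by (intro step) simp
    also have "\<dots> = ?K * 2 powr (- (real l * s)) * 2 powr (- (real k * s))"
      by (simp add: powr_add[symmetric] algebra_simps)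
    also have "\<dots> \<le> ?K * 2 powr (- (real l * s)) * ?q ^ k"
    proof (intro mult_left_mono)
      have "2 powr (- (real k * s)) \<le> 2 powr (- (real k * s0))"
        using s by (intro powr_mono) (auto intro: mult_left_mono)
      also have "\<dots> = ?q ^ k" by (simp add: powr_realpow[symmetric] powr_powr mult.commute)
      finally show "2 powr (- (real k * s)) \<le> ?q ^ k" .
    qed (use K in auto)
    finally show ?case using Suc by (simp add: distrib_left)
  qed simp
  have "\<bar>proj (l + k) h x - proj l h x\<bar> \<le> tail_const CARD('d) s0 * M * 2 powr (- (real l * s))" for k
  proof -
    have "(\<Sum>i<k. ?q ^ i) \<le> 1 / (1 - ?q)"
      using q by (subst sum_gp_strict) (auto intro!: divide_right_mono)
    then have "?K * 2 powr (- (real l * s)) * (\<Sum>i<k. ?q ^ i) \<le> ?K * 2 powr (- (real l * s)) * (1 / (1 - ?q))"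
      using K by (intro mult_left_mono) auto
    also have "\<dots> = tail_const CARD('d) s0 * M * 2 powr (- (real l * s))"
      by (simp add: tail_const_def)
    finally show ?thesis using bound[of k] by linarith
  qed
  moreover have "(\<lambda>k. \<bar>proj (l + k) h x - proj l h x\<bar>) \<longlonglongrightarrow> \<bar>h x - proj l h x\<bar>"
  proof -
    have "(\<lambda>k. proj (k + l) h x) \<longlonglongrightarrow> h x"
      using proj_tendsto[OF c x] by (rule LIMSEQ_ignore_initial_segment)
    then show ?thesis by (intro tendsto_intros) (simp add: add.commute)
  qed
  ultimately show ?thesis by (intro LIMSEQ_le_const2) auto
qed

text \<open>One fixed projection \<open>proj J\<close> approximates the whole class within
  \<open>\<epsilon> / 4\<close>. Its image lies in a finite-dimensional space and has bounded
  coefficients there, so the projected functions share a modulus of continuity. The level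
  \<open>l0\<close> obtained is the same for all densities of the model.\<close>

lemma coef_ball_equicontinuous:
  fixes M U s0 \<epsilon> :: real
  assumes s0: "0 < s0" and e: "0 < \<epsilon>" and M: "0 \<le> M" and U: "0 \<le> U"
  shows "\<exists>l0\<ge>J0. \<forall>l\<ge>l0. \<forall>s\<ge>s0. \<forall>h :: real ^ 'd \<Rightarrow> real. coef_ball s M h \<longrightarrow> (\<forall>x\<in>unit_cube. \<bar>h x\<bar> \<le> U) \<longrightarrow>
    (\<forall>x\<in>unit_cube. \<forall>y\<in>unit_cube. (\<forall>j. \<bar>x $ j - y $ j\<bar> \<le> Q / 2 ^ l) \<longrightarrow> \<bar>h x - h y\<bar> \<le> \<epsilon>)"
proof -
  let ?t = "tail_const CARD('d) s0 * M"
  have t: "0 \<le> ?t" using tail_const_pos[OF s0, of "CARD('d)"] M by simp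
  obtain J where J: "J0 \<le> J" "?t * 2 powr (- (real J * s0)) \<le> \<epsilon> / 4"
  proof -
    have "2 powr (- s0) < 1" using s0 powr_less_mono[of "- s0" 0 2] by auto
    then have "(\<lambda>k. ?t * (2 powr (- s0)) ^ k) \<longlonglongrightarrow> ?t * 0"
      by (intro tendsto_intros LIMSEQ_power_zero) auto
    then have "eventually (\<lambda>k. ?t * (2 powr (- s0)) ^ k < \<epsilon> / 4) sequentially"
      using e by (intro order_tendstoD) auto
    then obtain k0 where "\<And>k. k \<ge> k0 \<Longrightarrow> ?t * (2 powr (- s0)) ^ k < \<epsilon> / 4"
      by (auto simp: eventually_sequentially)
    then have "?t * (2 powr (- s0)) ^ (max k0 J0) < \<epsilon> / 4" by simp
    then show ?thesis
      using that[of "max k0 J0"] by (simp add: powr_realpow[symmetric] powr_powr mult.commute)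
  qed
  define c where "c = U * (Q ^ CARD('d) * 2 powr (- (real J * real CARD('d) / 2)))"
  have c: "0 \<le> c" using U Q_power_ge_1[of "CARD('d)"] by (simp add: c_def)
  define Z where "Z = (level_indices J :: (nat ^ 'd) set)"
  \<comment> \<open>An equal share of \<open>\<epsilon> / 2\<close> for each scaling function of
    level \<open>J\<close>, weighted by the coefficient bound \<open>c\<close>; adding 1 to
    \<open>c\<close> avoids a division by zero.\<close>
  define e' where "e' = \<epsilon> / (2 * (c + 1) * real (card Z))"
  have Z: "finite Z" "0 < card Z"
    using level_indices_nonempty by (auto simp: Z_def card_gt_0_iff)
  have e': "0 < e'" "real (card Z) * (c * e') \<le> \<epsilon> / 2"
  proof -
    show "0 < e'" using e c Z unfolding e'_def by (intro divide_pos_pos mult_pos_pos) auto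
    have "real (card Z) * (c * e') = \<epsilon> / 2 * (c / (c + 1))"
    proof -
      have "k * (c * (\<epsilon> / (2 * p * k))) = \<epsilon> / 2 * (c / p)" if "p \<noteq> 0" "k \<noteq> 0" for p k :: real
        using that by (simp add: field_simps)
      then show ?thesis using Z c unfolding e'_def by auto
    qed
    also have "\<dots> \<le> \<epsilon> / 2 * 1"
      using e c by (intro mult_left_mono) auto
    finally show "real (card Z) * (c * e') \<le> \<epsilon> / 2" by simp
  qed
  have "\<forall>m. \<exists>\<delta>>0. m \<in> Z \<longrightarrow> (\<forall>x\<in>unit_cube. \<forall>y\<in>unit_cube. dist y x < \<delta> \<longrightarrow> dist (scaling J m y) (scaling J m x) < e')"
  proof
    fix m :: "nat ^ 'd"
    show "\<exists>\<delta>>0. m \<in> Z \<longrightarrow> (\<forall>x\<in>unit_cube. \<forall>y\<in>unit_cube. dist y x < \<delta> \<longrightarrow> dist (scaling J m y) (scaling J m x) < e')"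
    proof (cases "m \<in> Z")
      case True
      then have "uniformly_continuous_on unit_cube (scaling J m)"
        using J by (intro compact_uniformly_continuous compact_unit_cube wavelet_continuous) (auto simp: Z_def)
      then show ?thesis unfolding uniformly_continuous_on_def using e'(1) by blast
    qed (auto intro: exI[of _ 1])
  qed
  then obtain \<delta> where \<delta>: "\<And>m. 0 < \<delta> m" "\<And>m x y. m \<in> Z \<Longrightarrow> x \<in> unit_cube \<Longrightarrow> y \<in> unit_cube \<Longrightarrow> dist y x < \<delta> m \<Longrightarrow> dist (scaling J m y) (scaling J m x) < e'"
    by metis
  have "0 < Min (\<delta> ` Z)" using Z \<delta>(1) by (subst Min_gr_iff) (auto simp: card_gt_0_iff)
  then obtain l0 where l0: "J0 \<le> l0" "\<And>l x y. l0 \<le> l \<Longrightarrow> (\<forall>j. \<bar>x $ j - (y :: real ^ 'd) $ j\<bar> \<le> Q / 2 ^ l) \<Longrightarrow> dist x y < Min (\<delta> ` Z)"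
    using ex_level_within by blast
  show ?thesis
  proof (intro exI[of _ l0] conjI allI impI ballI)
    fix l s and h :: "real ^ 'd \<Rightarrow> real" and x y :: "real ^ 'd"
    assume l: "l0 \<le> l" and s: "s0 \<le> s" and h: "coef_ball s M h" and hU: "\<forall>x\<in>unit_cube. \<bar>h x\<bar> \<le> U"
      and x: "x \<in> unit_cube" and y: "y \<in> unit_cube" and xy: "\<forall>j. \<bar>x $ j - y $ j\<bar> \<le> Q / 2 ^ l"
    have err: "\<bar>h z - proj J h z\<bar> \<le> \<epsilon> / 4" if z: "z \<in> unit_cube" for z
    proof -
      have "\<bar>h z - proj J h z\<bar> \<le> ?t * 2 powr (- (real J * s))"
        by (rule proj_error[OF h s0 s J(1) z])
      also have "\<dots> \<le> ?t * 2 powr (- (real J * s0))"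
        using t s by (intro mult_left_mono powr_mono) (auto intro: mult_left_mono)
      finally show ?thesis using J(2) by linarith
    qed
    have d: "dist x y < Min (\<delta> ` Z)" using l0(2)[OF l] xy by blast
    have "\<bar>proj J h x - proj J h y\<bar> = \<bar>\<Sum>m\<in>Z. l2_inner unit_cube h (scaling J m) * (scaling J m x - scaling J m y)\<bar>"
      by (simp add: proj_def Z_def sum_subtractf right_diff_distrib)
    also have "\<dots> \<le> (\<Sum>m\<in>Z. \<bar>l2_inner unit_cube h (scaling J m)\<bar> * \<bar>scaling J m x - scaling J m y\<bar>)"
      by (rule order_trans[OF sum_abs]) (simp add: abs_mult)
    also have "\<dots> \<le> (\<Sum>m\<in>Z. c * e')"
    proof (intro sum_mono mult_mono)
      fix m assume m: "m \<in> Z"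
      show "\<bar>l2_inner unit_cube h (scaling J m)\<bar> \<le> c"
        unfolding c_def using J m h hU by (intro l2_inner_wavelet_le) (auto simp: Z_def coef_ball_continuous)
      have "dist x y < \<delta> m" using d m Z by (metis Min_gr_iff finite_imageI image_eqI image_is_empty empty_iff)
      then show "\<bar>scaling J m x - scaling J m y\<bar> \<le> e'"
        using \<delta>(2)[OF m y x] by (simp add: dist_real_def)
    qed (use c in auto)
    also have "\<dots> \<le> \<epsilon> / 2" using e'(2) by simp
    finally show "\<bar>h x - h y\<bar> \<le> \<epsilon>" using err[OF x] err[OF y] by linarith
  qed (rule l0)
qed

text \<open>The tests at level \<open>l\<close> recover \<open>u\<close> up to its distance to the level: convolving \<open>a u\<close> with
  the projection kernel gives \<open>a u\<close> back, because \<open>a\<close> is almost constant at scale \<open>2\<^sup>-\<^sup>l\<close>.  The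
  fluctuations of \<open>T\<close> are needed only on products of two level-\<open>l\<close> functions.\<close>

lemma stability:
  fixes u a :: "real ^ 'd \<Rightarrow> real"
  assumes l: "J0 \<le> l" and T: "positive_functional T"
    and u: "continuous_on unit_cube u" and a: "continuous_on unit_cube a"
    and aL: "0 < aL" "\<And>x. x \<in> unit_cube \<Longrightarrow> aL \<le> a x" and aU: "\<And>x. x \<in> unit_cube \<Longrightarrow> a x \<le> aU"
    and e: "0 \<le> \<epsilon>" "2 * ((Q ^ CARD('d)) ^ 3 + (Q ^ CARD('d)) ^ 2) * \<epsilon> \<le> aL"
    and osc: "\<And>x y. x \<in> unit_cube \<Longrightarrow> y \<in> unit_cube \<Longrightarrow> (\<And>j. \<bar>x $ j - y $ j\<bar> \<le> Q / 2 ^ l) \<Longrightarrow> \<bar>a x - a y\<bar> \<le> \<epsilon>"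
    and T1: "\<And>m m'. m \<in> level_indices l \<Longrightarrow> m' \<in> level_indices l \<Longrightarrow>
      \<bar>T (\<lambda>x. scaling l m x * scaling l m' x) - (LINT x:unit_cube|lborel. a x * (scaling l m x * scaling l m' x))\<bar> \<le> \<epsilon>"
    and T2: "\<And>m. m \<in> level_indices l \<Longrightarrow> T (\<lambda>x. \<bar>scaling l m x\<bar>) \<le> \<tau> * 2 powr (- (real l * real CARD('d) / 2))"
    and T3: "\<And>m. m \<in> level_indices l \<Longrightarrow> \<bar>T (\<lambda>x. u x * scaling l m x)\<bar> \<le> \<eta> * 2 powr (- (real l * real CARD('d) / 2))"
    and \<rho>: "\<And>x. x \<in> unit_cube \<Longrightarrow> \<bar>u x - proj l u x\<bar> \<le> \<rho>"
    and x: "x \<in> unit_cube"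
  shows "\<bar>u x\<bar> \<le> 2 / aL * (Q ^ CARD('d) * \<eta> + \<rho> * (aL + Q ^ CARD('d) * \<tau> + aU * (Q ^ CARD('d))\<^sup>2))"
proof -
  define F where "F = Q ^ CARD('d)"
  define r where "r = 2 powr (- (real l * real CARD('d) / 2))"
  have F: "1 \<le> F" unfolding F_def by (rule Q_power_ge_1)
  have r: "0 < r" by (simp add: r_def)
  note cont = continuous_intros wavelet_continuous l u a proj_continuous
  \<comment> \<open>The whole estimate is made at a maximum point of |\<open>u\<close>|: every error
    proportional to \<open>\<epsilon>\<close> is measured in \<open>U\<close>, the quantity to be
    bounded.\<close>
  obtain x0 where x0: "x0 \<in> unit_cube" "\<And>y. y \<in> unit_cube \<Longrightarrow> \<bar>u y\<bar> \<le> \<bar>u x0\<bar>"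
    using continuous_attains_sup[of unit_cube "\<lambda>x. \<bar>u x\<bar>"] compact_unit_cube unit_cube_nonempty u
    by (metis continuous_on_rabs empty_iff)
  define U where "U = \<bar>u x0\<bar>"
  have U: "0 \<le> U" "\<And>y. y \<in> unit_cube \<Longrightarrow> \<bar>u y\<bar> \<le> U" using x0 by (auto simp: U_def)
  have \<rho>0: "0 \<le> \<rho>" using \<rho>[OF x] by linarith
  have aU0: "0 < aU" using aL(1) aL(2)[OF x] aU[OF x] by linarith
  have coef: "\<bar>l2_inner unit_cube u (scaling l m)\<bar> \<le> U * (F * r)" if "m \<in> level_indices l" for m
    unfolding F_def r_def using that U by (intro l2_inner_wavelet_le l u)
  \<comment> \<open>The weighted coefficient is compared with the test of \<open>u\<close>.
    Replacing \<open>u\<close> by its projection costs \<open>\<rho>\<close> under \<open>T\<close>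
    and under the integral; on the projection the two differ only through Gram entries.\<close>
  have main: "\<bar>l2_inner unit_cube (\<lambda>y. a y * u y) (scaling l m)\<bar> \<le> (F\<^sup>2 * U * \<epsilon> + \<eta> + \<rho> * \<tau> + aU * \<rho> * F) * r"
    if m: "m \<in> level_indices l" for m
  proof -
    let ?c = "\<lambda>m'. l2_inner unit_cube u (scaling l m')"
    let ?T = "\<lambda>m'. T (\<lambda>x. scaling l m' x * scaling l m x)"
    let ?I = "\<lambda>m'. LINT x:unit_cube|lborel. a x * (scaling l m' x * scaling l m x)"
    let ?S = "{m'\<in>level_indices l. \<exists>x\<in>unit_cube. scaling l m x \<noteq> 0 \<and> scaling l m' x \<noteq> 0}"
    have 0: "l2_inner unit_cube (\<lambda>y. a y * u y) (scaling l m) = (LINT x:unit_cube|lborel. a x * (u x * scaling l m x))"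
      by (simp add: l2_inner_def mult.assoc)
    have Tp: "T (\<lambda>x. proj l u x * scaling l m x) = (\<Sum>m'\<in>level_indices l. ?c m' * ?T m')"
    proof -
      have "T (\<lambda>x. proj l u x * scaling l m x) = T (\<lambda>x. \<Sum>m'\<in>level_indices l. ?c m' * (scaling l m' x * scaling l m x))"
        by (simp add: proj_def sum_distrib_right mult.assoc)
      also have "\<dots> = (\<Sum>m'\<in>level_indices l. ?c m' * ?T m')"
        using m by (intro pf_sum[OF T] cont) auto
      finally show ?thesis .
    qed
    have Ip: "(LINT x:unit_cube|lborel. a x * (proj l u x * scaling l m x)) = (\<Sum>m'\<in>level_indices l. ?c m' * ?I m')"
    proof -
      have "(LINT x:unit_cube|lborel. a x * (proj l u x * scaling l m x))
          = (LINT x:unit_cube|lborel. (\<Sum>m'\<in>level_indices l. ?c m' * (a x * (scaling l m' x * scaling l m x))))"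
        by (simp add: proj_def sum_distrib_right sum_distrib_left mult_ac)
      also have "\<dots> = (\<Sum>m'\<in>level_indices l. LINT x:unit_cube|lborel. ?c m' * (a x * (scaling l m' x * scaling l m x)))"
        using m by (intro set_integral_sum unit_cube_integrable cont) auto
      finally show ?thesis by simp
    qed
    \<comment> \<open>Both matrices vanish exactly off the overlap set, so the error is summed over
      boundedly many entries and not over the whole level.\<close>
    have zero: "?T m' = 0" "?I m' = 0" if m': "m' \<in> level_indices l" "m' \<notin> ?S" for m'
    proof -
      have z: "scaling l m' x * scaling l m x = 0" if "x \<in> unit_cube" for x using m' that by auto
      have "\<bar>?T m'\<bar> \<le> T (\<lambda>x. 0)"
        using m m' z by (intro pf_abs_le[OF T] cont) auto
      then show "?T m' = 0" by (simp add: pf_zero[OF T])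
      have "?I m' = (LINT x:(unit_cube :: (real ^ 'd) set)|lborel. 0)"
        using z by (intro set_lebesgue_integral_cong) auto
      then show "?I m' = 0" by simp
    qed
    have "T (\<lambda>x. proj l u x * scaling l m x) - (LINT x:unit_cube|lborel. a x * (proj l u x * scaling l m x))
        = (\<Sum>m'\<in>level_indices l. ?c m' * (?T m' - ?I m'))"
      by (simp add: Tp Ip sum_subtractf right_diff_distrib)
    also have "\<dots> = (\<Sum>m'\<in>?S. ?c m' * (?T m' - ?I m'))"
      using zero by (intro sum.mono_neutral_right) auto
    finally have eq: "T (\<lambda>x. proj l u x * scaling l m x) - (LINT x:unit_cube|lborel. a x * (proj l u x * scaling l m x))
        = (\<Sum>m'\<in>?S. ?c m' * (?T m' - ?I m'))" .
    have "\<bar>\<Sum>m'\<in>?S. ?c m' * (?T m' - ?I m')\<bar> \<le> (\<Sum>m'\<in>?S. U * (F * r) * \<epsilon>)"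
      using coef T1 m e U F r
      by (intro order_trans[OF sum_abs] sum_mono) (auto simp: abs_mult intro!: mult_mono)
    also have "\<dots> = real (card ?S) * (U * (F * r) * \<epsilon>)" by simp
    also have "\<dots> \<le> F * (U * (F * r) * \<epsilon>)"
      unfolding F_def using scaling_overlap[OF l m] U e r Q_power_ge_1[of "CARD('d)"]
      by (intro mult_right_mono) auto
    finally have 1: "\<bar>T (\<lambda>x. proj l u x * scaling l m x) - (LINT x:unit_cube|lborel. a x * (proj l u x * scaling l m x))\<bar>
      \<le> F * (U * (F * r) * \<epsilon>)"
      unfolding eq .
    have "\<bar>T (\<lambda>x. (u x - proj l u x) * scaling l m x)\<bar> \<le> T (\<lambda>x. \<rho> * \<bar>scaling l m x\<bar>)"
      using m \<rho> by (intro pf_abs_le[OF T] cont) (auto simp: abs_mult intro!: mult_right_mono)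
    also have "\<dots> = \<rho> * T (\<lambda>x. \<bar>scaling l m x\<bar>)"
      using m by (intro pf_scale[OF T] cont) auto
    also have "\<dots> \<le> \<rho> * (\<tau> * r)" using T2[OF m] \<rho>0 by (intro mult_left_mono) (auto simp: r_def)
    finally have 2: "\<bar>T (\<lambda>x. (u x - proj l u x) * scaling l m x)\<bar> \<le> \<rho> * (\<tau> * r)" .
    have d2: "T (\<lambda>x. (u x - proj l u x) * scaling l m x) = T (\<lambda>x. u x * scaling l m x) - T (\<lambda>x. proj l u x * scaling l m x)"
      unfolding left_diff_distrib using m by (intro pf_diff[OF T] cont)
    have "\<bar>LINT x:unit_cube|lborel. a x * ((u x - proj l u x) * scaling l m x)\<bar> \<le> (LINT x:unit_cube|lborel. aU * \<rho> * \<bar>scaling l m x\<bar>)"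
    proof (intro abs_set_integral_le unit_cube_integrable cont m)
      fix y :: "real ^ 'd" assume y: "y \<in> unit_cube"
      have "\<bar>a y\<bar> * \<bar>u y - proj l u y\<bar> \<le> aU * \<rho>"
        using aL(1) aL(2)[OF y] aU[OF y] \<rho>[OF y] by (intro mult_mono) auto
      then show "\<bar>a y * ((u y - proj l u y) * scaling l m y)\<bar> \<le> aU * \<rho> * \<bar>scaling l m y\<bar>"
        by (simp add: abs_mult mult.assoc[symmetric] mult_right_mono)
    qed
    also have "\<dots> = aU * \<rho> * (LINT x:unit_cube|lborel. \<bar>scaling l m x\<bar>)" by simp
    also have "\<dots> \<le> aU * \<rho> * (F * r)"
      unfolding F_def r_def using aU0 \<rho>0 by (intro mult_left_mono wavelet_L1 l m) auto
    finally have 3: "\<bar>LINT x:unit_cube|lborel. a x * ((u x - proj l u x) * scaling l m x)\<bar> \<le> aU * \<rho> * (F * r)" .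
    have d3: "(LINT x:unit_cube|lborel. a x * ((u x - proj l u x) * scaling l m x))
        = (LINT x:unit_cube|lborel. a x * (u x * scaling l m x)) - (LINT x:unit_cube|lborel. a x * (proj l u x * scaling l m x))"
    proof -
      have i: "set_integrable lborel unit_cube (\<lambda>x. a x * (u x * scaling l m x))"
          "set_integrable lborel unit_cube (\<lambda>x. a x * (proj l u x * scaling l m x))"
        by (intro unit_cube_integrable cont m)+
      show ?thesis
        using set_integral_diff(2)[OF i] by (simp add: left_diff_distrib right_diff_distrib)
    qed
    have "\<bar>l2_inner unit_cube (\<lambda>y. a y * u y) (scaling l m)\<bar>
        \<le> F * (U * (F * r) * \<epsilon>) + \<eta> * r + \<rho> * (\<tau> * r) + aU * \<rho> * (F * r)"
      using 0 1 2 d2 3 d3 T3[OF m] unfolding r_def[symmetric] by linarith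
    then show ?thesis by (simp add: algebra_simps power2_eq_square)
  qed
  define E where "E = F\<^sup>2 * U * \<epsilon> + \<eta> + \<rho> * \<tau> + aU * \<rho> * F"
  have E0: "0 \<le> E"
  proof -
    obtain m :: "nat ^ 'd" where "m \<in> level_indices l" using level_indices_nonempty by blast
    from main[OF this] have "0 \<le> E * r" unfolding E_def using abs_ge_zero order_trans by blast
    then show ?thesis using r by (simp add: zero_le_mult_iff)
  qed
  have p1: "\<bar>proj l (\<lambda>y. a y * u y) x0\<bar> \<le> F * E"
    unfolding F_def using main E0 unfolding E_def[symmetric] r_def
    by (intro proj_abs_le[OF l x0(1)]) auto
  \<comment> \<open>Freezing \<open>a\<close> at \<open>x0\<close> turns the projection of
    \<open>a * u\<close> into \<open>a x0\<close> times that of \<open>u\<close>; the kernel sees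
    \<open>a\<close> only at distances where it oscillates by at most
    \<open>\<epsilon>\<close>.\<close>
  have p2: "\<bar>proj l (\<lambda>y. (a y - a x0) * u y) x0\<bar> \<le> (\<epsilon> * U) * F\<^sup>2"
    unfolding F_def
  proof (rule proj_abs_le_local[OF l x0(1)])
    fix y assume y: "y \<in> unit_cube" "\<And>j. \<bar>x0 $ j - y $ j\<bar> \<le> Q / 2 ^ l"
    have "\<bar>a x0 - a y\<bar> \<le> \<epsilon>" by (rule osc[OF x0(1) y])
    then show "\<bar>(a y - a x0) * u y\<bar> \<le> \<epsilon> * U"
      unfolding abs_mult using U(2)[OF y(1)] e by (intro mult_mono) (auto simp: abs_minus_commute)
  qed (use U e in \<open>auto intro!: cont\<close>)
  have p3: "proj l (\<lambda>y. (a y - a x0) * u y) x0 = proj l (\<lambda>y. a y * u y) x0 - a x0 * proj l u x0"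
    unfolding left_diff_distrib by (subst proj_diff) (auto intro!: cont simp: proj_scale)
  have "aL * \<bar>proj l u x0\<bar> \<le> \<bar>a x0 * proj l u x0\<bar>"
    unfolding abs_mult using aL(1) aL(2)[OF x0(1)] by (intro mult_right_mono) auto
  also have "\<dots> \<le> F * E + \<epsilon> * U * F\<^sup>2" using p1 p2 p3 by linarith
  finally have q: "aL * \<bar>proj l u x0\<bar> \<le> F * E + \<epsilon> * U * F\<^sup>2" .
  have "U \<le> \<bar>proj l u x0\<bar> + \<rho>" using \<rho>[OF x0(1)] unfolding U_def by linarith
  then have "aL * U \<le> aL * (\<bar>proj l u x0\<bar> + \<rho>)" using aL(1) by (intro mult_left_mono) auto
  also have "\<dots> \<le> F * E + \<epsilon> * U * F\<^sup>2 + aL * \<rho>" using q by (simp add: distrib_left)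
  also have "\<dots> = (F ^ 3 + F\<^sup>2) * \<epsilon> * U + (F * \<eta> + \<rho> * (aL + F * \<tau> + aU * F\<^sup>2))"
    by (simp add: E_def algebra_simps power2_eq_square power3_eq_cube)
  \<comment> \<open>The absorption: by the smallness of \<open>\<epsilon>\<close> the terms in
    \<open>U\<close> on the right take up at most half of \<open>aL * U\<close>.\<close>
  also have "\<dots> \<le> aL / 2 * U + (F * \<eta> + \<rho> * (aL + F * \<tau> + aU * F\<^sup>2))"
  proof (intro add_right_mono mult_right_mono U(1))
    show "(F ^ 3 + F\<^sup>2) * \<epsilon> \<le> aL / 2"
      using e(2) unfolding F_def[symmetric] by (simp add: algebra_simps)
  qed
  finally have "U \<le> 2 / aL * (F * \<eta> + \<rho> * (aL + F * \<tau> + aU * F\<^sup>2))"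
    using aL(1) by (simp add: field_simps)
  then show ?thesis using U(2)[OF x] unfolding F_def by linarith
qed

end

subsection \<open>Concentration of empirical averages\<close>

lemma exp_le_quadratic:
  fixes x :: real
  assumes "\<bar>x\<bar> \<le> 1"
  shows "exp x \<le> 1 + x + x\<^sup>2"
proof (cases "0 \<le> x")
  case True
  then show ?thesis using assms by (intro exp_bound) auto
next
  case False
  define y where "y = - x"
  have y: "0 < y" "y \<le> 1" using False assms by (auto simp: y_def)
  \<comment> \<open>The product equals 1 plus the cube of \<open>y\<close>.\<close>
  have "1 \<le> (1 + y) * (1 - y + y\<^sup>2)"
    using y by (simp add: algebra_simps power2_eq_square)
  also have "\<dots> \<le> exp y * (1 - y + y\<^sup>2)"
    using y by (intro mult_right_mono exp_ge_add_one_self) (auto simp: power2_eq_square)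
  finally have "exp (- y) \<le> 1 - y + y\<^sup>2"
    by (simp add: exp_minus field_simps)
  then show ?thesis by (simp add: y_def)
qed

definition empirical :: "nat \<Rightarrow> ('a \<Rightarrow> real) \<Rightarrow> (nat \<Rightarrow> 'a) \<Rightarrow> real" where
  "empirical n F \<omega> = (\<Sum>i<n. F (\<omega> i)) / real n"

lemma prob_space_sample_law: "prob_space P \<Longrightarrow> prob_space (sample_law n P)"
  unfolding sample_law_def by (intro prob_space_PiM)

lemma empirical_measurable [measurable]:
  assumes [measurable]: "F \<in> borel_measurable P"
  shows "empirical n F \<in> borel_measurable (sample_law n P)"
  unfolding empirical_def[abs_def] sample_law_def by measurable

text \<open>The condition \<open>t * b \<le> 1\<close> keeps the exponent in the range of the
  quadratic bound for exp. The linear term integrates to 0, and only the second moment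
  remains.\<close>

lemma exp_moment_bound:
  fixes F :: "'a \<Rightarrow> real"
  assumes P: "prob_space P" and F [measurable]: "F \<in> borel_measurable P" and b: "AE z in P. \<bar>F z\<bar> \<le> b"
    and mean: "(\<integral>z. F z \<partial>P) = 0" and var: "(\<integral>z. (F z)\<^sup>2 \<partial>P) \<le> v" and t: "0 \<le> t" "t * b \<le> 1"
  shows "integrable P (\<lambda>z. exp (t * F z))" "(\<integral>z. exp (t * F z) \<partial>P) \<le> exp (t\<^sup>2 * v)"
proof -
  interpret prob_space P by fact
  have F1: "integrable P F" using b by (intro integrable_const_bound[where B = b]) auto
  have F2: "integrable P (\<lambda>z. (F z)\<^sup>2)"
  proof (rule integrable_const_bound[where B = "b\<^sup>2"])
    show "AE z in P. norm ((F z)\<^sup>2) \<le> b\<^sup>2"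
      using b by eventually_elim (simp add: abs_le_square_iff[symmetric])
  qed simp
  have le: "AE z in P. exp (t * F z) \<le> 1 + t * F z + t\<^sup>2 * (F z)\<^sup>2"
    using b
  proof eventually_elim
    case (elim z)
    have "\<bar>t * F z\<bar> \<le> t * b" using elim t by (simp add: abs_mult mult_left_mono)
    then show ?case using exp_le_quadratic[of "t * F z"] t by (simp add: power_mult_distrib)
  qed
  show E: "integrable P (\<lambda>z. exp (t * F z))"
  proof (rule integrable_const_bound[where B = "exp (t * b)"])
    show "AE z in P. norm (exp (t * F z)) \<le> exp (t * b)"
      using b by eventually_elim (use t in \<open>auto intro!: mult_left_mono\<close>)
  qed simp
  have "(\<integral>z. exp (t * F z) \<partial>P) \<le> (\<integral>z. 1 + t * F z + t\<^sup>2 * (F z)\<^sup>2 \<partial>P)"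
    using F1 F2 le by (intro integral_mono_AE E) auto
  also have "\<dots> = 1 + t\<^sup>2 * (\<integral>z. (F z)\<^sup>2 \<partial>P)"
    using F1 F2 mean by (simp add: prob_space)
  also have "\<dots> \<le> 1 + t\<^sup>2 * v" using var by (intro add_left_mono mult_left_mono) auto
  also have "\<dots> \<le> exp (t\<^sup>2 * v)" by (rule exp_ge_add_one_self)
  finally show "(\<integral>z. exp (t * F z) \<partial>P) \<le> exp (t\<^sup>2 * v)" .
qed

lemma bernstein_one_sided:
  fixes F :: "'a \<Rightarrow> real"
  assumes P: "prob_space P" and F [measurable]: "F \<in> borel_measurable P" and b: "AE z in P. \<bar>F z\<bar> \<le> b"
    and mean: "(\<integral>z. F z \<partial>P) = 0" and var: "(\<integral>z. (F z)\<^sup>2 \<partial>P) \<le> v" and v: "0 < v"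
    and e: "0 < e" "e * b \<le> 2 * v" and n: "0 < n"
  shows "measure (sample_law n P) {\<omega>\<in>space (sample_law n P). e \<le> empirical n F \<omega>} \<le> exp (- (real n * e\<^sup>2 / (4 * v)))"
proof -
  interpret prob_space P by fact
  interpret S: prob_space "sample_law n P" by (rule prob_space_sample_law) fact
  interpret PP: product_sigma_finite "\<lambda>_ :: nat. P" by standard
  \<comment> \<open>The minimizer of the exponent \<open>t\<^sup>2 * v - t * e\<close>; the
    condition on \<open>e * b\<close> is exactly \<open>t * b \<le> 1\<close>.\<close>
  define t where "t = e / (2 * v)"
  have t: "0 < t" "t * b \<le> 1" using v e by (auto simp: t_def field_simps)
  note m = exp_moment_bound[OF P F b mean var less_imp_le[OF t(1)] t(2)]
  define G where "G \<omega> = (\<Prod>i<n. exp (t * F (\<omega> i)))" for \<omega> :: "nat \<Rightarrow> 'a"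
  have Gi: "integrable (sample_law n P) G"
    unfolding G_def[abs_def] sample_law_def by (intro PP.product_integrable_prod m) auto
  have "(\<integral>\<omega>. G \<omega> \<partial>sample_law n P) = (\<Prod>i<n. \<integral>z. exp (t * F z) \<partial>P)"
    unfolding G_def[abs_def] sample_law_def by (intro PP.product_integral_prod m) auto
  also have "\<dots> \<le> (\<Prod>i<n. exp (t\<^sup>2 * v))"
    using m(2) by (intro prod_mono) auto
  also have "\<dots> = exp (real n * (t\<^sup>2 * v))"
    by (simp add: exp_of_nat_mult)
  finally have GI: "(\<integral>\<omega>. G \<omega> \<partial>sample_law n P) \<le> exp (real n * (t\<^sup>2 * v))" .
  have G: "G \<omega> = exp (t * (real n * empirical n F \<omega>))" for \<omega>
  proof -
    have "real n * empirical n F \<omega> = (\<Sum>i<n. F (\<omega> i))" using n by (simp add: empirical_def)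
    then show ?thesis by (simp add: G_def exp_sum[symmetric] sum_distrib_left)
  qed
  have "measure (sample_law n P) {\<omega>\<in>space (sample_law n P). e \<le> empirical n F \<omega>}
      = measure (sample_law n P) {\<omega>\<in>space (sample_law n P). exp (t * (real n * e)) \<le> G \<omega>}"
    using t n by (simp add: G)
  also have "\<dots> \<le> (\<integral>\<omega>. G \<omega> \<partial>sample_law n P) / exp (t * (real n * e))"
    using Gi by (rule integral_Markov_inequality_measure[where A = "{}"]) (auto simp: G)
  also have "\<dots> \<le> exp (real n * (t\<^sup>2 * v)) / exp (t * (real n * e))"
    using GI by (intro divide_right_mono) auto
  also have "\<dots> = exp (- (real n * e\<^sup>2 / (4 * v)))"
    using v by (simp add: exp_diff[symmetric] t_def field_simps power2_eq_square)
  finally show ?thesis .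
qed

lemma bernstein:
  fixes F :: "'a \<Rightarrow> real"
  assumes P: "prob_space P" and F [measurable]: "F \<in> borel_measurable P" and b: "AE z in P. \<bar>F z\<bar> \<le> b"
    and var: "(\<integral>z. (F z)\<^sup>2 \<partial>P) \<le> v" and v: "0 < v"
    and e: "0 < e" "e * b \<le> v" and n: "0 < n"
  shows "measure (sample_law n P) {\<omega>\<in>space (sample_law n P). e \<le> \<bar>empirical n F \<omega> - (\<integral>z. F z \<partial>P)\<bar>}
    \<le> 2 * exp (- (real n * e\<^sup>2 / (4 * v)))"
proof -
  interpret prob_space P by fact
  interpret S: prob_space "sample_law n P" by (rule prob_space_sample_law) fact
  let ?m = "\<integral>z. F z \<partial>P"
  have F1: "integrable P F" using b by (intro integrable_const_bound[where B = b]) auto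
  have F2: "integrable P (\<lambda>z. (F z)\<^sup>2)"
  proof (rule integrable_const_bound[where B = "b\<^sup>2"])
    show "AE z in P. norm ((F z)\<^sup>2) \<le> b\<^sup>2"
      using b by eventually_elim (simp add: abs_le_square_iff[symmetric])
  qed simp
  have mb: "\<bar>?m\<bar> \<le> b"
  proof -
    have "\<bar>?m\<bar> \<le> (\<integral>z. \<bar>F z\<bar> \<partial>P)" by (rule integral_abs_bound)
    also have "\<dots> \<le> (\<integral>z. b \<partial>P)" using F1 b by (intro integral_mono_AE) auto
    finally show ?thesis by (simp add: prob_space)
  qed
  \<comment> \<open>\<open>c\<close> runs through both signs. Centring doubles the sup bound to
    \<open>2 * b\<close>, hence the condition \<open>e * b \<le> v\<close> here, and does not
    increase the second moment.\<close>
  have side: "measure (sample_law n P) {\<omega>\<in>space (sample_law n P). e \<le> empirical n (\<lambda>z. c * (F z - ?m)) \<omega>}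
    \<le> exp (- (real n * e\<^sup>2 / (4 * v)))" if c: "c = 1 \<or> c = - 1" for c :: real
  proof (rule bernstein_one_sided[OF P])
    show "AE z in P. \<bar>c * (F z - ?m)\<bar> \<le> 2 * b"
      using b by eventually_elim (use mb c in auto)
    show "(\<integral>z. c * (F z - ?m) \<partial>P) = 0" using F1 by (simp add: prob_space)
    have "(\<integral>z. (c * (F z - ?m))\<^sup>2 \<partial>P) = (\<integral>z. (F z)\<^sup>2 - 2 * ?m * F z + ?m\<^sup>2 \<partial>P)"
      using c by (intro Bochner_Integration.integral_cong) (auto simp: power2_eq_square algebra_simps)
    also have "\<dots> = (\<integral>z. (F z)\<^sup>2 \<partial>P) - ?m\<^sup>2"
      using F1 F2 by (simp add: prob_space power2_eq_square)
    also have "\<dots> \<le> v" using var by (smt (verit) zero_le_power2)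
    finally show "(\<integral>z. (c * (F z - ?m))\<^sup>2 \<partial>P) \<le> v" .
    show "e * (2 * b) \<le> 2 * v" using e by simp
  qed (use v e n in auto)
  have emp: "empirical n (\<lambda>z. c * (F z - ?m)) \<omega> = c * (empirical n F \<omega> - ?m)" for c \<omega>
    using n by (simp add: empirical_def sum_distrib_left[symmetric] sum_subtractf field_simps)
  have "{\<omega>\<in>space (sample_law n P). e \<le> \<bar>empirical n F \<omega> - ?m\<bar>}
      = {\<omega>\<in>space (sample_law n P). e \<le> empirical n (\<lambda>z. 1 * (F z - ?m)) \<omega>}
      \<union> {\<omega>\<in>space (sample_law n P). e \<le> empirical n (\<lambda>z. - 1 * (F z - ?m)) \<omega>}"
    unfolding emp by auto
  then have "measure (sample_law n P) {\<omega>\<in>space (sample_law n P). e \<le> \<bar>empirical n F \<omega> - ?m\<bar>}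
      \<le> measure (sample_law n P) {\<omega>\<in>space (sample_law n P). e \<le> empirical n (\<lambda>z. 1 * (F z - ?m)) \<omega>}
      + measure (sample_law n P) {\<omega>\<in>space (sample_law n P). e \<le> empirical n (\<lambda>z. - 1 * (F z - ?m)) \<omega>}"
    by (auto intro!: measure_Un_le simp del: mult_1_left mult_minus1)
  then show ?thesis using side[of 1] side[of "- 1"] by linarith
qed

text \<open>The part of \<open>model_class\<close> about the law of one observation, with a single
  bound \<open>U\<close> and only continuity of \<open>f\<close> and \<open>g\<close>; smoothness is
  carried separately by \<open>coef_ball\<close>.\<close>

locale model =
  fixes P :: "(real \<times> (real ^ 'd)) measure" and f g :: "real ^ 'd \<Rightarrow> real" and U :: real
  assumes prob_P: "prob_space P" and sets_P [measurable_cong]: "sets P = sets borel"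
    and W_bounded: "AE z in P. \<bar>fst z\<bar> \<le> U"
    and cond_exp: "AE z in P. real_cond_exp P (vimage_algebra (space P) snd borel) fst z = f (snd z)"
    and density: "distributed P lborel snd (\<lambda>x. ennreal (indicator unit_cube x * g x))"
    and f_continuous: "continuous_on unit_cube f" and g_continuous: "continuous_on unit_cube g"
    and f_bounded: "\<And>x. x \<in> unit_cube \<Longrightarrow> \<bar>f x\<bar> \<le> U"
    and g_nonneg: "\<And>x. x \<in> unit_cube \<Longrightarrow> 0 \<le> g x" and g_bounded: "\<And>x. x \<in> unit_cube \<Longrightarrow> g x \<le> U"
begin

sublocale prob_space P by (rule prob_P)

abbreviation on_cube :: "(real ^ 'd \<Rightarrow> real) \<Rightarrow> real ^ 'd \<Rightarrow> real" where
  "on_cube H x \<equiv> indicator unit_cube x * H x"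

lemma on_cube_measurable: "continuous_on unit_cube H \<Longrightarrow> on_cube H \<in> borel_measurable borel"
  using borel_measurable_continuous_on_indicator[OF unit_cube_borel, of H] by simp

lemma fst_measurable [measurable]: "fst \<in> borel_measurable P"
  and snd_measurable [measurable]: "snd \<in> borel_measurable P"
  by (simp_all add: measurable_cong_sets[OF sets_P refl] borel_prod[symmetric])

lemma on_cube_snd_measurable [measurable]:
  "continuous_on unit_cube H \<Longrightarrow> (\<lambda>z. on_cube H (snd z)) \<in> borel_measurable P"
  by (rule measurable_compose[OF snd_measurable on_cube_measurable])

lemma U_nonneg: "0 \<le> U"
  using f_bounded[OF unit_cube_nonempty] by linarith

lemma integral_on_cube:
  assumes H: "continuous_on unit_cube H"
  shows "(\<integral>z. on_cube H (snd z) \<partial>P) = (LINT x:unit_cube|lborel. g x * H x)"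
proof -
  have "(\<integral>x. on_cube g x * on_cube H x \<partial>lborel) = (\<integral>z. on_cube H (snd z) \<partial>P)"
    using density on_cube_measurable[OF H]
    by (intro distributed_integral) (auto simp: g_nonneg indicator_def)
  moreover have "(\<integral>x. on_cube g x * on_cube H x \<partial>lborel) = (LINT x:unit_cube|lborel. g x * H x)"
    unfolding set_lebesgue_integral_def
    by (intro Bochner_Integration.integral_cong) (auto simp: indicator_def)
  ultimately show ?thesis by simp
qed

lemma integral_on_cube_le:
  assumes H: "continuous_on unit_cube H" "\<And>x. x \<in> unit_cube \<Longrightarrow> 0 \<le> H x"
  shows "(\<integral>z. on_cube H (snd z) \<partial>P) \<le> U * (LINT x:unit_cube|lborel. H x)"
proof -
  have "(LINT x:unit_cube|lborel. g x * H x) \<le> (LINT x:unit_cube|lborel. U * H x)"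
    using H g_bounded by (intro set_integral_mono unit_cube_integrable continuous_intros g_continuous mult_right_mono) auto
  then show ?thesis by (simp add: integral_on_cube H)
qed

lemma on_cube_bounded_integrable:
  assumes H: "continuous_on unit_cube H"
  shows "integrable P (\<lambda>z. on_cube H (snd z))" "integrable P (\<lambda>z. fst z * on_cube H (snd z))"
proof -
  obtain A where A: "0 \<le> A" "\<And>x. x \<in> unit_cube \<Longrightarrow> \<bar>H x\<bar> \<le> A"
    using unit_cube_bounded[OF H] by blast
  have le: "\<bar>on_cube H x\<bar> \<le> A" for x using A by (auto simp: indicator_def)
  show "integrable P (\<lambda>z. on_cube H (snd z))"
    using le by (intro integrable_const_bound[where B = A] on_cube_snd_measurable H) auto
  note [measurable] = on_cube_snd_measurable[OF H]
  show "integrable P (\<lambda>z. fst z * on_cube H (snd z))"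
  proof (rule integrable_const_bound[where B = "U * A"])
    show "AE z in P. norm (fst z * on_cube H (snd z)) \<le> U * A"
      using W_bounded
    proof eventually_elim
      case (elim z)
      then show ?case unfolding real_norm_def abs_mult
        using le[of "snd z"] U_nonneg A(1) by (intro mult_mono) (auto simp: abs_mult)
    qed
  qed measurable
qed

text \<open>A function of the design variable is measurable for the sigma-algebra in the conditional
  expectation and can be pulled out. So the residual is centred against every test function without
  any smoothness of the product of \<open>f\<close> and \<open>g\<close>.\<close>

lemma integral_residual:
  assumes H: "continuous_on unit_cube H"
  shows "(\<integral>z. (fst z - f (snd z)) * on_cube H (snd z) \<partial>P) = 0"
proof -
  let ?F = "vimage_algebra (space P) snd (borel :: (real ^ 'd) measure)"
  have sub: "subalgebra P ?F"
    unfolding subalgebra_def using sets_image_in_sets[OF _ snd_measurable] by simp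
  interpret finite_measure_subalgebra P ?F
    by unfold_locales (rule sub)
  have snd_F: "snd \<in> measurable ?F borel"
    by (rule measurable_vimage_algebra1) auto
  have "(\<integral>z. on_cube H (snd z) * real_cond_exp P ?F fst z \<partial>P) = (\<integral>z. on_cube H (snd z) * fst z \<partial>P)"
    using on_cube_bounded_integrable(2)[OF H]
    by (intro real_cond_exp_intg measurable_compose[OF snd_F on_cube_measurable[OF H]]) (auto simp: mult.commute)
  moreover have "(\<integral>z. on_cube H (snd z) * real_cond_exp P ?F fst z \<partial>P) = (\<integral>z. on_cube (\<lambda>x. f x * H x) (snd z) \<partial>P)"
  proof (rule integral_cong_AE)
    show "AE z in P. on_cube H (snd z) * real_cond_exp P ?F fst z = on_cube (\<lambda>x. f x * H x) (snd z)"
      using cond_exp by eventually_elim simp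
  qed (use on_cube_snd_measurable[OF H] on_cube_snd_measurable[OF continuous_on_mult[OF f_continuous H]] in measurable)
  moreover have "(\<integral>z. (fst z - f (snd z)) * on_cube H (snd z) \<partial>P)
      = (\<integral>z. fst z * on_cube H (snd z) \<partial>P) - (\<integral>z. on_cube (\<lambda>x. f x * H x) (snd z) \<partial>P)"
    using on_cube_bounded_integrable[OF H] on_cube_bounded_integrable(1)[OF continuous_on_mult[OF f_continuous H]]
    by (subst Bochner_Integration.integral_diff[symmetric]) (auto simp: algebra_simps)
  ultimately show ?thesis by (simp add: mult.commute)
qed

end

text \<open>40 is the 4 of the exponent times 10. The tenth power leaves room for a union bound over
  levels and pairs of indices that still ends at the fourth power.\<close>

lemma bernstein_n10:
  fixes F :: "'a \<Rightarrow> real"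
  assumes "prob_space P" "F \<in> borel_measurable P" "AE z in P. \<bar>F z\<bar> \<le> b"
    and "(\<integral>z. (F z)\<^sup>2 \<partial>P) \<le> v" "0 < v" "0 < e" "e * b \<le> v" and n: "2 \<le> n"
    and big: "40 * v * ln (real n) \<le> real n * e\<^sup>2"
  shows "measure (sample_law n P) {\<omega>\<in>space (sample_law n P). e \<le> \<bar>empirical n F \<omega> - (\<integral>z. F z \<partial>P)\<bar>}
    \<le> 2 / real n ^ 10"
proof -
  have "measure (sample_law n P) {\<omega>\<in>space (sample_law n P). e \<le> \<bar>empirical n F \<omega> - (\<integral>z. F z \<partial>P)\<bar>}
    \<le> 2 * exp (- (real n * e\<^sup>2 / (4 * v)))"
    using assms by (intro bernstein) auto
  also have "\<dots> \<le> 2 * exp (- (10 * ln (real n)))"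
    using big \<open>0 < v\<close> by (simp add: field_simps)
  also have "exp (- (10 * ln (real n))) = 1 / real n ^ 10"
    using n exp_of_nat_mult[of 10 "ln (real n)"] by (simp add: exp_minus field_simps)
  finally show ?thesis by simp
qed

section \<open>The event on which all empirical averages are accurate\<close>

context cdv_bounded
begin

text \<open>Gram entries need only the constant accuracy \<open>\<epsilon>\<close>; single averages
  need the noise level \<open>thr\<close>. The absolute values serve to bound the mass of a test,
  the third average is the test for the density, and the last, the residuals, the test for the
  regression function.\<close>

definition good_sample :: "(real ^ 'd \<Rightarrow> real) \<Rightarrow> (real ^ 'd \<Rightarrow> real) \<Rightarrow> nat \<Rightarrow> nat \<Rightarrow> real \<Rightarrow> real \<Rightarrow>
    (nat \<Rightarrow> real \<times> (real ^ 'd)) \<Rightarrow> bool" where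
  "good_sample f g n L \<epsilon> thr \<omega> \<longleftrightarrow> (\<forall>l\<in>{J0..L}. \<forall>m\<in>level_indices l.
     (\<forall>m'\<in>level_indices l. \<bar>empirical n (\<lambda>z. indicator unit_cube (snd z) * (scaling l m (snd z) * scaling l m' (snd z))) \<omega>
        - (LINT x:unit_cube|lborel. g x * (scaling l m x * scaling l m' x))\<bar> \<le> \<epsilon>) \<and>
     \<bar>empirical n (\<lambda>z. indicator unit_cube (snd z) * \<bar>scaling l m (snd z)\<bar>) \<omega>
        - (LINT x:unit_cube|lborel. g x * \<bar>scaling l m x\<bar>)\<bar> \<le> thr \<and>
     \<bar>empirical n (\<lambda>z. indicator unit_cube (snd z) * scaling l m (snd z)) \<omega>
        - (LINT x:unit_cube|lborel. g x * scaling l m x)\<bar> \<le> thr \<and>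
     \<bar>empirical n (\<lambda>z. (fst z - f (snd z)) * (indicator unit_cube (snd z) * scaling l m (snd z))) \<omega>\<bar> \<le> thr)"

lemma scaling_product_L1:
  fixes m m' :: "nat ^ 'd"
  assumes l: "J0 \<le> l" and m: "m \<in> level_indices l" "m' \<in> level_indices l"
  shows "(LINT x:unit_cube|lborel. \<bar>scaling l m x\<bar> * \<bar>scaling l m' x\<bar>) \<le> (Q ^ CARD('d))\<^sup>2"
proof -
  let ?r = "Q ^ CARD('d) * 2 powr (real l * real CARD('d) / 2)"
  have "(LINT x:unit_cube|lborel. \<bar>scaling l m x\<bar> * \<bar>scaling l m' x\<bar>) \<le> (LINT x:unit_cube|lborel. ?r * \<bar>scaling l m' x\<bar>)"
    using l m by (intro set_integral_mono unit_cube_integrable continuous_intros wavelet_continuous mult_right_mono wavelet_abs_le) auto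
  also have "\<dots> = ?r * (LINT x:unit_cube|lborel. \<bar>scaling l m' x\<bar>)" by simp
  also have "\<dots> \<le> ?r * (Q ^ CARD('d) * 2 powr (- (real l * real CARD('d) / 2)))"
    using l m Q_ge_1 by (intro mult_left_mono wavelet_L1) auto
  also have "\<dots> = (Q ^ CARD('d))\<^sup>2"
    using powr_half_cancel[of "real l * real CARD('d)" "(Q ^ CARD('d))\<^sup>2"] by (simp add: power2_eq_square mult_ac)
  finally show ?thesis .
qed

text \<open>Products of two scaling functions have second moment of order
  \<open>2 ^ (l * d)\<close>, which limits \<open>L\<close>. Single ones have bounded second moment
  but height \<open>2 powr (l * d / 2)\<close>, and the last condition on \<open>thr\<close> keeps
  them in the Gaussian range of Bernstein's inequality.\<close>

lemma good_sample_prob: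
  fixes P :: "(real \<times> (real ^ 'd)) measure"
  assumes model: "model P f g U" and U: "0 < U" and n: "2 \<le> n" and L: "J0 \<le> L"
    and L_le: "2 ^ (L * CARD('d)) \<le> real n"
    and e: "0 < \<epsilon>" "\<epsilon> \<le> U" "40 * ((Q ^ CARD('d)) ^ 4 * 2 ^ (L * CARD('d)) * U) * ln (real n) \<le> real n * \<epsilon>\<^sup>2"
    and lam: "0 < thr" "40 * ((Q ^ CARD('d))\<^sup>2 * U * (1 + 2 * U)\<^sup>2) * ln (real n) \<le> real n * thr\<^sup>2"
      "thr * 2 powr (real L * real CARD('d) / 2) \<le> U"
  shows "\<exists>N\<in>sets (sample_law n P). measure (sample_law n P) N \<le> 1 / real n ^ 4 \<and>
    (\<forall>\<omega>\<in>space (sample_law n P) - N. good_sample f g n L \<epsilon> thr \<omega>)"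
proof -
  interpret model P f g U by fact
  interpret S: prob_space "sample_law n P" by (rule prob_space_sample_law) (rule prob_P)
  define F where "F = Q ^ CARD('d)"
  have F: "1 \<le> F" unfolding F_def by (rule Q_power_ge_1)
  \<comment> \<open>The factor \<open>1 + 2 * U\<close> dominates both multipliers that occur, 1 and
    the residual, which is bounded by \<open>2 * U\<close>; so one \<open>v\<close> serves all three
    single averages.\<close>
  define v where "v = F\<^sup>2 * U * (1 + 2 * U)\<^sup>2"
  have v: "0 < v" using F U by (simp add: v_def)
  define r where "r l = 2 powr (real l * real CARD('d) / 2)" for l
  have r2: "(r l)\<^sup>2 = 2 ^ (l * CARD('d))" for l
    by (simp add: r_def power2_eq_square powr_add[symmetric] powr_realpow[symmetric])
  have r_mono: "r l \<le> r L" if "l \<le> L" for l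
    unfolding r_def using that by (intro powr_mono) (auto intro: mult_right_mono)
  have r0: "0 < r l" for l by (simp add: r_def)
  note cont = continuous_intros wavelet_continuous
  let ?dev = "\<lambda>e F. {\<omega>\<in>space (sample_law n P). e \<le> \<bar>empirical n F \<omega> - (\<integral>z. F z \<partial>P)\<bar>}"
  let ?F1 = "\<lambda>l m m' z. indicator unit_cube (snd z) * (scaling l m (snd z) * scaling l m' (snd z)) :: real"
  let ?F2 = "\<lambda>l m z. indicator unit_cube (snd z) * \<bar>scaling l m (snd z)\<bar> :: real"
  let ?F3 = "\<lambda>l m z. indicator unit_cube (snd z) * scaling l m (snd z) :: real"
  let ?F4 = "\<lambda>l m z. (fst z - f (snd z)) * (indicator unit_cube (snd z) * scaling l m (snd z)) :: real"
  have sq_le: "(\<integral>z. (indicator unit_cube (snd z) * (scaling l m (snd z) * scaling l m' (snd z)))\<^sup>2 \<partial>P) \<le> F ^ 4 * 2 ^ (L * CARD('d)) * U"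
    if l: "J0 \<le> l" "l \<le> L" and m: "m \<in> level_indices l" "m' \<in> level_indices l" for l and m m' :: "nat ^ 'd"
  proof -
    have "(\<integral>z. (?F1 l m m' z)\<^sup>2 \<partial>P) = (\<integral>z. indicator unit_cube (snd z) * (scaling l m (snd z) * scaling l m' (snd z))\<^sup>2 \<partial>P)"
      by (intro Bochner_Integration.integral_cong) (auto simp: indicator_def)
    also have "\<dots> \<le> U * (LINT x:unit_cube|lborel. (scaling l m x * scaling l m' x)\<^sup>2)"
      using l m by (intro integral_on_cube_le cont) auto
    also have "(LINT x:unit_cube|lborel. (scaling l m x * scaling l m' x)\<^sup>2)
        \<le> (LINT x:unit_cube|lborel. (F * r l)\<^sup>2 * (\<bar>scaling l m x\<bar> * \<bar>scaling l m' x\<bar>))"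
    proof (intro set_integral_mono unit_cube_integrable cont l m)
      fix x :: "real ^ 'd" assume x: "x \<in> unit_cube"
      have "\<bar>scaling l m x\<bar> * \<bar>scaling l m' x\<bar> \<le> (F * r l) * (F * r l)"
        unfolding F_def r_def using l m x F[unfolded F_def] by (intro mult_mono wavelet_abs_le) auto
      then have "(\<bar>scaling l m x\<bar> * \<bar>scaling l m' x\<bar>) * (\<bar>scaling l m x\<bar> * \<bar>scaling l m' x\<bar>)
          \<le> (F * r l)\<^sup>2 * (\<bar>scaling l m x\<bar> * \<bar>scaling l m' x\<bar>)"
        by (intro mult_right_mono) (auto simp: power2_eq_square)
      then show "(scaling l m x * scaling l m' x)\<^sup>2 \<le> (F * r l)\<^sup>2 * (\<bar>scaling l m x\<bar> * \<bar>scaling l m' x\<bar>)"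
        by (simp add: power2_eq_square abs_mult[symmetric])
    qed
    also have "\<dots> = (F * r l)\<^sup>2 * (LINT x:unit_cube|lborel. \<bar>scaling l m x\<bar> * \<bar>scaling l m' x\<bar>)" by simp
    also have "\<dots> \<le> (F * r l)\<^sup>2 * F\<^sup>2"
      unfolding F_def using l m by (intro mult_left_mono scaling_product_L1) auto
    also have "\<dots> \<le> F ^ 4 * 2 ^ (L * CARD('d))"
    proof -
      have "(r l)\<^sup>2 \<le> (r L)\<^sup>2" using r_mono[OF l(2)] r0[of l] by (intro power_mono) auto
      then have "F ^ 4 * (r l)\<^sup>2 \<le> F ^ 4 * (r L)\<^sup>2" using F by (intro mult_left_mono) auto
      then show ?thesis unfolding r2[of L] by (simp add: power_mult_distrib power4_eq_xxxx power2_eq_square mult_ac)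
    qed
    finally show ?thesis using U by (simp add: mult.commute)
  qed
  have sq_le2: "(\<integral>z. (indicator unit_cube (snd z) * scaling l m (snd z))\<^sup>2 \<partial>P) \<le> F\<^sup>2 * U"
    if l: "J0 \<le> l" and m: "m \<in> level_indices l" for l and m :: "nat ^ 'd"
  proof -
    have "(\<integral>z. (?F3 l m z)\<^sup>2 \<partial>P) = (\<integral>z. indicator unit_cube (snd z) * (\<bar>scaling l m (snd z)\<bar> * \<bar>scaling l m (snd z)\<bar>) \<partial>P)"
      by (intro Bochner_Integration.integral_cong) (auto simp: indicator_def power2_eq_square)
    also have "\<dots> \<le> U * (LINT x:unit_cube|lborel. \<bar>scaling l m x\<bar> * \<bar>scaling l m x\<bar>)"
      using l m by (intro integral_on_cube_le cont) auto
    also have "\<dots> \<le> U * F\<^sup>2"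
      unfolding F_def using l m U by (intro mult_left_mono scaling_product_L1) auto
    finally show ?thesis by (simp add: mult.commute)
  qed
  have vge: "F\<^sup>2 * U \<le> v" "4 * U\<^sup>2 * (F\<^sup>2 * U) \<le> v"
  proof -
    have "F\<^sup>2 * U * 1 \<le> F\<^sup>2 * U * (1 + 2 * U)\<^sup>2"
      using U F by (intro mult_left_mono) (auto simp: power2_eq_square algebra_simps)
    then show "F\<^sup>2 * U \<le> v" by (simp add: v_def)
    have "F\<^sup>2 * U * (4 * U\<^sup>2) \<le> F\<^sup>2 * U * (1 + 2 * U)\<^sup>2"
      using U F by (intro mult_left_mono) (auto simp: power2_eq_square algebra_simps)
    then show "4 * U\<^sup>2 * (F\<^sup>2 * U) \<le> v" by (simp add: v_def mult_ac)
  qed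
  have lamb: "thr * ((1 + 2 * U) * (F * r l)) \<le> v" if "l \<le> L" for l
  proof -
    have "thr * r l \<le> thr * r L" using lam(1) r_mono[OF that] by (intro mult_left_mono) auto
    also have "\<dots> \<le> U" using lam(3) by (simp add: r_def)
    finally have "thr * r l \<le> U" .
    then have "(1 + 2 * U) * F * (thr * r l) \<le> (1 + 2 * U) * F * U"
      using U F by (intro mult_left_mono) auto
    also have "\<dots> \<le> ((1 + 2 * U) * F * U) * (F * (1 + 2 * U))"
    proof -
      have "1 * 1 \<le> F * (1 + 2 * U)" using F U by (intro mult_mono) auto
      then have "((1 + 2 * U) * F * U) * (1 * 1) \<le> ((1 + 2 * U) * F * U) * (F * (1 + 2 * U))"
        using F U by (intro mult_left_mono) auto
      then show ?thesis by simp
    qed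
    finally show ?thesis by (simp add: v_def power2_eq_square mult_ac)
  qed
  have abs3: "\<bar>indicator unit_cube (snd z) * scaling l m (snd z)\<bar> \<le> F * r l"
    if "J0 \<le> l" "m \<in> level_indices l" for l m and z :: "real \<times> (real ^ 'd)"
    using wavelet_abs_le[OF that(1) _ that(2), of "snd z" "\<chi> j. False"] F r0[of l]
    by (auto simp: indicator_def F_def r_def)
  \<comment> \<open>Nothing is known about \<open>f\<close> off the cube, not even measurability, so
    the indicator has to be moved onto \<open>f\<close> first.\<close>
  have F4m: "?F4 l m \<in> borel_measurable P" if "J0 \<le> l" "m \<in> level_indices l" for l and m :: "nat ^ 'd"
  proof -
    have "?F4 l m = (\<lambda>z. fst z * ?F3 l m z - indicator unit_cube (snd z) * (f (snd z) * scaling l m (snd z)))"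
      by (auto simp: fun_eq_iff algebra_simps)
    also have "\<dots> \<in> borel_measurable P"
      using that by (intro borel_measurable_diff borel_measurable_times fst_measurable on_cube_snd_measurable cont f_continuous)
    finally show ?thesis .
  qed
  have B1: "measure (sample_law n P) (?dev \<epsilon> (?F1 l m m')) \<le> 2 / real n ^ 10"
    if l: "J0 \<le> l" "l \<le> L" and m: "m \<in> level_indices l" "m' \<in> level_indices l" for l and m m' :: "nat ^ 'd"
  proof (rule bernstein_n10[OF prob_P, where v = "F ^ 4 * 2 ^ (L * CARD('d)) * U" and b = "F\<^sup>2 * 2 ^ (L * CARD('d))"])
    show "(\<lambda>z. ?F1 l m m' z) \<in> borel_measurable P"
      using l m by (intro on_cube_snd_measurable cont)
    show "AE z in P. \<bar>?F1 l m m' z\<bar> \<le> F\<^sup>2 * 2 ^ (L * CARD('d))"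
    proof (rule AE_I2)
      fix z :: "real \<times> (real ^ 'd)"
      have "\<bar>?F1 l m m' z\<bar> = \<bar>indicator unit_cube (snd z) * scaling l m (snd z)\<bar> * \<bar>indicator unit_cube (snd z) * scaling l m' (snd z)\<bar>"
        by (auto simp: indicator_def abs_mult)
      also have "\<dots> \<le> (F * r L) * (F * r L)"
        using abs3[OF l(1) m(1), of z] abs3[OF l(1) m(2), of z] r_mono[OF l(2)] F less_imp_le[OF r0]
        by (intro mult_mono) (auto intro: order_trans mult_left_mono)
      also have "\<dots> = F\<^sup>2 * (r L)\<^sup>2" by (simp add: power2_eq_square)
      finally show "\<bar>?F1 l m m' z\<bar> \<le> F\<^sup>2 * 2 ^ (L * CARD('d))" by (simp only: r2)
    qed
    have "\<epsilon> * (F\<^sup>2 * 2 ^ (L * CARD('d))) \<le> U * (F\<^sup>2 * 2 ^ (L * CARD('d)))"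
      using e by (intro mult_right_mono) auto
    also have "\<dots> \<le> U * (F ^ 4 * 2 ^ (L * CARD('d)))"
      using U F by (intro mult_left_mono mult_right_mono power_increasing) auto
    finally show "\<epsilon> * (F\<^sup>2 * 2 ^ (L * CARD('d))) \<le> F ^ 4 * 2 ^ (L * CARD('d)) * U" by (simp add: mult_ac)
    show "0 < F ^ 4 * 2 ^ (L * CARD('d)) * U"
      using F U by (intro mult_pos_pos zero_less_power) auto
  qed (use sq_le[OF l m] F U e n in \<open>auto simp: F_def\<close>)
  have B2: "measure (sample_law n P) (?dev thr (?F2 l m)) \<le> 2 / real n ^ 10"
    and B3: "measure (sample_law n P) (?dev thr (?F3 l m)) \<le> 2 / real n ^ 10"
    and B4: "measure (sample_law n P) (?dev thr (?F4 l m)) \<le> 2 / real n ^ 10"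
    if l: "J0 \<le> l" "l \<le> L" and m: "m \<in> level_indices l" for l and m :: "nat ^ 'd"
  proof -
    have b: "F * r l \<le> (1 + 2 * U) * (F * r l)" "2 * U * (F * r l) \<le> (1 + 2 * U) * (F * r l)"
    proof -
      have "0 \<le> F * r l" using F r0[of l] by simp
      then show "F * r l \<le> (1 + 2 * U) * (F * r l)" "2 * U * (F * r l) \<le> (1 + 2 * U) * (F * r l)"
        using U mult_right_mono[of 1 "1 + 2 * U" "F * r l"] by (auto simp: distrib_right)
    qed
    note bn = bernstein_n10[OF prob_P, where v = v and b = "(1 + 2 * U) * (F * r l)" and e = thr]
    have big: "40 * v * ln (real n) \<le> real n * thr\<^sup>2" using lam(2) by (simp add: v_def F_def)
    show "measure (sample_law n P) (?dev thr (?F3 l m)) \<le> 2 / real n ^ 10"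
    proof (rule bn)
      show "AE z in P. \<bar>?F3 l m z\<bar> \<le> (1 + 2 * U) * (F * r l)"
        using abs3[OF l(1) m] b by (intro AE_I2) (meson order_trans)
    qed (use sq_le2[OF l(1) m] vge v lam lamb[OF l(2)] n big l m in \<open>auto intro!: on_cube_snd_measurable cont\<close>)
    show "measure (sample_law n P) (?dev thr (?F2 l m)) \<le> 2 / real n ^ 10"
    proof (rule bn)
      show "AE z in P. \<bar>?F2 l m z\<bar> \<le> (1 + 2 * U) * (F * r l)"
        using abs3[OF l(1) m] b by (intro AE_I2) (simp add: abs_mult, meson order_trans)
      have "(\<integral>z. (?F2 l m z)\<^sup>2 \<partial>P) = (\<integral>z. (?F3 l m z)\<^sup>2 \<partial>P)"
        by (intro Bochner_Integration.integral_cong) (auto simp: power_mult_distrib)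
      then show "(\<integral>z. (?F2 l m z)\<^sup>2 \<partial>P) \<le> v" using sq_le2[OF l(1) m] vge by simp
    qed (use vge v lam lamb[OF l(2)] n big l m in \<open>auto intro!: on_cube_snd_measurable cont\<close>)
    have F4: "AE z in P. \<bar>?F4 l m z\<bar> \<le> 2 * U * \<bar>?F3 l m z\<bar>"
      using W_bounded
    proof eventually_elim
      case (elim z)
      show ?case
      proof (cases "snd z \<in> unit_cube")
        case True
        then have "\<bar>fst z - f (snd z)\<bar> \<le> 2 * U" using elim f_bounded[of "snd z"] by linarith
        then show ?thesis unfolding abs_mult[of "fst z - f (snd z)"] by (intro mult_right_mono) auto
      qed simp
    qed
    have F4b: "AE z in P. \<bar>?F4 l m z\<bar> \<le> (1 + 2 * U) * (F * r l)"
      using F4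
    proof eventually_elim
      case (elim z)
      have "2 * U * \<bar>?F3 l m z\<bar> \<le> 2 * U * (F * r l)" using abs3[OF l(1) m] U by (intro mult_left_mono) auto
      then show ?case using elim b by linarith
    qed
    show "measure (sample_law n P) (?dev thr (?F4 l m)) \<le> 2 / real n ^ 10"
    proof (rule bn[OF F4m[OF l(1) m] F4b])
      have i3: "integrable P (\<lambda>z. (?F3 l m z)\<^sup>2)"
      proof -
        have "integrable P (\<lambda>z. indicator unit_cube (snd z) * (scaling l m (snd z))\<^sup>2)"
          using l m by (intro on_cube_bounded_integrable cont)
        then show ?thesis by (rule Bochner_Integration.integrable_cong[THEN iffD1, rotated -1]) (auto simp: indicator_def)
      qed
      have "(\<integral>z. (?F4 l m z)\<^sup>2 \<partial>P) \<le> (\<integral>z. 4 * U\<^sup>2 * (?F3 l m z)\<^sup>2 \<partial>P)"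
      proof (rule integral_mono_AE)
        show "AE z in P. (?F4 l m z)\<^sup>2 \<le> 4 * U\<^sup>2 * (?F3 l m z)\<^sup>2"
          using F4
        proof eventually_elim
          case (elim z)
          then have "\<bar>?F4 l m z\<bar>\<^sup>2 \<le> (2 * U * \<bar>?F3 l m z\<bar>)\<^sup>2" by (intro power_mono) auto
          then show ?case by (simp add: power_mult_distrib)
        qed
        show "integrable P (\<lambda>z. (?F4 l m z)\<^sup>2)"
        proof (rule integrable_const_bound)
          show "AE z in P. norm ((?F4 l m z)\<^sup>2) \<le> ((1 + 2 * U) * (F * r l))\<^sup>2"
            using F4b
          proof eventually_elim
            case (elim z)
            then have "\<bar>?F4 l m z\<bar>\<^sup>2 \<le> ((1 + 2 * U) * (F * r l))\<^sup>2" by (intro power_mono) auto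
            then show ?case by simp
          qed
        qed (use F4m[OF l(1) m] in measurable)
      qed (use i3 in auto)
      also have "\<dots> = 4 * U\<^sup>2 * (\<integral>z. (?F3 l m z)\<^sup>2 \<partial>P)" by simp
      also have "\<dots> \<le> 4 * U\<^sup>2 * (F\<^sup>2 * U)" using sq_le2[OF l(1) m] by (intro mult_left_mono) auto
      finally show "(\<integral>z. (?F4 l m z)\<^sup>2 \<partial>P) \<le> v" using vge by linarith
    qed (use v lam lamb[OF l(2)] n big in auto)
  qed
  have dev_sets: "?dev e H \<in> sets (sample_law n P)" if [measurable]: "H \<in> borel_measurable P" for e H
    by measurable
  define D where "D l m = ?dev thr (?F2 l m) \<union> ?dev thr (?F3 l m) \<union> ?dev thr (?F4 l m) \<union> (\<Union>m'\<in>level_indices l. ?dev \<epsilon> (?F1 l m m'))"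
    for l and m :: "nat ^ 'd"
  have s1: "?dev \<epsilon> (?F1 l m m') \<in> sets (sample_law n P)" if "J0 \<le> l" "m \<in> level_indices l" "m' \<in> level_indices l" for l m m'
    using that by (intro dev_sets on_cube_snd_measurable cont)
  have s2: "?dev thr (?F2 l m) \<in> sets (sample_law n P)" "?dev thr (?F3 l m) \<in> sets (sample_law n P)" "?dev thr (?F4 l m) \<in> sets (sample_law n P)"
    if "J0 \<le> l" "m \<in> level_indices l" for l m
    using that by (intro dev_sets on_cube_snd_measurable cont F4m; simp)+
  have Ds: "D l m \<in> sets (sample_law n P)" if "J0 \<le> l" "m \<in> level_indices l" for l m
    unfolding D_def by (intro sets.Un sets.finite_UN s1 s2 finite_level_indices that)
  have card_le: "real (card (level_indices l :: (nat ^ 'd) set)) \<le> real n" if "l \<le> L" for l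
  proof -
    have "(2::real) ^ (l * CARD('d)) \<le> 2 ^ (L * CARD('d))" using that by (intro power_increasing) auto
    also note L_le
    finally show ?thesis unfolding card_level_indices of_nat_power of_nat_numeral .
  qed
  have Dm: "measure (sample_law n P) (D l m) \<le> (real n + 3) * (2 / real n ^ 10)" if l: "J0 \<le> l" "l \<le> L" and m: "m \<in> level_indices l" for l m
  proof -
    let ?M = "measure (sample_law n P)"
    have U1: "?M (\<Union>m'\<in>level_indices l. ?dev \<epsilon> (?F1 l m m')) \<le> real n * (2 / real n ^ 10)"
    proof -
      have "?M (\<Union>m'\<in>level_indices l. ?dev \<epsilon> (?F1 l m m')) \<le> (\<Sum>m'\<in>level_indices l. ?M (?dev \<epsilon> (?F1 l m m')))"
        using s1[OF l(1) m] by (intro measure_UNION_le) auto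
      also have "\<dots> \<le> (\<Sum>m'\<in>(level_indices l :: (nat ^ 'd) set). 2 / real n ^ 10)"
        using B1[OF l m] by (intro sum_mono) auto
      also have "\<dots> \<le> real n * (2 / real n ^ 10)"
        unfolding sum_constant by (intro mult_right_mono card_le l) auto
      finally show ?thesis .
    qed
    have UN: "(\<Union>m'\<in>level_indices l. ?dev \<epsilon> (?F1 l m m')) \<in> sets (sample_law n P)"
      using s1[OF l(1) m] by (intro sets.finite_UN) auto
    have "?M (D l m) \<le> ?M (?dev thr (?F2 l m)) + ?M (?dev thr (?F3 l m)) + ?M (?dev thr (?F4 l m)) + ?M (\<Union>m'\<in>level_indices l. ?dev \<epsilon> (?F1 l m m'))"
      unfolding D_def
      by (intro order_trans[OF measure_Un_le] add_right_mono order_refl sets.Un s2[OF l(1) m] UN)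
    also have "\<dots> \<le> 2 / real n ^ 10 + 2 / real n ^ 10 + 2 / real n ^ 10 + real n * (2 / real n ^ 10)"
      by (intro add_mono B2[OF l m] B3[OF l m] B4[OF l m] U1)
    also have "\<dots> = (real n + 3) * (2 / real n ^ 10)"
      unfolding distrib_right by linarith
    finally show ?thesis .
  qed
  define N where "N = (\<Union>l\<in>{J0..L}. \<Union>m\<in>level_indices l. D l m)"
  show ?thesis
  proof (intro bexI[of _ N] conjI ballI)
    show "N \<in> sets (sample_law n P)"
      unfolding N_def using Ds by (intro sets.finite_UN) auto
    have "measure (sample_law n P) N \<le> (\<Sum>l\<in>{J0..L}. measure (sample_law n P) (\<Union>m\<in>level_indices l. D l m))"
      unfolding N_def using Ds by (intro measure_UNION_le sets.finite_UN) auto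
    also have "\<dots> \<le> (\<Sum>l\<in>{J0..L}. real n * ((real n + 3) * (2 / real n ^ 10)))"
    proof (intro sum_mono)
      fix l assume l: "l \<in> {J0..L}"
      have "measure (sample_law n P) (\<Union>m\<in>level_indices l. D l m) \<le> (\<Sum>m\<in>level_indices l. measure (sample_law n P) (D l m))"
        using Ds l by (intro measure_UNION_le) auto
      also have "\<dots> \<le> (\<Sum>m\<in>(level_indices l :: (nat ^ 'd) set). (real n + 3) * (2 / real n ^ 10))"
        using Dm l by (intro sum_mono) auto
      also have "\<dots> \<le> real n * ((real n + 3) * (2 / real n ^ 10))"
        unfolding sum_constant using l by (intro mult_right_mono card_le) auto
      finally show "measure (sample_law n P) (\<Union>m\<in>level_indices l. D l m) \<le> real n * ((real n + 3) * (2 / real n ^ 10))" .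
    qed
    also have "\<dots> \<le> real n * (real n * ((real n + 3) * (2 / real n ^ 10)))"
    proof -
      \<comment> \<open>The number of levels is at most \<open>L\<close>, because \<open>J0\<close>
        is positive, and hence below \<open>2 ^ (L * d) \<le> n\<close>. Levels, indices and pairs
        together give at most \<open>n * n * (n + 3)\<close> events.\<close>
      have "card {J0..L} \<le> L" using J0_pos L by simp
      also have "real L \<le> 2 ^ L" by (metis less_imp_le of_nat_less_two_power)
      also have "(2::real) ^ L \<le> 2 ^ (L * CARD('d))" by (intro power_increasing) auto
      also note L_le
      finally have "real (card {J0..L}) \<le> real n" by simp
      then show ?thesis unfolding sum_constant by (intro mult_right_mono) auto
    qed
    also have "\<dots> \<le> real n * (real n * (real n ^ 4 * (1 / real n ^ 10)))"
    proof -
      have "(real n + 3) * 2 \<le> real n ^ 4"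
      proof -
        have "2 ^ 3 * real n \<le> real n ^ 3 * real n" using n by (intro mult_right_mono power_mono) auto
        moreover have "real n ^ 3 * real n = real n ^ 4" by (simp add: eval_nat_numeral)
        moreover have "(2::real) \<le> real n" using n by simp
        ultimately show ?thesis by simp
      qed
      then have "(real n + 3) * (2 / real n ^ 10) \<le> real n ^ 4 * (1 / real n ^ 10)"
        using n by (simp add: divide_right_mono)
      then show ?thesis by (intro mult_left_mono) auto
    qed
    also have "\<dots> = 1 / real n ^ 4"
      using n by (simp add: field_simps eval_nat_numeral)
    finally show "measure (sample_law n P) N \<le> 1 / real n ^ 4" .
  next
    fix \<omega> assume w: "\<omega> \<in> space (sample_law n P) - N"
    show "good_sample f g n L \<epsilon> thr \<omega>"
      unfolding good_sample_def
    proof (intro ballI conjI)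
      fix l and m :: "nat ^ 'd" assume l: "l \<in> {J0..L}" and m: "m \<in> level_indices l"
      have wD: "\<omega> \<notin> D l m" using w l m by (auto simp: N_def)
      have E: "(\<integral>z. ?F2 l m z \<partial>P) = (LINT x:unit_cube|lborel. g x * \<bar>scaling l m x\<bar>)"
         "(\<integral>z. ?F3 l m z \<partial>P) = (LINT x:unit_cube|lborel. g x * scaling l m x)"
         "(\<integral>z. ?F4 l m z \<partial>P) = 0"
        using l m by (intro integral_on_cube integral_residual cont; simp)+
      show "\<bar>empirical n (?F2 l m) \<omega> - (LINT x:unit_cube|lborel. g x * \<bar>scaling l m x\<bar>)\<bar> \<le> thr"
        "\<bar>empirical n (?F3 l m) \<omega> - (LINT x:unit_cube|lborel. g x * scaling l m x)\<bar> \<le> thr"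
        "\<bar>empirical n (?F4 l m) \<omega>\<bar> \<le> thr"
        using wD w unfolding D_def E[symmetric] by (auto simp: E(3))
      fix m' :: "nat ^ 'd" assume m': "m' \<in> level_indices l"
      have "(\<integral>z. ?F1 l m m' z \<partial>P) = (LINT x:unit_cube|lborel. g x * (scaling l m x * scaling l m' x))"
        using l m m' by (intro integral_on_cube cont; simp)
      then show "\<bar>empirical n (?F1 l m m') \<omega> - (LINT x:unit_cube|lborel. g x * (scaling l m x * scaling l m' x))\<bar> \<le> \<epsilon>"
        using wD w m' unfolding D_def by auto
    qed
  qed
qed

end

subsection \<open>Selection of the smoothest feasible candidate\<close>

text \<open>The selected index is the first feasible one at the greatest \<open>j \<le> J\<close>
  that has any; monotonicity makes it feasible for all smaller \<open>j\<close>. Countability of the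
  candidates gives measurability, so no measurable choice theorem is involved.\<close>

lemma measurable_lexicographic_selection:
  fixes A :: "nat \<Rightarrow> nat \<Rightarrow> 'w \<Rightarrow> bool"
  assumes meas [measurable]: "\<And>j i. Measurable.pred M (A j i)"
    and mono: "\<And>j j' i \<omega>. j \<le> j' \<Longrightarrow> A j' i \<omega> \<Longrightarrow> A j i \<omega>"
  shows "\<exists>idx\<in>measurable M (count_space UNIV). \<forall>\<omega> j. j \<le> J \<longrightarrow> (\<exists>i. A j i \<omega>) \<longrightarrow> A j (idx \<omega> :: nat) \<omega>"
proof -
  \<comment> \<open>Counting \<open>k\<close> upwards in \<open>J - k\<close> runs through the grid
    downwards from \<open>J\<close>, so that a maximum becomes a \<open>LEAST\<close>, which
    preserves measurability.\<close>
  define K where "K \<omega> = (LEAST k. \<exists>i. A (J - k) i \<omega>)" for \<omega>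
  define I where "I j \<omega> = (LEAST i. A j i \<omega>)" for j \<omega>
  have [measurable]: "K \<in> measurable M (count_space UNIV)"
    unfolding K_def[abs_def] by measurable
  have [measurable]: "I j \<in> measurable M (count_space UNIV)" for j
    unfolding I_def[abs_def] by measurable
  have "(\<lambda>\<omega>. I (J - K \<omega>) \<omega>) \<in> measurable M (count_space UNIV)"
    by (rule measurable_compose_countable[where f = "\<lambda>k \<omega>. I (J - k) \<omega>"]) measurable
  moreover have "A j (I (J - K \<omega>) \<omega>) \<omega>" if j: "j \<le> J" and ex: "\<exists>i. A j i \<omega>" for \<omega> j
  proof -
    have j': "J - (J - j) = j" using j by simp
    have 1: "\<exists>i. A (J - (J - j)) i \<omega>" using ex unfolding j' .
    have "K \<omega> \<le> J - j"
      unfolding K_def by (rule Least_le[where P = "\<lambda>k. \<exists>i. A (J - k) i \<omega>", OF 1])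
    then have le: "j \<le> J - K \<omega>" using j by linarith
    have "\<exists>i. A (J - K \<omega>) i \<omega>"
      unfolding K_def by (rule LeastI[where P = "\<lambda>k. \<exists>i. A (J - k) i \<omega>", OF 1])
    then have "A (J - K \<omega>) (I (J - K \<omega>) \<omega>) \<omega>" unfolding I_def by (rule LeastI_ex)
    then show ?thesis by (rule mono[OF le])
  qed
  ultimately show ?thesis by (intro bexI[of _ "\<lambda>\<omega>. I (J - K \<omega>) \<omega>"]) simp_all
qed

lemma n_over_ln_ge_1: "2 \<le> n \<Longrightarrow> 1 \<le> real n / ln (real n)"
  using ln_le_minus_one[of "real n"] by (simp add: field_simps)

text \<open>The test level \<open>l\<close> balancing noise against bias is \<open>log 2 r / (2 s + d)\<close> up to rounding
  and up to the limits \<open>l0\<close> and \<open>L\<close>.\<close>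

lemma ex_balanced_level:
  fixes r s d c0 \<gamma>m :: real
  assumes r: "1 \<le> r" and s: "0 < s" "s \<le> \<gamma>m" and d: "1 \<le> d" and c0: "0 < c0" "c0 \<le> 1"
    and L: "l0 \<le> L" "c0 * r \<le> 2 powr ((real L + 1) * d)"
  shows "\<exists>l\<in>{l0..L}. 2 powr (real l * d / 2) * r powr (- 1 / 2) + 2 powr (- (real l * s))
    \<le> (2 powr (real l0 * d / 2) + 2 powr \<gamma>m * c0 powr (- (\<gamma>m / d))) * r powr (- (s / (2 * s + d)))"
proof -
  define x where "x = log 2 r / (2 * s + d)"
  have x: "0 \<le> x" using r s d by (simp add: x_def)
  \<comment> \<open>At the real level \<open>x\<close> the noise
    \<open>2 powr (x * d / 2) * r powr (- 1 / 2)\<close> and the bias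
    \<open>2 powr (- (x * s))\<close> both equal the target rate.\<close>
  have rx: "r = 2 powr (x * (2 * s + d))" using r s d by (simp add: x_def powr_log_cancel)
  define l where "l = max l0 (min L (nat \<lfloor>x\<rfloor>))"
  have l: "l \<in> {l0..L}" using L by (auto simp: l_def)
  have rho: "r powr (- (s / (2 * s + d))) = 2 powr (- (x * s))"
  proof -
    have "x * D * (- (s / D)) = - (x * s)" if "D \<noteq> 0" for D using that by simp
    from this[of "2 * s + d"] show ?thesis using s d unfolding rx powr_powr by simp
  qed
  have "real l \<le> real l0 + x"
  proof -
    have "l \<le> l0 + nat \<lfloor>x\<rfloor>" by (auto simp: l_def)
    then have "real l \<le> real l0 + real (nat \<lfloor>x\<rfloor>)" by linarith
    moreover have "real (nat \<lfloor>x\<rfloor>) \<le> x" using x by linarith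
    ultimately show ?thesis by linarith
  qed
  then have "2 powr (real l * d / 2) \<le> 2 powr ((real l0 + x) * d / 2)"
    using d by (intro powr_mono divide_right_mono mult_right_mono) auto
  then have "2 powr (real l * d / 2) * r powr (- 1 / 2) \<le> 2 powr ((real l0 + x) * d / 2) * r powr (- 1 / 2)"
    by (intro mult_right_mono) auto
  also have "\<dots> = 2 powr (real l0 * d / 2) * r powr (- (s / (2 * s + d)))"
    unfolding rho unfolding rx powr_powr powr_add[symmetric]
    by (rule arg_cong[where f = "\<lambda>z. 2 powr z"]) (simp add: field_simps)
  finally have 1: "2 powr (real l * d / 2) * r powr (- 1 / 2) \<le> 2 powr (real l0 * d / 2) * r powr (- (s / (2 * s + d)))" .
  have c1: "1 \<le> c0 powr (- (\<gamma>m / d))"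
  proof -
    have "c0 powr 0 \<le> c0 powr (- (\<gamma>m / d))"
      using c0 s d by (intro powr_mono') auto
    then show ?thesis using c0 by simp
  qed
  have g1: "2 powr s \<le> 2 powr \<gamma>m" using s by (intro powr_mono) auto
  have 2: "2 powr (- (real l * s)) \<le> 2 powr \<gamma>m * c0 powr (- (\<gamma>m / d)) * r powr (- (s / (2 * s + d)))"
  proof (cases "nat \<lfloor>x\<rfloor> \<le> L")
    case True
    then have "real (nat \<lfloor>x\<rfloor>) \<le> real l" by (simp add: l_def)
    then have "x - 1 \<le> real l" using x by linarith
    then have "2 powr (- (real l * s)) \<le> 2 powr (- ((x - 1) * s))"
      using s by (intro powr_mono le_imp_neg_le mult_right_mono) auto
    also have "\<dots> = 2 powr s * 1 * 2 powr (- (x * s))"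
      by (simp add: powr_add[symmetric] algebra_simps)
    also have "\<dots> \<le> 2 powr \<gamma>m * c0 powr (- (\<gamma>m / d)) * 2 powr (- (x * s))"
      using g1 c1 by (intro mult_right_mono mult_mono) auto
    finally show ?thesis unfolding rho .
  next
    \<comment> \<open>The ideal level lies beyond \<open>L\<close>. The bias at \<open>L\<close> is
      then of order \<open>r powr (- (s / d))\<close>, which is below the target rate since
      \<open>s / (2 * s + d) \<le> s / d\<close>.\<close>
    case False
    then have "L \<le> l" by (simp add: l_def)
    then have "2 powr (- (real l * s)) \<le> 2 powr (- (real L * s))"
      using s by (intro powr_mono le_imp_neg_le mult_right_mono) auto
    also have "\<dots> = 2 powr s * (2 powr ((real L + 1) * d)) powr (- (s / d))"
      using d unfolding powr_powr powr_add[symmetric] by (simp add: field_simps)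
    also have "\<dots> \<le> 2 powr s * (c0 * r) powr (- (s / d))"
      using L c0 r s d by (intro mult_left_mono powr_mono2') auto
    also have "\<dots> = 2 powr s * c0 powr (- (s / d)) * r powr (- (s / d))"
      using c0 r by (simp add: powr_mult)
    also have "\<dots> \<le> 2 powr \<gamma>m * c0 powr (- (\<gamma>m / d)) * r powr (- (s / (2 * s + d)))"
    proof (intro mult_mono g1)
      show "c0 powr (- (s / d)) \<le> c0 powr (- (\<gamma>m / d))"
        using c0 s d by (intro powr_mono') (auto intro: divide_right_mono)
      have "s / (2 * s + d) \<le> s / d" using s d by (intro divide_left_mono) auto
      then show "r powr (- (s / d)) \<le> r powr (- (s / (2 * s + d)))" using r by (intro powr_mono) auto
    qed auto
    finally show ?thesis .
  qed
  show ?thesis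
    using 1 2 l by (intro bexI[of _ l]) (simp_all add: distrib_right)
qed

text \<open>The parameter \<open>dim\<close> only ties the dimension to the locale.\<close>

locale adaptive = cdv_bounded B Q for B Q +
  fixes dim :: "'d::finite itself" and s0 \<gamma>m M \<tau> aL aU \<epsilon> \<kappa> c0 :: real and l0 :: nat
  assumes s0: "0 < s0" and M: "0 \<le> M" and \<tau>: "0 \<le> \<tau>" and aL: "0 < aL" and aU: "0 \<le> aU"
    and \<epsilon>: "0 \<le> \<epsilon>" "2 * ((Q ^ CARD('d)) ^ 3 + (Q ^ CARD('d)) ^ 2) * \<epsilon> \<le> aL"
    and \<kappa>: "0 < \<kappa>" and c0: "0 < c0" "c0 \<le> 1" and l0: "J0 \<le> l0"
begin

text \<open>\<open>A0\<close> bounds, in units of \<open>2 powr (- (L * grid L j))\<close>, the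
  effect on a test of replacing the truth by its rounded projection: approximation and rounding
  error times the mass \<open>\<tau>\<close>. \<open>M1\<close> is the ball radius after rounding.
  \<open>C1\<close> collects the factors in the bound of \<open>stability\<close> for the difference
  of a candidate and the truth.\<close>

definition A0 :: real where "A0 = \<tau> * (tail_const CARD('d) s0 * M + Q ^ CARD('d))"
definition M1 :: real where "M1 = M + (Q ^ CARD('d))\<^sup>2"
definition C1 :: real where
  "C1 = 2 / aL * (2 * Q ^ CARD('d) + (2 * Q ^ CARD('d) * A0 + tail_const CARD('d) s0 * (M + 2 * M1) * (aL + Q ^ CARD('d) * \<tau> + aU * (Q ^ CARD('d))\<^sup>2)))"

text \<open>For large \<open>n\<close>, the finest level with
  \<open>2 ^ (level n * d) \<le> c0 * n / ln n\<close>: up to it the Gram entries can be estimated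
  within \<open>\<epsilon>\<close>, once \<open>c0\<close> is small in terms of
  \<open>\<epsilon>\<close>.\<close>

definition level :: "nat \<Rightarrow> nat" where
  "level n = nat \<lfloor>log 2 (c0 * (real n / ln (real n))) / real CARD('d)\<rfloor>"

definition large :: "nat \<Rightarrow> bool" where
  "large n \<longleftrightarrow> 2 powr (real l0 * real CARD('d)) \<le> c0 * (real n / ln (real n))"

definition threshold :: "nat \<Rightarrow> real" where
  "threshold n = \<kappa> * (real n / ln (real n)) powr (- 1 / 2)"

text \<open>Summed against the scaling functions of level \<open>L\<close>, whose height is
  \<open>2 powr (L * d / 2)\<close>, a rounding error of this size stays bounded even under the
  largest weight \<open>2 powr (L * (\<gamma>m + d / 2))\<close> of a ball of smoothness up to
  \<open>\<gamma>m\<close>.\<close>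

definition mesh :: "nat \<Rightarrow> real" where
  "mesh L = 2 powr (- (real L * (\<gamma>m + real CARD('d))))"

text \<open>Rounding the coefficients at level \<open>L\<close> to a mesh makes the set of candidates countable.\<close>

definition candidates :: "nat \<Rightarrow> (real ^ 'd \<Rightarrow> real) set" where
  "candidates L = (\<lambda>c x. \<Sum>m\<in>level_indices L. (mesh L * of_int (c m)) * scaling L m x) `
     (Pi\<^sub>E (level_indices L) (\<lambda>_. UNIV :: int set))"

text \<open>The spacing \<open>1 / L\<close> makes \<open>2 powr (l * s)\<close> vary by at most a
  factor 2 within a cell for every \<open>l \<le> L\<close>.\<close>

definition grid :: "nat \<Rightarrow> nat \<Rightarrow> real" where
  "grid L j = s0 + real j / real L"

text \<open>The tolerance is the noise level plus the bias of the rounded projection of a truth of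
  smoothness at least \<open>grid L j\<close>. Ball and tolerance both shrink as \<open>j\<close>
  grows, which orders the feasible sets.\<close>

definition feasible :: "nat \<Rightarrow> real \<Rightarrow> (nat \<Rightarrow> nat ^ 'd \<Rightarrow> real) \<Rightarrow> ((real ^ 'd \<Rightarrow> real) \<Rightarrow> real) \<Rightarrow> nat \<Rightarrow> (real ^ 'd \<Rightarrow> real) \<Rightarrow> bool" where
  "feasible L thr y T j h \<longleftrightarrow> coef_ball (grid L j) M1 h \<and> (\<forall>l\<in>{l0..L}. \<forall>m\<in>level_indices l.
     \<bar>y l m - T (\<lambda>x. h x * scaling l m x)\<bar> \<le> thr + A0 * 2 powr (- (real L * grid L j)) * 2 powr (- (real l * real CARD('d) / 2)))"

text \<open>For the regression function \<open>T\<close> is the empirical mean and \<open>a\<close> the density; for the density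
  \<open>T\<close> is the Lebesgue integral and \<open>a = 1\<close>.\<close>

definition suitable :: "nat \<Rightarrow> real \<Rightarrow> (nat \<Rightarrow> nat ^ 'd \<Rightarrow> real) \<Rightarrow> ((real ^ 'd \<Rightarrow> real) \<Rightarrow> real) \<Rightarrow> (real ^ 'd \<Rightarrow> real) \<Rightarrow> (real ^ 'd \<Rightarrow> real) \<Rightarrow> bool" where
  "suitable L thr y T a t \<longleftrightarrow> positive_functional T \<and> continuous_on unit_cube a \<and>
     (\<forall>x\<in>unit_cube. aL \<le> a x \<and> a x \<le> aU) \<and>
     (\<forall>l\<ge>l0. \<forall>x\<in>unit_cube. \<forall>y\<in>unit_cube. (\<forall>j. \<bar>x $ j - y $ j\<bar> \<le> Q / 2 ^ l) \<longrightarrow> \<bar>a x - a y\<bar> \<le> \<epsilon>) \<and>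
     (\<forall>l\<in>{l0..L}. \<forall>m\<in>level_indices l.
        (\<forall>m'\<in>level_indices l. \<bar>T (\<lambda>x. scaling l m x * scaling l m' x) - (LINT x:unit_cube|lborel. a x * (scaling l m x * scaling l m' x))\<bar> \<le> \<epsilon>) \<and>
        T (\<lambda>x. \<bar>scaling l m x\<bar>) \<le> \<tau> * 2 powr (- (real l * real CARD('d) / 2)) \<and>
        \<bar>y l m - T (\<lambda>x. t x * scaling l m x)\<bar> \<le> thr)"

lemma F_ge_1: "1 \<le> Q ^ CARD('d)" by (rule Q_power_ge_1)

lemma tailc_pos: "0 < tail_const CARD('d) s0" by (rule tail_const_pos[OF s0])

lemma A0_nonneg: "0 \<le> A0"
  unfolding A0_def using \<tau> M tailc_pos F_ge_1 by (intro mult_nonneg_nonneg add_nonneg_nonneg) auto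

lemma M1_ge: "M \<le> M1" "0 \<le> M1" using M by (auto simp: M1_def)

lemma C1_nonneg: "0 \<le> C1"
  unfolding C1_def using aL aU \<tau> M M1_ge tailc_pos F_ge_1 A0_nonneg
  by (intro mult_nonneg_nonneg add_nonneg_nonneg divide_nonneg_nonneg) auto

lemma countable_candidates: "countable (candidates L)"
  unfolding candidates_def by (intro countable_image countable_PiE) auto

lemma candidates_nonempty: "candidates L \<noteq> {}"
  by (auto simp: candidates_def PiE_eq_empty_iff)

lemma candidate_continuous: "J0 \<le> L \<Longrightarrow> h \<in> candidates L \<Longrightarrow> continuous_on unit_cube h"
  unfolding candidates_def by (auto intro!: continuous_intros wavelet_continuous)

lemma candidate_coef_eq_0:
  assumes "h \<in> candidates L" "J0 \<le> L" "L \<le> l" "m \<in> level_indices l" "v \<noteq> (\<chi> j. False)"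
  shows "l2_inner unit_cube h (wavelet B v l m) = 0"
  using assms unfolding candidates_def by (auto intro!: l2_inner_scaling_sum_wavelet_eq_0)

lemma feasible_mono:
  assumes "j \<le> j'" "feasible L thr y T j' h"
  shows "feasible L thr y T j h"
proof -
  have g: "grid L j \<le> grid L j'" using assms(1) by (simp add: grid_def divide_right_mono)
  have "thr + A0 * 2 powr (- (real L * grid L j')) * 2 powr (- (real l * real CARD('d) / 2))
      \<le> thr + A0 * 2 powr (- (real L * grid L j)) * 2 powr (- (real l * real CARD('d) / 2))" for l
    using A0_nonneg g by (intro add_left_mono mult_right_mono mult_left_mono powr_mono le_imp_neg_le) auto
  then show ?thesis
    using assms(2) g unfolding feasible_def by (meson coef_ball_mono order_refl order_trans)
qed

text \<open>The witness is the projection of the truth to level \<open>L\<close> with coefficients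
  rounded down to the mesh. Below \<open>L\<close> its wavelet coefficients are those of the truth
  up to the rounding error, and from \<open>L\<close> on they vanish.\<close>

lemma ex_feasible_candidate:
  assumes L: "l0 \<le> L" and t: "coef_ball s M t" and s: "s0 \<le> s" "s \<le> \<gamma>m" and j: "grid L j \<le> s"
    and suit: "suitable L thr y T a t"
  shows "\<exists>h\<in>candidates L. feasible L thr y T j h"
proof -
  have JL: "J0 \<le> L" using L l0 by simp
  have tc: "continuous_on unit_cube t" using t by (rule coef_ball_continuous)
  define \<theta> where "\<theta> m = l2_inner unit_cube t (scaling L m)" for m
  define c where "c = restrict (\<lambda>m. \<lfloor>\<theta> m / mesh L\<rfloor>) (level_indices L)"
  define h where "h = (\<lambda>x. \<Sum>m\<in>level_indices L. (mesh L * of_int (c m)) * scaling L m x)"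
  have h: "h \<in> candidates L"
    unfolding candidates_def h_def by (rule image_eqI[of _ _ c]) (auto simp: c_def)
  have hc: "continuous_on unit_cube h" by (rule candidate_continuous[OF JL h])
  have mesh: "0 < mesh L" by (simp add: mesh_def)
  define e where "e x = proj L t x - h x" for x
  have ec: "continuous_on unit_cube e"
    unfolding e_def[abs_def] using JL by (intro continuous_intros proj_continuous hc)
  \<comment> \<open>\<open>mesh L\<close> times the height and overlap of the scaling functions. The
    weight of smoothness \<open>\<gamma>m\<close> at level \<open>L\<close> cancels the power of 2,
    and one more factor \<open>Q ^ CARD('d)\<close> gives the square added in
    \<open>M1\<close>.\<close>
  define b where "b = Q ^ CARD('d) * 2 powr (- (real L * (\<gamma>m + real CARD('d) / 2)))"
  have b: "0 \<le> b" using F_ge_1 by (simp add: b_def)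
  have e: "\<bar>e x\<bar> \<le> b" if x: "x \<in> unit_cube" for x
  proof -
    have "e x = (\<Sum>m\<in>level_indices L. (\<theta> m - mesh L * of_int (c m)) * scaling L m x)"
      by (simp add: e_def proj_def h_def \<theta>_def sum_subtractf left_diff_distrib)
    also have "\<bar>\<dots>\<bar> \<le> (\<Sum>m\<in>level_indices L. mesh L * \<bar>scaling L m x\<bar>)"
    proof (intro order_trans[OF sum_abs] sum_mono)
      fix m :: "nat ^ 'd" assume m: "m \<in> level_indices L"
      have "of_int (c m) \<le> \<theta> m / mesh L" "\<theta> m / mesh L \<le> of_int (c m) + 1"
        using m by (auto simp: c_def intro: less_imp_le)
      then have "mesh L * of_int (c m) \<le> \<theta> m" "\<theta> m \<le> mesh L * of_int (c m) + mesh L"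
        using mesh by (auto simp: field_simps)
      then have "\<bar>\<theta> m - mesh L * of_int (c m)\<bar> \<le> mesh L" by linarith
      then show "\<bar>(\<theta> m - mesh L * of_int (c m)) * scaling L m x\<bar> \<le> mesh L * \<bar>scaling L m x\<bar>"
        unfolding abs_mult by (intro mult_right_mono) auto
    qed
    also have "\<dots> = mesh L * (\<Sum>m\<in>level_indices L. \<bar>scaling L m x\<bar>)" by (simp add: sum_distrib_left)
    also have "\<dots> \<le> mesh L * (Q ^ CARD('d) * 2 powr (real L * real CARD('d) / 2))"
      using mesh by (intro mult_left_mono wavelet_abs_sum JL x) auto
    also have "\<dots> = b"
    proof -
      have "mesh L * 2 powr (real L * real CARD('d) / 2) = 2 powr (- (real L * (\<gamma>m + real CARD('d) / 2)))"
        unfolding mesh_def powr_add[symmetric] by (simp add: algebra_simps)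
      then show ?thesis by (simp add: b_def mult.left_commute)
    qed
    finally show ?thesis .
  qed
  have sj: "grid L j \<le> \<gamma>m" using j s by simp
  have coef: "2 powr (real l * (grid L j + real CARD('d) / 2)) * \<bar>l2_inner unit_cube h (wavelet B v l m)\<bar> \<le> M1"
    if l: "J0 \<le> l" and m: "m \<in> level_indices l" and lv: "l < L \<or> l \<le> L \<and> v = (\<chi> j. False)"
      and tM: "2 powr (real l * (s + real CARD('d) / 2)) * \<bar>l2_inner unit_cube t (wavelet B v l m)\<bar> \<le> M" for l m v
  proof -
    have "l2_inner unit_cube h (wavelet B v l m) = l2_inner unit_cube (\<lambda>x. proj L t x - e x) (wavelet B v l m)"
      by (simp add: e_def)
    also have "\<dots> = l2_inner unit_cube t (wavelet B v l m) - l2_inner unit_cube e (wavelet B v l m)"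
      using l m lv by (subst l2_inner_diff_left) (auto intro!: proj_continuous JL ec wavelet_continuous simp: l2_inner_proj_wavelet tc)
    finally have eq: "l2_inner unit_cube h (wavelet B v l m) = l2_inner unit_cube t (wavelet B v l m) - l2_inner unit_cube e (wavelet B v l m)" .
    have "\<bar>l2_inner unit_cube e (wavelet B v l m)\<bar> \<le> b * (Q ^ CARD('d) * 2 powr (- (real l * real CARD('d) / 2)))"
      using l m e by (intro l2_inner_wavelet_le ec)
    also have "\<dots> \<le> b * (Q ^ CARD('d) * 1)"
      using b F_ge_1 powr_mono[of "- (real l * real CARD('d) / 2)" 0 2] by (intro mult_left_mono) auto
    finally have ee: "\<bar>l2_inner unit_cube e (wavelet B v l m)\<bar> \<le> b * Q ^ CARD('d)" by simp
    have "2 powr (real l * (grid L j + real CARD('d) / 2)) * \<bar>l2_inner unit_cube h (wavelet B v l m)\<bar>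
        \<le> 2 powr (real l * (grid L j + real CARD('d) / 2)) * \<bar>l2_inner unit_cube t (wavelet B v l m)\<bar>
        + 2 powr (real l * (grid L j + real CARD('d) / 2)) * \<bar>l2_inner unit_cube e (wavelet B v l m)\<bar>"
      unfolding distrib_left[symmetric] eq by (intro mult_left_mono) auto
    also have "\<dots> \<le> 2 powr (real l * (s + real CARD('d) / 2)) * \<bar>l2_inner unit_cube t (wavelet B v l m)\<bar>
        + 2 powr (real L * (\<gamma>m + real CARD('d) / 2)) * (b * Q ^ CARD('d))"
    proof (intro add_mono mult_right_mono mult_mono ee)
      show "2 powr (real l * (grid L j + real CARD('d) / 2)) \<le> 2 powr (real l * (s + real CARD('d) / 2))"
        using j by (intro powr_mono mult_left_mono) auto
      have "0 \<le> grid L j" using s0 by (simp add: grid_def)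
      then show "2 powr (real l * (grid L j + real CARD('d) / 2)) \<le> 2 powr (real L * (\<gamma>m + real CARD('d) / 2))"
        using sj lv by (intro powr_mono mult_mono) auto
    qed auto
    also have "2 powr (real L * (\<gamma>m + real CARD('d) / 2)) * (b * Q ^ CARD('d)) = (Q ^ CARD('d))\<^sup>2"
      by (simp add: b_def power2_eq_square powr_minus)
    finally show ?thesis using tM by (simp add: M1_def)
  qed
  have ball: "coef_ball (grid L j) M1 h"
    unfolding coef_ball_def
  proof (intro conjI hc ballI allI impI)
    fix m :: "nat ^ 'd" assume m: "m \<in> level_indices J0"
    show "2 powr (real J0 * (grid L j + real CARD('d) / 2)) * \<bar>l2_inner unit_cube h (scaling J0 m)\<bar> \<le> M1"
      using t m JL by (intro coef) (auto simp: coef_ball_def)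
  next
    fix l and m :: "nat ^ 'd" and v :: "bool ^ 'd"
    assume l: "J0 \<le> l" and m: "m \<in> level_indices l" and v: "v \<noteq> (\<chi> j. False)"
    show "2 powr (real l * (grid L j + real CARD('d) / 2)) * \<bar>l2_inner unit_cube h (wavelet B v l m)\<bar> \<le> M1"
    proof (cases "l < L")
      case True
      then show ?thesis using t l m v by (intro coef) (auto simp: coef_ball_def)
    next
      case False
      then show ?thesis using candidate_coef_eq_0[OF h JL _ m v] M1_ge by simp
    qed
  qed
  have err: "\<bar>t x - h x\<bar> \<le> (tail_const CARD('d) s0 * M + Q ^ CARD('d)) * 2 powr (- (real L * grid L j))" if x: "x \<in> unit_cube" for x
  proof -
    have "\<bar>t x - proj L t x\<bar> \<le> tail_const CARD('d) s0 * M * 2 powr (- (real L * s))"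
      using proj_error[OF t s0 s(1) JL x] by simp
    also have "\<dots> \<le> tail_const CARD('d) s0 * M * 2 powr (- (real L * grid L j))"
      using tailc_pos M j by (intro mult_left_mono powr_mono) (auto intro: mult_left_mono)
    finally have 1: "\<bar>t x - proj L t x\<bar> \<le> tail_const CARD('d) s0 * M * 2 powr (- (real L * grid L j))" .
    have "b \<le> Q ^ CARD('d) * 2 powr (- (real L * grid L j))"
      unfolding b_def using F_ge_1 sj by (intro mult_left_mono powr_mono) (auto intro!: mult_left_mono)
    then have 2: "\<bar>e x\<bar> \<le> Q ^ CARD('d) * 2 powr (- (real L * grid L j))" using e[OF x] by linarith
    have "t x - h x = (t x - proj L t x) + e x" by (simp add: e_def)
    then have "\<bar>t x - h x\<bar> \<le> \<bar>t x - proj L t x\<bar> + \<bar>e x\<bar>" by linarith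
    then show ?thesis using 1 2 by (simp add: distrib_right)
  qed
  have "feasible L thr y T j h"
    unfolding feasible_def
  proof (intro conjI ball ballI)
    fix l and m :: "nat ^ 'd" assume l: "l \<in> {l0..L}" and m: "m \<in> level_indices l"
    have T: "positive_functional T" and T2: "T (\<lambda>x. \<bar>scaling l m x\<bar>) \<le> \<tau> * 2 powr (- (real l * real CARD('d) / 2))"
      and T3: "\<bar>y l m - T (\<lambda>x. t x * scaling l m x)\<bar> \<le> thr"
      using suit l m by (auto simp: suitable_def)
    have Jl: "J0 \<le> l" using l l0 by simp
    let ?k = "(tail_const CARD('d) s0 * M + Q ^ CARD('d)) * 2 powr (- (real L * grid L j))"
    have k: "0 \<le> ?k" using tailc_pos M F_ge_1 by simp
    have "T (\<lambda>x. t x * scaling l m x) - T (\<lambda>x. h x * scaling l m x) = T (\<lambda>x. t x * scaling l m x - h x * scaling l m x)"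
      by (rule pf_diff[OF T, symmetric]) (intro continuous_intros tc hc wavelet_continuous Jl m)+
    also have "\<bar>\<dots>\<bar> \<le> T (\<lambda>x. ?k * \<bar>scaling l m x\<bar>)"
    proof (rule pf_abs_le[OF T])
      fix x :: "real ^ 'd" assume "x \<in> unit_cube"
      then show "\<bar>t x * scaling l m x - h x * scaling l m x\<bar> \<le> ?k * \<bar>scaling l m x\<bar>"
        unfolding left_diff_distrib[symmetric] abs_mult by (intro mult_right_mono err) auto
    qed (intro continuous_intros tc hc wavelet_continuous Jl m)+
    also have "\<dots> = ?k * T (\<lambda>x. \<bar>scaling l m x\<bar>)"
      by (intro pf_scale[OF T] continuous_intros wavelet_continuous Jl m)
    also have "\<dots> \<le> ?k * (\<tau> * 2 powr (- (real l * real CARD('d) / 2)))"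
      using T2 k by (rule mult_left_mono)
    also have "\<dots> = A0 * 2 powr (- (real L * grid L j)) * 2 powr (- (real l * real CARD('d) / 2))"
      by (simp add: A0_def mult_ac)
    finally show "\<bar>y l m - T (\<lambda>x. h x * scaling l m x)\<bar>
        \<le> thr + A0 * 2 powr (- (real L * grid L j)) * 2 powr (- (real l * real CARD('d) / 2))"
      using T3 by linarith
  qed
  then show ?thesis using h by blast
qed

text \<open>Candidate and truth both match the data, so their difference has small tests, and both
  are smooth, so it is close to its projection; \<open>stability\<close> applies to the difference
  at any level between \<open>l0\<close> and \<open>L\<close>.\<close>

lemma feasible_imp_close:
  assumes L: "l0 \<le> L" and t: "coef_ball s M t" and s: "s0 \<le> s" and j: "grid L j \<le> s" "s \<le> grid L (Suc j)"
    and suit: "suitable L thr y T a t" and h: "h \<in> candidates L" "feasible L thr y T j h" and thr: "0 \<le> thr"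
  shows "coef_ball s (2 * M1) h"
    and "\<And>l x. l \<in> {l0..L} \<Longrightarrow> x \<in> unit_cube \<Longrightarrow>
      \<bar>h x - t x\<bar> \<le> C1 * (2 powr (real l * real CARD('d) / 2) * thr + 2 powr (- (real l * s)))"
proof -
  have JL: "J0 \<le> L" and L0: "0 < L" using L l0 J0_pos by auto
  have tc: "continuous_on unit_cube t" using t by (rule coef_ball_continuous)
  have hb: "coef_ball (grid L j) M1 h" using h by (simp add: feasible_def)
  have hc: "continuous_on unit_cube h" using hb by (rule coef_ball_continuous)
  \<comment> \<open>From the mesh \<open>1 / L\<close>: passing from \<open>grid L j\<close> to the
    true \<open>s\<close> costs at most a factor 2 at any level up to \<open>L\<close>.\<close>
  have gap: "real l * (s - grid L j) \<le> 1" if "l \<le> L" for l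
  proof -
    have "s - grid L j \<le> 1 / real L" using j by (simp add: grid_def add_divide_distrib)
    then have "real l * (s - grid L j) \<le> real L * (1 / real L)"
      using that j by (intro mult_mono) auto
    then show ?thesis using L0 by simp
  qed
  have coef: "2 powr (real l * (s + real CARD('d) / 2)) * \<bar>z\<bar> \<le> 2 * M1"
    if "l \<le> L" "2 powr (real l * (grid L j + real CARD('d) / 2)) * \<bar>z\<bar> \<le> M1" for l z
  proof -
    have "2 powr (real l * (s + real CARD('d) / 2)) = 2 powr (real l * (s - grid L j)) * 2 powr (real l * (grid L j + real CARD('d) / 2))"
      by (simp add: powr_add[symmetric] algebra_simps)
    moreover have "2 powr (real l * (s - grid L j)) \<le> 2 powr 1" using gap[OF that(1)] by (intro powr_mono) auto
    ultimately have "2 powr (real l * (s + real CARD('d) / 2)) * \<bar>z\<bar> \<le> 2 powr 1 * (2 powr (real l * (grid L j + real CARD('d) / 2)) * \<bar>z\<bar>)"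
      unfolding mult.assoc[symmetric] by (intro mult_right_mono) auto
    then show ?thesis using that(2) by simp
  qed
  show hs: "coef_ball s (2 * M1) h"
    unfolding coef_ball_def
  proof (intro conjI hc ballI allI impI)
    fix m :: "nat ^ 'd" assume m: "m \<in> level_indices J0"
    show "2 powr (real J0 * (s + real CARD('d) / 2)) * \<bar>l2_inner unit_cube h (scaling J0 m)\<bar> \<le> 2 * M1"
      using hb m JL by (intro coef) (auto simp: coef_ball_def)
  next
    fix l and m :: "nat ^ 'd" and v :: "bool ^ 'd"
    assume l: "J0 \<le> l" and m: "m \<in> level_indices l" and v: "v \<noteq> (\<chi> j. False)"
    show "2 powr (real l * (s + real CARD('d) / 2)) * \<bar>l2_inner unit_cube h (wavelet B v l m)\<bar> \<le> 2 * M1"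
    proof (cases "l < L")
      case True
      then show ?thesis using hb l m v by (intro coef) (auto simp: coef_ball_def)
    next
      case False
      then show ?thesis using candidate_coef_eq_0[OF h(1) JL _ m v] M1_ge by simp
    qed
  qed
  fix l and x :: "real ^ 'd" assume l: "l \<in> {l0..L}" and x: "x \<in> unit_cube"
  have Jl: "J0 \<le> l" using l l0 by simp
  have T: "positive_functional T" and a: "continuous_on unit_cube a"
      "\<And>x. x \<in> unit_cube \<Longrightarrow> aL \<le> a x" "\<And>x. x \<in> unit_cube \<Longrightarrow> a x \<le> aU"
    and osc: "\<And>x y. x \<in> unit_cube \<Longrightarrow> y \<in> unit_cube \<Longrightarrow> (\<And>j. \<bar>x $ j - y $ j\<bar> \<le> Q / 2 ^ l) \<Longrightarrow> \<bar>a x - a y\<bar> \<le> \<epsilon>"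
    and T1: "\<And>m m'. m \<in> level_indices l \<Longrightarrow> m' \<in> level_indices l \<Longrightarrow>
      \<bar>T (\<lambda>x. scaling l m x * scaling l m' x) - (LINT x:unit_cube|lborel. a x * (scaling l m x * scaling l m' x))\<bar> \<le> \<epsilon>"
    and T2: "\<And>m. m \<in> level_indices l \<Longrightarrow> T (\<lambda>x. \<bar>scaling l m x\<bar>) \<le> \<tau> * 2 powr (- (real l * real CARD('d) / 2))"
    and T3: "\<And>m. m \<in> level_indices l \<Longrightarrow> \<bar>y l m - T (\<lambda>x. t x * scaling l m x)\<bar> \<le> thr"
    using suit l by (auto simp: suitable_def)
  define p where "p = 2 powr (- (real l * s))"
  define q where "q = 2 powr (real l * real CARD('d) / 2) * thr"
  have p: "0 \<le> p" and q: "0 \<le> q" using thr by (auto simp: p_def q_def)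
  define \<eta> where "\<eta> = 2 * q + 2 * A0 * p"
  have disc: "\<bar>T (\<lambda>x. (h x - t x) * scaling l m x)\<bar> \<le> \<eta> * 2 powr (- (real l * real CARD('d) / 2))"
    if m: "m \<in> level_indices l" for m
  proof -
    have "T (\<lambda>x. (h x - t x) * scaling l m x) = T (\<lambda>x. h x * scaling l m x) - T (\<lambda>x. t x * scaling l m x)"
      unfolding left_diff_distrib
      by (rule pf_diff[OF T]) (intro continuous_intros tc hc wavelet_continuous Jl m)+
    moreover have "\<bar>y l m - T (\<lambda>x. h x * scaling l m x)\<bar> \<le> thr + A0 * 2 powr (- (real L * grid L j)) * 2 powr (- (real l * real CARD('d) / 2))"
      using h(2) l m by (simp add: feasible_def)
    ultimately have "\<bar>T (\<lambda>x. (h x - t x) * scaling l m x)\<bar> \<le> 2 * thr + A0 * 2 powr (- (real L * grid L j)) * 2 powr (- (real l * real CARD('d) / 2))"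
      using T3[OF m] by linarith
    \<comment> \<open>The bias allowance refers to level \<open>L\<close> and smoothness
      \<open>grid L j\<close>. Going to \<open>s\<close> costs the factor 2, and going to the
      coarser level \<open>l\<close> only enlarges the power.\<close>
    also have "\<dots> \<le> 2 * thr + A0 * (2 * p) * 2 powr (- (real l * real CARD('d) / 2))"
    proof (intro add_left_mono mult_right_mono mult_left_mono A0_nonneg)
      have "2 powr (- (real L * grid L j)) = 2 powr (real L * (s - grid L j)) * 2 powr (- (real L * s))"
        by (simp add: powr_add[symmetric] algebra_simps)
      also have "\<dots> \<le> 2 powr 1 * p"
        unfolding p_def using gap[of L] l s s0
        by (intro mult_mono powr_mono) (auto intro: mult_right_mono)
      finally show "2 powr (- (real L * grid L j)) \<le> 2 * p" by simp
    qed auto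
    also have "\<dots> = \<eta> * 2 powr (- (real l * real CARD('d) / 2))"
      by (simp add: \<eta>_def q_def distrib_right powr_minus field_simps)
    finally show ?thesis .
  qed
  have rho: "\<bar>(h z - t z) - proj l (\<lambda>x. h x - t x) z\<bar> \<le> tail_const CARD('d) s0 * (M + 2 * M1) * p" if z: "z \<in> unit_cube" for z
  proof -
    have "\<bar>h z - proj l h z\<bar> \<le> tail_const CARD('d) s0 * (2 * M1) * p" "\<bar>t z - proj l t z\<bar> \<le> tail_const CARD('d) s0 * M * p"
      using proj_error[OF hs s0 s Jl z] proj_error[OF t s0 s Jl z] by (simp_all add: p_def)
    moreover have "proj l (\<lambda>x. h x - t x) z = proj l h z - proj l t z"
      using Jl hc tc by (rule proj_diff)
    moreover have "tail_const CARD('d) s0 * (M + 2 * M1) * p = tail_const CARD('d) s0 * (2 * M1) * p + tail_const CARD('d) s0 * M * p"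
      by (simp add: algebra_simps)
    ultimately show ?thesis by linarith
  qed
  have "\<bar>h x - t x\<bar> \<le> 2 / aL * (Q ^ CARD('d) * \<eta> + tail_const CARD('d) s0 * (M + 2 * M1) * p * (aL + Q ^ CARD('d) * \<tau> + aU * (Q ^ CARD('d))\<^sup>2))"
    using stability[OF Jl T continuous_on_diff[OF hc tc] a(1) aL a(2,3) \<epsilon> osc T1 T2 disc rho x] .
  also have "\<dots> = 2 / aL * (2 * Q ^ CARD('d) * q + (2 * Q ^ CARD('d) * A0 + tail_const CARD('d) s0 * (M + 2 * M1) * (aL + Q ^ CARD('d) * \<tau> + aU * (Q ^ CARD('d))\<^sup>2)) * p)"
    by (simp add: \<eta>_def algebra_simps)
  also have "\<dots> \<le> 2 / aL * ((2 * Q ^ CARD('d) + (2 * Q ^ CARD('d) * A0 + tail_const CARD('d) s0 * (M + 2 * M1) * (aL + Q ^ CARD('d) * \<tau> + aU * (Q ^ CARD('d))\<^sup>2))) * (q + p))"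
  proof (intro mult_left_mono)
    let ?A = "2 * Q ^ CARD('d)" and ?B = "2 * Q ^ CARD('d) * A0 + tail_const CARD('d) s0 * (M + 2 * M1) * (aL + Q ^ CARD('d) * \<tau> + aU * (Q ^ CARD('d))\<^sup>2)"
    have "0 \<le> ?A" "0 \<le> ?B" using F_ge_1 A0_nonneg tailc_pos M M1_ge aL aU \<tau>
      by (auto intro!: mult_nonneg_nonneg add_nonneg_nonneg)
    moreover have "u * q + v * p \<le> (u + v) * (q + p)" if "0 \<le> u" "0 \<le> v" for u v
      using mult_nonneg_nonneg[OF that(1) p] mult_nonneg_nonneg[OF that(2) q]
      unfolding distrib_left distrib_right by linarith
    ultimately show "?A * q + ?B * p \<le> (?A + ?B) * (q + p)" by blast
  qed (use aL in auto)
  finally show "\<bar>h x - t x\<bar> \<le> C1 * (2 powr (real l * real CARD('d) / 2) * thr + 2 powr (- (real l * s)))"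
    by (simp only: C1_def p_def q_def mult.assoc)
qed

text \<open>The fallback estimator is constant: its proper wavelet coefficients vanish and only the
  coarse level counts, so one radius serves all \<open>s \<le> \<gamma>m\<close>.\<close>

lemma coef_ball_const:
  assumes "s \<le> \<gamma>m"
  shows "coef_ball s (\<bar>c\<bar> * Q ^ CARD('d) * 2 powr (real J0 * (\<gamma>m + real CARD('d) / 2))) (\<lambda>x :: real ^ 'd. c)"
  unfolding coef_ball_def
proof (intro conjI continuous_intros ballI allI impI)
  fix m :: "nat ^ 'd" assume m: "m \<in> level_indices J0"
  have "\<bar>l2_inner unit_cube (\<lambda>x. c) (scaling J0 m)\<bar> \<le> \<bar>c\<bar> * (Q ^ CARD('d) * 2 powr (- (real J0 * real CARD('d) / 2)))"
    by (intro l2_inner_wavelet_le m continuous_intros) auto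
  also have "\<dots> \<le> \<bar>c\<bar> * (Q ^ CARD('d) * 1)"
    using F_ge_1 powr_mono[of "- (real J0 * real CARD('d) / 2)" 0 2] by (intro mult_left_mono) auto
  finally have "2 powr (real J0 * (s + real CARD('d) / 2)) * \<bar>l2_inner unit_cube (\<lambda>x. c) (scaling J0 m)\<bar>
      \<le> 2 powr (real J0 * (\<gamma>m + real CARD('d) / 2)) * (\<bar>c\<bar> * (Q ^ CARD('d) * 1))"
    using assms by (intro mult_mono powr_mono mult_left_mono) auto
  then show "2 powr (real J0 * (s + real CARD('d) / 2)) * \<bar>l2_inner unit_cube (\<lambda>x. c) (scaling J0 m)\<bar>
      \<le> \<bar>c\<bar> * Q ^ CARD('d) * 2 powr (real J0 * (\<gamma>m + real CARD('d) / 2))"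
    by (simp add: mult_ac)
next
  fix l and m :: "nat ^ 'd" and v :: "bool ^ 'd"
  assume "J0 \<le> l" "m \<in> level_indices l" "v \<noteq> (\<chi> j. False)"
  then show "2 powr (real l * (s + real CARD('d) / 2)) * \<bar>l2_inner unit_cube (\<lambda>x. c) (wavelet B v l m)\<bar>
      \<le> \<bar>c\<bar> * Q ^ CARD('d) * 2 powr (real J0 * (\<gamma>m + real CARD('d) / 2))"
    using Q_ge_1 by (simp add: l2_inner_const_wavelet_eq_0)
qed

lemma large_level:
  assumes n: "2 \<le> n" and large: "large n"
  shows "l0 \<le> level n" "2 powr (real (level n) * real CARD('d)) \<le> c0 * (real n / ln (real n))"
    "c0 * (real n / ln (real n)) \<le> 2 powr ((real (level n) + 1) * real CARD('d))"
proof -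
  let ?r = "c0 * (real n / ln (real n))" and ?d = "real CARD('d)"
  have r: "0 < ?r" using n_over_ln_ge_1[OF n] c0 by (intro mult_pos_pos) auto
  have d: "0 < ?d" by simp
  have "real l0 * ?d \<le> log 2 ?r"
    using large r unfolding large_def by (simp add: le_log_iff)
  then have l0: "real l0 \<le> log 2 ?r / ?d" using d by (simp add: field_simps)
  then have "int l0 \<le> \<lfloor>log 2 ?r / ?d\<rfloor>" by (simp add: le_floor_iff)
  then show "l0 \<le> level n" unfolding level_def by linarith
  have lev: "real (level n) \<le> log 2 ?r / ?d" "log 2 ?r / ?d \<le> real (level n) + 1"
    using l0 unfolding level_def by linarith+
  have "real (level n) * ?d \<le> log 2 ?r" "log 2 ?r \<le> (real (level n) + 1) * ?d"
    using lev d by (simp_all add: field_simps)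
  then show "2 powr (real (level n) * ?d) \<le> ?r" "?r \<le> 2 powr ((real (level n) + 1) * ?d)"
    using r by (simp_all add: le_log_iff log_le_iff)
qed

definition C2 :: real where
  "C2 = C1 * (\<kappa> + 1) * (2 powr (real l0 * real CARD('d) / 2) + 2 powr \<gamma>m * c0 powr (- (\<gamma>m / real CARD('d))))"

lemma C2_nonneg: "0 \<le> C2"
  unfolding C2_def using C1_nonneg \<kappa> by (intro mult_nonneg_nonneg add_nonneg_nonneg) auto

text \<open>Three situations: a selected candidate in range (\<open>C2\<close>), one that leaves a
  range of length \<open>width\<close> around a truth with margin \<open>\<delta>\<close>
  (\<open>C2 * width / \<delta>\<close>), and sample sizes too small for any test (last
  summand).\<close>

definition C3 :: "real \<Rightarrow> real \<Rightarrow> real" where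
  "C3 \<delta> width = C2 * (1 + width / \<delta>) + width * (2 powr (real l0 * real CARD('d)) / c0)"

definition Mc :: "real \<Rightarrow> real" where
  "Mc c = max (2 * M1) (\<bar>c\<bar> * Q ^ CARD('d) * 2 powr (real J0 * (\<gamma>m + real CARD('d) / 2)))"

lemma feasible_error_rate:
  assumes n: "2 \<le> n" and large: "large n" and t: "coef_ball s M t" and s: "s0 \<le> s" "s \<le> \<gamma>m"
    and j: "grid (level n) j \<le> s" "s \<le> grid (level n) (Suc j)"
    and suit: "suitable (level n) (threshold n) y T a t"
    and h: "h \<in> candidates (level n)" "feasible (level n) (threshold n) y T j h" and x: "x \<in> unit_cube"
  shows "\<bar>h x - t x\<bar> \<le> C2 * (real n / ln (real n)) powr (- (s / (2 * s + real CARD('d))))"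
proof -
  let ?r = "real n / ln (real n)" and ?d = "real CARD('d)"
  have r: "1 \<le> ?r" by (rule n_over_ln_ge_1[OF n])
  obtain l where l: "l \<in> {l0..level n}" and bal: "2 powr (real l * ?d / 2) * ?r powr (- 1 / 2) + 2 powr (- (real l * s))
    \<le> (2 powr (real l0 * ?d / 2) + 2 powr \<gamma>m * c0 powr (- (\<gamma>m / ?d))) * ?r powr (- (s / (2 * s + ?d)))"
  proof -
    have d: "1 \<le> ?d" by simp
    show ?thesis
      using that ex_balanced_level[OF r less_le_trans[OF s0 s(1)] s(2) d c0 large_level(1,3)[OF n large]] by blast
  qed
  have "\<bar>h x - t x\<bar> \<le> C1 * (2 powr (real l * ?d / 2) * threshold n + 2 powr (- (real l * s)))"
    using \<kappa> by (intro feasible_imp_close(2)[OF large_level(1)[OF n large] t s(1) j suit h _ l x]) (auto simp: threshold_def)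
  also have "\<dots> \<le> C1 * ((\<kappa> + 1) * (2 powr (real l * ?d / 2) * ?r powr (- 1 / 2) + 2 powr (- (real l * s))))"
  proof (intro mult_left_mono C1_nonneg)
    have "\<kappa> * u + v \<le> (\<kappa> + 1) * (u + v)" if "0 \<le> u" "0 \<le> v" for u v
      using \<kappa> that mult_nonneg_nonneg[of \<kappa> v] unfolding distrib_left distrib_right by linarith
    from this[of "2 powr (real l * ?d / 2) * ?r powr (- 1 / 2)" "2 powr (- (real l * s))"]
    show "2 powr (real l * ?d / 2) * threshold n + 2 powr (- (real l * s))
      \<le> (\<kappa> + 1) * (2 powr (real l * ?d / 2) * ?r powr (- 1 / 2) + 2 powr (- (real l * s)))"
      by (simp add: threshold_def mult.left_commute)
  qed
  also have "\<dots> \<le> C1 * ((\<kappa> + 1) * ((2 powr (real l0 * ?d / 2) + 2 powr \<gamma>m * c0 powr (- (\<gamma>m / ?d))) * ?r powr (- (s / (2 * s + ?d)))))"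
    using \<kappa> by (intro mult_left_mono C1_nonneg bal) auto
  finally show ?thesis by (simp add: C2_def mult.assoc)
qed

text \<open>The estimator is a fixed sequence \<open>H\<close> with a data-dependent index. Truth,
  smoothness, weight and margin are quantified after \<open>idx\<close> and \<open>H\<close>; this
  is the adaptivity. The guarantee is deterministic, given the sample conditions in
  \<open>suitable\<close>.\<close>

definition selected :: "nat \<Rightarrow> real \<Rightarrow> real \<Rightarrow> real \<Rightarrow> ('w \<Rightarrow> nat \<Rightarrow> nat ^ 'd \<Rightarrow> real) \<Rightarrow>
    ('w \<Rightarrow> (real ^ 'd \<Rightarrow> real) \<Rightarrow> real) \<Rightarrow> ('w \<Rightarrow> nat) \<Rightarrow> (nat \<Rightarrow> real ^ 'd \<Rightarrow> real) \<Rightarrow> bool" where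
  "selected n lo c hi Y T idx H \<longleftrightarrow>
    (\<forall>i. continuous_on unit_cube (H i) \<and> (\<forall>x\<in>unit_cube. lo \<le> H i x \<and> H i x \<le> hi)) \<and>
    (\<forall>\<omega> s t a \<delta>. s0 \<le> s \<longrightarrow> s < \<gamma>m \<longrightarrow> coef_ball s M t \<longrightarrow> 0 < \<delta> \<longrightarrow>
       (\<forall>x\<in>unit_cube. lo + \<delta> \<le> t x \<and> t x \<le> hi - \<delta>) \<longrightarrow>
       (large n \<longrightarrow> suitable (level n) (threshold n) (Y \<omega>) (T \<omega>) a t) \<longrightarrow>
       coef_ball s (Mc c) (H (idx \<omega>)) \<and>
       (\<forall>x\<in>unit_cube. \<bar>H (idx \<omega>) x - t x\<bar> \<le> C3 \<delta> (hi - lo) * (real n / ln (real n)) powr (- (s / (2 * s + real CARD('d))))))"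

lemma selected_range:
  assumes "selected n lo c hi Y T idx H"
  shows "continuous_on unit_cube (H i)" "x \<in> unit_cube \<Longrightarrow> lo \<le> H i x \<and> H i x \<le> hi"
  using assms by (simp_all add: selected_def)

lemma selected_error:
  assumes "selected n lo c hi Y T idx H" "s0 \<le> s" "s < \<gamma>m" "coef_ball s M t" "0 < \<delta>"
    "\<And>x. x \<in> unit_cube \<Longrightarrow> lo + \<delta> \<le> t x \<and> t x \<le> hi - \<delta>"
    "large n \<Longrightarrow> suitable (level n) (threshold n) (Y \<omega>) (T \<omega>) a t"
  shows "coef_ball s (Mc c) (H (idx \<omega>))"
    "x \<in> unit_cube \<Longrightarrow> \<bar>H (idx \<omega>) x - t x\<bar> \<le> C3 \<delta> (hi - lo) * (real n / ln (real n)) powr (- (s / (2 * s + real CARD('d))))"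
  using assms unfolding selected_def by blast+

lemma ex_selected_estimator:
  fixes Ms :: "'w measure" and Y :: "'w \<Rightarrow> nat \<Rightarrow> nat ^ 'd \<Rightarrow> real" and T :: "'w \<Rightarrow> (real ^ 'd \<Rightarrow> real) \<Rightarrow> real"
  assumes n: "2 \<le> n" and c: "lo \<le> c" "c \<le> hi"
    and meas: "\<And>l m h. J0 \<le> l \<Longrightarrow> m \<in> level_indices l \<Longrightarrow> continuous_on unit_cube h \<Longrightarrow>
      (\<lambda>\<omega>. Y \<omega> l m - T \<omega> (\<lambda>x. h x * scaling l m x)) \<in> borel_measurable Ms"
  shows "\<exists>idx\<in>measurable Ms (count_space UNIV). \<exists>H. selected n lo c hi Y T idx H"
proof (cases "large n")
  case False
  let ?r = "real n / ln (real n)" and ?R = "2 powr (real l0 * real CARD('d)) / c0"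
  have r: "1 \<le> ?r" by (rule n_over_ln_ge_1[OF n])
  \<comment> \<open>If \<open>n\<close> is not large, \<open>n / ln n\<close> is bounded, so the
    trivial error \<open>hi - lo\<close> is a constant times its inverse, and the rate decays no
    faster than that inverse.\<close>
  have rR: "?r \<le> ?R" using False c0 by (simp add: large_def field_simps)
  have "\<bar>c - t x\<bar> \<le> C3 \<delta> (hi - lo) * ?r powr (- (s / (2 * s + real CARD('d))))"
    if s: "s0 \<le> s" and \<delta>: "0 < \<delta>" and t: "\<forall>x\<in>unit_cube. lo + \<delta> \<le> t x \<and> t x \<le> hi - \<delta>" and x: "x \<in> unit_cube"
    for s t \<delta> and x :: "real ^ 'd"
  proof -
    have "\<bar>c - t x\<bar> \<le> hi - lo" using t x c \<delta> by (fastforce simp: abs_le_iff)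
    also have "\<dots> \<le> (hi - lo) * (?R * ?r powr (- 1))"
    proof -
      have "q * q powr (- 1) = 1" if "1 \<le> q" for q :: real
        using that by (simp add: powr_minus_divide)
      from this[OF r] have "1 = ?r * ?r powr (- 1)" ..
      also have "\<dots> \<le> ?R * ?r powr (- 1)" using rR by (intro mult_right_mono) auto
      finally show ?thesis using c mult_left_mono[of 1 "?R * ?r powr (- 1)" "hi - lo"] by simp
    qed
    also have "\<dots> \<le> (hi - lo) * (?R * ?r powr (- (s / (2 * s + real CARD('d)))))"
    proof (intro mult_left_mono powr_mono r)
      show "- 1 \<le> - (s / (2 * s + real CARD('d)))" using s s0 by (simp add: field_simps)
    qed (use c c0 in auto)
    also have "\<dots> \<le> C3 \<delta> (hi - lo) * ?r powr (- (s / (2 * s + real CARD('d))))"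
      unfolding mult.assoc[symmetric] C3_def using C2_nonneg c \<delta> by (intro mult_right_mono) auto
    finally show ?thesis .
  qed
  moreover have "coef_ball s (Mc c) (\<lambda>x :: real ^ 'd. c)" if "s < \<gamma>m" for s
    by (rule coef_ball_mono[OF coef_ball_const[of s c] order_refl]) (use that in \<open>auto simp: Mc_def\<close>)
  ultimately show ?thesis
    unfolding selected_def using c by (intro bexI[of _ "\<lambda>_. 0"] exI[of _ "\<lambda>_ _. c"]) auto
next
  case True
  define L where "L = level n"
  define thr where "thr = threshold n"
  have lL: "l0 \<le> L" "J0 \<le> L" "0 < L" using large_level(1)[OF n True] l0 J0_pos by (auto simp: L_def)
  define cd where "cd i = from_nat_into (candidates L) i" for i
  have cd: "cd i \<in> candidates L" for i
    unfolding cd_def by (rule from_nat_into[OF candidates_nonempty])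
  have cd_surj: "\<exists>i. cd i = h" if "h \<in> candidates L" for h
    unfolding cd_def using from_nat_into_surj[OF countable_candidates that] .
  have cdc: "continuous_on unit_cube (cd i)" for i by (rule candidate_continuous[OF lL(2) cd])
  define A where "A j i \<omega> \<longleftrightarrow> feasible L thr (Y \<omega>) (T \<omega>) j (cd i)" for j i \<omega>
  have Am: "Measurable.pred Ms (A j i)" for j i
  proof -
    have m1: "(\<lambda>\<omega>. Y \<omega> l m - T \<omega> (\<lambda>x. cd i x * scaling l m x)) \<in> borel_measurable Ms"
      if "l \<in> {l0..L}" "m \<in> level_indices l" for l m
      using that l0 by (intro meas cdc) auto
    have "Measurable.pred Ms (\<lambda>\<omega>. \<bar>Y \<omega> l m - T \<omega> (\<lambda>x. cd i x * scaling l m x)\<bar> \<le> k)"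
      if "l \<in> {l0..L}" "m \<in> level_indices l" for l m k
    proof -
      note [measurable] = m1[OF that]
      show ?thesis by measurable
    qed
    then show ?thesis
      unfolding A_def[abs_def] feasible_def
      by (intro pred_intros_logic pred_intros_finite) auto
  qed
  \<comment> \<open>The grid reaches at least up to \<open>\<gamma>m\<close>, so the cell of any
    admissible \<open>s\<close> has an index \<open>\<le> J\<close>.\<close>
  define J where "J = nat \<lceil>(\<gamma>m - s0) * real L\<rceil>"
  obtain idx where idx: "idx \<in> measurable Ms (count_space UNIV)" "\<And>\<omega> j. j \<le> J \<Longrightarrow> \<exists>i. A j i \<omega> \<Longrightarrow> A j (idx \<omega>) \<omega>"
    using measurable_lexicographic_selection[of A Ms J, OF Am] feasible_mono unfolding A_def by blast
  \<comment> \<open>Replacement by the constant \<open>c\<close>, unlike clipping, stays in a ball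
    of every smoothness. The decision depends on \<open>i\<close> only, so \<open>idx\<close>
    remains the only random ingredient.\<close>
  define H where "H i = (if \<forall>x\<in>unit_cube. lo \<le> cd i x \<and> cd i x \<le> hi then cd i else (\<lambda>_. c))" for i
  have H: "continuous_on unit_cube (H i)" "\<forall>x\<in>unit_cube. lo \<le> H i x \<and> H i x \<le> hi" for i
    using cdc c by (auto simp: H_def)
  have main: "coef_ball s (Mc c) (H (idx \<omega>)) \<and>
       (\<forall>x\<in>unit_cube. \<bar>H (idx \<omega>) x - t x\<bar> \<le> C3 \<delta> (hi - lo) * (real n / ln (real n)) powr (- (s / (2 * s + real CARD('d)))))"
    if s: "s0 \<le> s" "s < \<gamma>m" and t: "coef_ball s M t" and \<delta>: "0 < \<delta>"
      and tb: "\<forall>x\<in>unit_cube. lo + \<delta> \<le> t x \<and> t x \<le> hi - \<delta>"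
      and suit: "suitable L thr (Y \<omega>) (T \<omega>) a t" for \<omega> s t a \<delta>
  proof -
    let ?\<rho> = "(real n / ln (real n)) powr (- (s / (2 * s + real CARD('d))))"
    define j where "j = nat \<lfloor>(s - s0) * real L\<rfloor>"
    have j0: "0 \<le> (s - s0) * real L" using s by simp
    have "(s - s0) * real L \<le> (\<gamma>m - s0) * real L" using s by (intro mult_right_mono) auto
    then have jJ: "j \<le> J" unfolding j_def J_def by linarith
    have "real j \<le> (s - s0) * real L" "(s - s0) * real L \<le> real (Suc j)"
      using j0 unfolding j_def by linarith+
    then have j: "grid L j \<le> s" "s \<le> grid L (Suc j)"
      using lL(3) by (simp_all add: grid_def field_simps)
    obtain h where h: "h \<in> candidates L" "feasible L thr (Y \<omega>) (T \<omega>) j h"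
      using ex_feasible_candidate[OF lL(1) t s(1) less_imp_le[OF s(2)] j(1) suit] by blast
    obtain i0 where "cd i0 = h" using cd_surj[OF h(1)] by blast
    then have "A j i0 \<omega>" using h(2) by (simp add: A_def)
    then have f: "feasible L thr (Y \<omega>) (T \<omega>) j (cd (idx \<omega>))" using idx(2)[OF jJ] unfolding A_def by blast
    have thr: "0 \<le> thr" using \<kappa> by (simp add: thr_def threshold_def)
    have ball: "coef_ball s (2 * M1) (cd (idx \<omega>))"
      by (rule feasible_imp_close(1)[OF lL(1) t s(1) j suit cd f thr])
    have err: "\<bar>cd (idx \<omega>) x - t x\<bar> \<le> C2 * ?\<rho>" if x: "x \<in> unit_cube" for x
      using feasible_error_rate[OF n True t s(1) less_imp_le[OF s(2)], of j "Y \<omega>" "T \<omega>" a "cd (idx \<omega>)" x] j suit cd f x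
      by (simp add: L_def thr_def)
    have C23: "C2 * ?\<rho> \<le> C3 \<delta> (hi - lo) * ?\<rho>" and C23': "(hi - lo) / \<delta> * (C2 * ?\<rho>) \<le> C3 \<delta> (hi - lo) * ?\<rho>"
    proof -
      have w: "0 \<le> (hi - lo) * (2 powr (real l0 * real CARD('d)) / c0)" using c c0 by simp
      have q: "0 \<le> C2 * ((hi - lo) / \<delta>)" using C2_nonneg c \<delta> by simp
      have "C2 \<le> C3 \<delta> (hi - lo)" "(hi - lo) / \<delta> * C2 \<le> C3 \<delta> (hi - lo)"
        using w q C2_nonneg unfolding C3_def distrib_left by (simp_all add: mult.commute)
      then show "C2 * ?\<rho> \<le> C3 \<delta> (hi - lo) * ?\<rho>" "(hi - lo) / \<delta> * (C2 * ?\<rho>) \<le> C3 \<delta> (hi - lo) * ?\<rho>"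
        unfolding mult.assoc[symmetric] by - (rule mult_right_mono, assumption, simp)+
    qed
    show ?thesis
    proof (cases "\<forall>x\<in>unit_cube. lo \<le> cd (idx \<omega>) x \<and> cd (idx \<omega>) x \<le> hi")
      case True
      then have "H (idx \<omega>) = cd (idx \<omega>)" by (simp add: H_def)
      then show ?thesis
        using coef_ball_mono[OF ball order_refl, of "Mc c"] err C23 by (auto simp: Mc_def intro: order_trans)
    next
      case False
      then have Hc: "H (idx \<omega>) = (\<lambda>_. c)" unfolding H_def by (rule if_not_P)
      obtain z where z: "z \<in> unit_cube" "\<not> (lo \<le> cd (idx \<omega>) z \<and> cd (idx \<omega>) z \<le> hi)" using False by blast
      \<comment> \<open>A candidate that leaves the range is at least the margin
        \<open>\<delta>\<close> away from the truth somewhere. So the error bound is itself at least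
        \<open>\<delta>\<close>, and the trivial error \<open>hi - lo\<close> is at most
        \<open>(hi - lo) / \<delta>\<close> times it.\<close>
      have "\<delta> \<le> \<bar>cd (idx \<omega>) z - t z\<bar>" using tb z by fastforce
      then have d: "\<delta> \<le> C2 * ?\<rho>" using err[OF z(1)] by linarith
      have "\<bar>c - t x\<bar> \<le> C3 \<delta> (hi - lo) * ?\<rho>" if x: "x \<in> unit_cube" for x
      proof -
        have "\<bar>c - t x\<bar> \<le> hi - lo" using tb x c \<delta> by (fastforce simp: abs_le_iff)
        also have "\<dots> = (hi - lo) / \<delta> * \<delta>" using \<delta> by simp
        also have "\<dots> \<le> (hi - lo) / \<delta> * (C2 * ?\<rho>)" using d c \<delta> by (intro mult_left_mono) auto
        also note C23'
        finally show ?thesis .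
      qed
      moreover have "coef_ball s (Mc c) (\<lambda>x :: real ^ 'd. c)"
        by (rule coef_ball_mono[OF coef_ball_const[of s c] order_refl]) (use s in \<open>auto simp: Mc_def\<close>)
      ultimately show ?thesis unfolding Hc by blast
    qed
  qed
  show ?thesis
    unfolding selected_def
  proof (intro bexI[OF _ idx(1)] exI[of _ H] conjI allI)
    fix \<omega> s \<delta> and t a :: "real ^ 'd \<Rightarrow> real"
    let ?\<rho> = "(real n / ln (real n)) powr (- (s / (2 * s + real CARD('d))))"
    show "s0 \<le> s \<longrightarrow> s < \<gamma>m \<longrightarrow> coef_ball s M t \<longrightarrow> 0 < \<delta> \<longrightarrow>
       (\<forall>x\<in>unit_cube. lo + \<delta> \<le> t x \<and> t x \<le> hi - \<delta>) \<longrightarrow>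
       (large n \<longrightarrow> suitable (level n) (threshold n) (Y \<omega>) (T \<omega>) a t) \<longrightarrow>
       coef_ball s (Mc c) (H (idx \<omega>)) \<and> (\<forall>x\<in>unit_cube. \<bar>H (idx \<omega>) x - t x\<bar> \<le> C3 \<delta> (hi - lo) * ?\<rho>)"
    proof (intro impI)
      assume s: "s0 \<le> s" "s < \<gamma>m" and t: "coef_ball s M t" and \<delta>: "0 < \<delta>"
        and tb: "\<forall>x\<in>unit_cube. lo + \<delta> \<le> t x \<and> t x \<le> hi - \<delta>"
        and suit: "large n \<longrightarrow> suitable (level n) (threshold n) (Y \<omega>) (T \<omega>) a t"
      have "suitable L thr (Y \<omega>) (T \<omega>) a t" using suit True by (simp add: L_def thr_def)
      then show "coef_ball s (Mc c) (H (idx \<omega>)) \<and> (\<forall>x\<in>unit_cube. \<bar>H (idx \<omega>) x - t x\<bar> \<le> C3 \<delta> (hi - lo) * ?\<rho>)"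
        by (rule main[OF s t \<delta> tb])
    qed
  qed (use H in auto)
qed

end

subsection \<open>The estimators\<close>

lemma half_le_ln: "2 \<le> n \<Longrightarrow> 1 / 2 \<le> ln (real n)"
proof -
  assume n: "2 \<le> n"
  have "ln (1 / real n) \<le> 1 / real n - 1" using n by (intro ln_le_minus_one) auto
  moreover have "1 / real n \<le> 1 / 2" using n by (intro divide_left_mono) auto
  moreover have "ln (1 / real n) = - ln (real n)" using n by (simp add: ln_div)
  ultimately show ?thesis by linarith
qed

lemma sup_norm_bounds:
  assumes "\<And>x. x \<in> unit_cube \<Longrightarrow> \<bar>h x\<bar> \<le> b"
  shows "sup_norm h \<le> b" "0 \<le> sup_norm h"
proof -
  show "sup_norm h \<le> b"
    unfolding sup_norm_def using assms unit_cube_nonempty by (intro cSUP_least) auto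
  have "\<bar>h 0\<bar> \<le> sup_norm h"
    unfolding sup_norm_def using assms unit_cube_nonempty by (intro cSUP_upper bdd_aboveI2) auto
  then show "0 \<le> sup_norm h" by linarith
qed

text \<open>On the good event the error obeys the rate, and off it, with probability at most
  \<open>1 / n ^ 4\<close>, the error is at most \<open>hi - lo\<close>. As \<open>idx\<close> takes
  countably many values, all events are measurable, for an arbitrary set \<open>S\<close> and
  although \<open>sup_norm\<close> is an uncountable supremum.\<close>

lemma risk_bounds:
  fixes H :: "nat \<Rightarrow> real ^ 'd \<Rightarrow> real" and idx :: "'w \<Rightarrow> nat" and t :: "real ^ 'd \<Rightarrow> real"
  assumes Pn: "prob_space Pn" and idx [measurable]: "idx \<in> measurable Pn (count_space UNIV)"
    and H: "\<And>i x. x \<in> unit_cube \<Longrightarrow> lo \<le> H i x \<and> H i x \<le> hi"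
    and t: "\<And>x. x \<in> unit_cube \<Longrightarrow> lo \<le> t x \<and> t x \<le> hi"
    and N: "N \<in> sets Pn" "measure Pn N \<le> 1 / real n ^ 4" and n: "2 \<le> n"
    and ball: "\<And>\<omega>. \<omega> \<in> space Pn - N \<Longrightarrow> H (idx \<omega>) \<in> S"
    and err: "\<And>\<omega> x. \<omega> \<in> space Pn - N \<Longrightarrow> x \<in> unit_cube \<Longrightarrow>
      \<bar>H (idx \<omega>) x - t x\<bar> \<le> K * (real n / ln (real n)) powr (- (s / (2 * s + real CARD('d))))"
    and s: "0 < s" and K: "0 \<le> K" "K + (hi - lo) < C powr (real CARD('d) / (2 * s + real CARD('d)))"
  shows "integrable Pn (\<lambda>\<omega>. sup_norm (\<lambda>x. H (idx \<omega>) x - t x))"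
    and "(LINT \<omega>|Pn. sup_norm (\<lambda>x. H (idx \<omega>) x - t x)) \<le> rate (real CARD('d)) C n s"
    and "\<P>(\<omega> in Pn. sup_norm (\<lambda>x. H (idx \<omega>) x - t x) \<ge> rate (real CARD('d)) C n s) \<le> ln (real n) / real n ^ 3"
    and "Measurable.pred Pn (\<lambda>\<omega>. H (idx \<omega>) \<notin> S)"
    and "\<P>(\<omega> in Pn. H (idx \<omega>) \<notin> S) \<le> 1 / real n ^ 2"
proof -
  interpret prob_space Pn by fact
  let ?d = "real CARD('d)"
  let ?\<rho> = "(real n / ln (real n)) powr (- (s / (2 * s + ?d)))"
  define E where "E i = sup_norm (\<lambda>x. H i x - t x)" for i
  have r: "1 \<le> real n / ln (real n)" by (rule n_over_ln_ge_1[OF n])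
  have \<rho>0: "0 < ?\<rho>" using n by simp
  have n2: "2 \<le> real n" using n by simp
  have lohi: "lo \<le> hi" using t[OF unit_cube_nonempty] by linarith
  have E: "0 \<le> E i" "E i \<le> hi - lo" for i
  proof -
    have "\<bar>H i x - t x\<bar> \<le> hi - lo" if "x \<in> unit_cube" for x using H[OF that, of i] t[OF that] by linarith
    from sup_norm_bounds[OF this] show "0 \<le> E i" "E i \<le> hi - lo" by (simp_all add: E_def)
  qed
  have meas [measurable]: "(\<lambda>\<omega>. E (idx \<omega>)) \<in> borel_measurable Pn"
    by (rule measurable_compose[OF idx]) simp
  have int: "integrable Pn (\<lambda>\<omega>. E (idx \<omega>))"
    using E by (intro integrable_const_bound[where B = "hi - lo"]) auto
  then show "integrable Pn (\<lambda>\<omega>. sup_norm (\<lambda>x. H (idx \<omega>) x - t x))" by (simp add: E_def)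
  have good: "E (idx \<omega>) \<le> K * ?\<rho>" if "\<omega> \<in> space Pn - N" for \<omega>
    unfolding E_def using err[OF that] by (rule sup_norm_bounds(1))
  \<comment> \<open>The summand \<open>hi - lo\<close> pays for the bad event in the expectation;
    strictness keeps the good event out of the event that the error reaches the rate.\<close>
  have rate: "(K + (hi - lo)) * ?\<rho> < rate ?d C n s"
    unfolding rate_def using K(2) \<rho>0 by (intro mult_strict_right_mono) auto
  \<comment> \<open>The exponent \<open>s / (2 * s + d)\<close> is below 1, so the rate is at least
    \<open>ln n / n\<close>, far above the probability of the bad event.\<close>
  have n4: "1 / real n ^ 4 \<le> ?\<rho>"
  proof -
    have "1 / real n ^ 4 \<le> ln (real n) / real n"
    proof -
      have "1 / real n ^ 4 = 1 / real n ^ 3 / real n" by (simp add: eval_nat_numeral)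
      also have "1 / real n ^ 3 \<le> 1 / 2 ^ 3" using n2 by (intro divide_left_mono power_mono) auto
      also have "\<dots> \<le> ln (real n)" using half_le_ln[OF n] by simp
      finally show ?thesis by (simp add: divide_right_mono)
    qed
    also have "\<dots> = (real n / ln (real n)) powr (- 1)"
    proof -
      have "1 / q = q powr (- 1)" if "1 \<le> q" for q :: real using that by (simp add: powr_minus_divide)
      from this[OF r] show ?thesis by simp
    qed
    also have "\<dots> \<le> ?\<rho>"
      using s by (intro powr_mono r) (simp add: field_simps)
    finally show ?thesis .
  qed
  have iN: "integrable Pn (\<lambda>\<omega>. indicator N \<omega> :: real)"
    using N(1) by (intro integrable_real_indicator) (auto simp: less_top[symmetric])
  have "(LINT \<omega>|Pn. E (idx \<omega>)) \<le> (LINT \<omega>|Pn. K * ?\<rho> + (hi - lo) * indicator N \<omega>)"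
  proof (intro integral_mono int)
    show "integrable Pn (\<lambda>\<omega>. K * ?\<rho> + (hi - lo) * indicator N \<omega>)"
      using iN by simp
    fix \<omega> assume "\<omega> \<in> space Pn"
    moreover have "0 \<le> K * ?\<rho>" using K(1) \<rho>0 by simp
    ultimately show "E (idx \<omega>) \<le> K * ?\<rho> + (hi - lo) * indicator N \<omega>"
      using good[of \<omega>] E(2)[of "idx \<omega>"] by (cases "\<omega> \<in> N") auto
  qed
  also have "\<dots> = K * ?\<rho> + (hi - lo) * measure Pn N"
    using iN by (simp add: prob_space Int_absorb2[OF sets.sets_into_space[OF N(1)]])
  also have "\<dots> \<le> K * ?\<rho> + (hi - lo) * ?\<rho>"
    using N(2) n4 lohi by (intro add_left_mono mult_left_mono) auto
  also have "\<dots> \<le> rate ?d C n s" using rate by (simp add: distrib_right)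
  finally show "(LINT \<omega>|Pn. sup_norm (\<lambda>x. H (idx \<omega>) x - t x)) \<le> rate ?d C n s" by (simp add: E_def)
  have "measure Pn {\<omega>\<in>space Pn. rate ?d C n s \<le> E (idx \<omega>)} \<le> measure Pn N"
  proof (intro finite_measure_mono N(1) subsetI)
    fix \<omega> assume w: "\<omega> \<in> {\<omega>\<in>space Pn. rate ?d C n s \<le> E (idx \<omega>)}"
    show "\<omega> \<in> N"
    proof (rule ccontr)
      assume "\<omega> \<notin> N"
      then have "E (idx \<omega>) \<le> K * ?\<rho>" using w good by blast
      moreover have "0 \<le> (hi - lo) * ?\<rho>" using lohi \<rho>0 by simp
      ultimately show False using w rate by (auto simp: distrib_right)
    qed
  qed
  also have "\<dots> \<le> 1 / real n ^ 4" by (rule N)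
  also have "\<dots> \<le> ln (real n) / real n ^ 3"
  proof -
    have eq: "1 / real n ^ 4 = 1 / real n / real n ^ 3" by (simp add: eval_nat_numeral)
    have "1 / real n \<le> 1 / 2" using n2 by (intro divide_left_mono) auto
    then have "1 / real n \<le> ln (real n)" using half_le_ln[OF n] by linarith
    then show ?thesis unfolding eq by (intro divide_right_mono) auto
  qed
  finally show "\<P>(\<omega> in Pn. sup_norm (\<lambda>x. H (idx \<omega>) x - t x) \<ge> rate ?d C n s) \<le> ln (real n) / real n ^ 3"
    by (simp add: E_def)
  show "Measurable.pred Pn (\<lambda>\<omega>. H (idx \<omega>) \<notin> S)"
    by (rule measurable_compose[OF idx]) simp
  have "measure Pn {\<omega>\<in>space Pn. H (idx \<omega>) \<notin> S} \<le> measure Pn N"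
    using ball by (intro finite_measure_mono N(1)) auto
  also have "\<dots> \<le> 1 / real n ^ 4" by (rule N)
  also have "\<dots> \<le> 1 / real n ^ 2" using n2 by (intro divide_left_mono power_increasing) auto
  finally show "\<P>(\<omega> in Pn. H (idx \<omega>) \<notin> S) \<le> 1 / real n ^ 2" by simp
qed

text \<open>Joint measurability in sample and point: a countable partition of the samples, and one
  continuous function on each piece.\<close>

lemma is_estimator_selected:
  fixes H :: "nat \<Rightarrow> real ^ 'd \<Rightarrow> real"
  assumes idx: "idx \<in> measurable (sample_law n borel) (count_space UNIV)"
    and H: "\<And>i. continuous_on unit_cube (H i)"
  shows "is_estimator n (\<lambda>\<omega>. H (idx \<omega>))"
proof -
  have Hm: "H i \<in> borel_measurable (restrict_space borel unit_cube)" for i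
    using H by (rule borel_measurable_continuous_on_restrict)
  have "(\<lambda>z. H (idx (fst z)) (snd z)) \<in> borel_measurable (sample_law n borel \<Otimes>\<^sub>M restrict_space borel unit_cube)"
    by (rule measurable_compose_countable[where f = "\<lambda>i z. H i (snd z)" and g = "\<lambda>z. idx (fst z)"])
      (intro measurable_compose[OF measurable_snd Hm] measurable_compose[OF measurable_fst idx])+
  then show ?thesis by (simp add: is_estimator_def case_prod_beta')
qed

lemma measurable_sample_law_cong:
  assumes "sets P = sets borel"
  shows "measurable (sample_law n P) M = measurable (sample_law n borel) M"
  unfolding sample_law_def by (intro measurable_cong_sets sets_PiM_cong assms refl)

text \<open>The constants shared by both targets: \<open>\<epsilon>\<close> is small enough for the
  absorption with lower bounds \<open>BL\<close> and 1 of the weight, \<open>\<kappa>\<close> large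
  enough for Bernstein at the noise level, \<open>c0\<close> small enough for Gram entries within
  \<open>\<epsilon>\<close>, and \<open>l0\<close> a level from which densities oscillate by at most
  \<open>\<epsilon>\<close>.\<close>

locale regression = cdv_bounded B Q for B Q +
  fixes dim :: "'d::finite itself" and s0 \<gamma>m M BL U \<epsilon> \<kappa> c0 :: real and l0 :: nat
  assumes s0: "0 < s0" and M: "0 \<le> M" and BL: "0 < BL" "BL \<le> U"
    and \<epsilon>: "0 < \<epsilon>" "\<epsilon> \<le> U" "2 * ((Q ^ CARD('d)) ^ 3 + (Q ^ CARD('d)) ^ 2) * \<epsilon> \<le> BL"
      "2 * ((Q ^ CARD('d)) ^ 3 + (Q ^ CARD('d)) ^ 2) * \<epsilon> \<le> 1"
    and \<kappa>: "0 < \<kappa>" "40 * ((Q ^ CARD('d))\<^sup>2 * U * (1 + 2 * U)\<^sup>2) \<le> \<kappa>\<^sup>2"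
    and c0: "0 < c0" "c0 \<le> 1 / 2" "40 * (Q ^ CARD('d)) ^ 4 * U * c0 \<le> \<epsilon>\<^sup>2" "\<kappa>\<^sup>2 * c0 \<le> U\<^sup>2"
    and l0: "J0 \<le> l0"
    and osc: "\<And>l s h x y. l0 \<le> l \<Longrightarrow> s0 \<le> s \<Longrightarrow> coef_ball s M h \<Longrightarrow> (\<forall>x\<in>unit_cube. \<bar>h x\<bar> \<le> U) \<Longrightarrow>
      x \<in> unit_cube \<Longrightarrow> y \<in> unit_cube \<Longrightarrow> (\<forall>j. \<bar>x $ j - (y :: real ^ 'd) $ j\<bar> \<le> Q / 2 ^ l) \<Longrightarrow> \<bar>h x - h y\<bar> \<le> \<epsilon>"
begin

lemma U_pos: "0 < U" using BL by linarith

text \<open>The weight is the density, between \<open>BL\<close> and \<open>U\<close>. The bound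
  \<open>(U + 1) * (Q ^ CARD('d) + 1)\<close> for the mass of a test covers the empirical mean and
  the Lebesgue integral alike.\<close>

sublocale f: adaptive B Q dim s0 \<gamma>m M "(U + 1) * (Q ^ CARD('d) + 1)" BL U \<epsilon> \<kappa> c0 l0
  using s0 M BL U_pos \<epsilon> \<kappa> c0 l0 Q_power_ge_1[of "CARD('d)"] by unfold_locales auto

text \<open>The weight is 1. \<open>level\<close>, \<open>large\<close> and \<open>threshold\<close>
  depend only on \<open>c0\<close>, \<open>l0\<close>, \<open>\<kappa>\<close> and the dimension, so
  they coincide with those of \<open>f\<close>.\<close>

sublocale g: adaptive B Q dim s0 \<gamma>m M "(U + 1) * (Q ^ CARD('d) + 1)" 1 1 \<epsilon> \<kappa> c0 l0
  using s0 M U_pos \<epsilon> \<kappa> c0 l0 Q_power_ge_1[of "CARD('d)"] by unfold_locales auto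

definition f_data :: "nat \<Rightarrow> (nat \<Rightarrow> real \<times> (real ^ 'd)) \<Rightarrow> nat \<Rightarrow> nat ^ 'd \<Rightarrow> real" where
  "f_data n \<omega> l m = empirical n (\<lambda>z. fst z * (indicator unit_cube (snd z) * scaling l m (snd z))) \<omega>"

definition f_functional :: "nat \<Rightarrow> (nat \<Rightarrow> real \<times> (real ^ 'd)) \<Rightarrow> (real ^ 'd \<Rightarrow> real) \<Rightarrow> real" where
  "f_functional n \<omega> h = empirical n (\<lambda>z. indicator unit_cube (snd z) * h (snd z)) \<omega>"

definition g_data :: "nat \<Rightarrow> (nat \<Rightarrow> real \<times> (real ^ 'd)) \<Rightarrow> nat \<Rightarrow> nat ^ 'd \<Rightarrow> real" where
  "g_data n \<omega> l m = empirical n (\<lambda>z. indicator unit_cube (snd z) * scaling l m (snd z)) \<omega>"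

text \<open>Constant in the sample; the argument is there to fit the form of
  \<open>selected\<close>.\<close>

definition g_functional :: "(nat \<Rightarrow> real \<times> (real ^ 'd)) \<Rightarrow> (real ^ 'd \<Rightarrow> real) \<Rightarrow> real" where
  "g_functional \<omega> h = (LINT x:unit_cube|lborel. h x)"

lemma fst_borel: "(fst :: real \<times> (real ^ 'd) \<Rightarrow> real) \<in> borel_measurable borel"
  and snd_borel: "(snd :: real \<times> (real ^ 'd) \<Rightarrow> real ^ 'd) \<in> borel_measurable borel"
  by (simp_all add: borel_prod[symmetric])

lemma on_cube_snd_borel:
  "continuous_on unit_cube h \<Longrightarrow> (\<lambda>z :: real \<times> (real ^ 'd). indicator unit_cube (snd z) * h (snd z) :: real) \<in> borel_measurable borel"
  using measurable_compose[OF snd_borel borel_measurable_continuous_on_indicator[OF unit_cube_borel], of h]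
  by simp

lemma f_measurable:
  assumes "J0 \<le> l" "m \<in> level_indices l" "continuous_on unit_cube h"
  shows "(\<lambda>\<omega>. f_data n \<omega> l m - f_functional n \<omega> (\<lambda>x. h x * scaling l m x)) \<in> borel_measurable (sample_law n borel)"
proof -
  note [measurable] = fst_borel on_cube_snd_borel[OF wavelet_continuous[OF assms(1,2)]]
  have "(\<lambda>z. fst z * (indicator unit_cube (snd z) * scaling l m (snd z))) \<in> borel_measurable borel"
    by measurable
  then show ?thesis
    unfolding f_data_def f_functional_def
    by (intro borel_measurable_diff empirical_measurable on_cube_snd_borel continuous_on_mult wavelet_continuous assms)
qed

lemma g_measurable:
  assumes "J0 \<le> l" "m \<in> level_indices l" "continuous_on unit_cube h"
  shows "(\<lambda>\<omega>. g_data n \<omega> l m - g_functional \<omega> (\<lambda>x. h x * scaling l m x)) \<in> borel_measurable (sample_law n borel)"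
  unfolding g_data_def g_functional_def
  by (intro borel_measurable_diff empirical_measurable on_cube_snd_borel wavelet_continuous assms) simp

text \<open>The hypotheses of \<open>good_sample_prob\<close> at the chosen level and threshold.
  They reduce to the conditions on \<open>\<kappa>\<close> and \<open>c0\<close> through
  \<open>2 ^ (level n * d) \<le> c0 * n / ln n\<close>; the bound by \<open>n\<close> uses
  \<open>c0 \<le> 1 / 2 \<le> ln n\<close>.\<close>

lemma threshold_facts:
  assumes n: "2 \<le> n" and large: "f.large n"
  shows "J0 \<le> f.level n" "2 ^ (f.level n * CARD('d)) \<le> real n" "0 < f.threshold n"
    "40 * ((Q ^ CARD('d)) ^ 4 * 2 ^ (f.level n * CARD('d)) * U) * ln (real n) \<le> real n * \<epsilon>\<^sup>2"
    "40 * ((Q ^ CARD('d))\<^sup>2 * U * (1 + 2 * U)\<^sup>2) * ln (real n) \<le> real n * (f.threshold n)\<^sup>2"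
    "f.threshold n * 2 powr (real (f.level n) * real CARD('d) / 2) \<le> U"
proof -
  let ?r = "real n / ln (real n)" and ?d = "real CARD('d)" and ?L = "f.level n"
  note lev = f.large_level[OF n large]
  have r: "1 \<le> ?r" by (rule n_over_ln_ge_1[OF n])
  have ln0: "0 < ln (real n)" using n by simp
  show "J0 \<le> ?L" using lev(1) l0 by simp
  have two: "2 ^ (?L * CARD('d)) = 2 powr (real ?L * ?d)" by (simp add: powr_realpow[symmetric])
  have le: "2 ^ (?L * CARD('d)) \<le> c0 * ?r" unfolding two by (rule lev(2))
  show "2 ^ (?L * CARD('d)) \<le> real n"
  proof -
    have "c0 * ?r \<le> 1 / 2 * ?r" using c0 r by (intro mult_right_mono) auto
    also have "\<dots> \<le> 1 / 2 * (real n / (1 / 2))"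
      using half_le_ln[OF n] ln0 by (intro mult_left_mono divide_left_mono) auto
    also have "\<dots> = real n" by simp
    finally show ?thesis using le by linarith
  qed
  show "0 < f.threshold n" using n \<kappa> by (simp add: f.threshold_def)
  show "40 * ((Q ^ CARD('d)) ^ 4 * 2 ^ (?L * CARD('d)) * U) * ln (real n) \<le> real n * \<epsilon>\<^sup>2"
  proof -
    have "2 ^ (?L * CARD('d)) * ln (real n) \<le> c0 * real n" using le ln0 by (simp add: field_simps)
    then have "(40 * (Q ^ CARD('d)) ^ 4 * U) * (2 ^ (?L * CARD('d)) * ln (real n)) \<le> (40 * (Q ^ CARD('d)) ^ 4 * U) * (c0 * real n)"
      using U_pos Q_ge_1 by (intro mult_left_mono) auto
    also have "\<dots> = (40 * (Q ^ CARD('d)) ^ 4 * U * c0) * real n" by simp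
    also have "\<dots> \<le> \<epsilon>\<^sup>2 * real n" using c0(3) by (intro mult_right_mono) auto
    finally show ?thesis by (simp add: mult_ac)
  qed
  have thr2: "(f.threshold n)\<^sup>2 = \<kappa>\<^sup>2 / ?r"
  proof -
    have "(q powr (- 1 / 2))\<^sup>2 = 1 / q" if "1 \<le> q" for q :: real
      using that by (simp add: power2_eq_square powr_add[symmetric] powr_minus_divide)
    from this[OF r] show ?thesis by (simp add: f.threshold_def power_mult_distrib)
  qed
  show "40 * ((Q ^ CARD('d))\<^sup>2 * U * (1 + 2 * U)\<^sup>2) * ln (real n) \<le> real n * (f.threshold n)\<^sup>2"
  proof -
    have "real n * (f.threshold n)\<^sup>2 = \<kappa>\<^sup>2 * ln (real n)"
      using n by (simp add: thr2)
    then show ?thesis using mult_right_mono[OF \<kappa>(2), of "ln (real n)"] ln0 by simp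
  qed
  show "f.threshold n * 2 powr (real ?L * ?d / 2) \<le> U"
  proof (rule power2_le_imp_le)
    have "(2 powr (real ?L * ?d / 2))\<^sup>2 = 2 powr (real ?L * ?d)"
      by (simp add: power2_eq_square powr_add[symmetric] mult.commute)
    then have "(f.threshold n * 2 powr (real ?L * ?d / 2))\<^sup>2 = \<kappa>\<^sup>2 / ?r * 2 powr (real ?L * ?d)"
      by (simp add: power_mult_distrib thr2)
    also have "\<dots> \<le> \<kappa>\<^sup>2 / ?r * (c0 * ?r)"
      using lev(2) ln0 by (intro mult_left_mono) auto
    also have "\<dots> = \<kappa>\<^sup>2 * c0" using n by simp
    also have "\<dots> \<le> U\<^sup>2" by (rule c0(4))
    finally show "(f.threshold n * 2 powr (real ?L * ?d / 2))\<^sup>2 \<le> U\<^sup>2" .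
  qed (use U_pos in simp)
qed

lemma suitable_f:
  assumes n: "2 \<le> n" and large: "f.large n" and model: "model P f g U"
    and g: "coef_ball \<gamma> M g" "s0 \<le> \<gamma>" "\<And>x. x \<in> unit_cube \<Longrightarrow> BL \<le> g x"
    and good: "good_sample f g n (f.level n) \<epsilon> (f.threshold n) \<omega>"
  shows "f.suitable (f.level n) (f.threshold n) (f_data n \<omega>) (f_functional n \<omega>) g f"
proof -
  interpret model P f g U by fact
  note thr = threshold_facts[OF n large]
  have pf: "positive_functional (f_functional n \<omega>)"
    using positive_functional_empirical[of "\<lambda>i. snd (\<omega> i)" n] by (simp add: f_functional_def[abs_def] empirical_def)
  have gabs: "\<forall>x\<in>unit_cube. \<bar>g x\<bar> \<le> U" using g(3) g_bounded BL by (force simp: abs_le_iff)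
  show ?thesis
    unfolding f.suitable_def
  proof (intro conjI ballI allI impI pf g_continuous)
    fix l and x y :: "real ^ 'd"
    assume "l0 \<le> l" "x \<in> unit_cube" "y \<in> unit_cube" "\<forall>j. \<bar>x $ j - y $ j\<bar> \<le> Q / 2 ^ l"
    then show "\<bar>g x - g y\<bar> \<le> \<epsilon>" using osc g gabs by blast
  next
    fix l and m :: "nat ^ 'd" assume l: "l \<in> {l0..f.level n}" and m: "m \<in> level_indices l"
    have l': "l \<in> {J0..f.level n}" using l l0 by auto
    then have Jl: "J0 \<le> l" by simp
    let ?r = "2 powr (- (real l * real CARD('d) / 2))"
    have "f_functional n \<omega> (\<lambda>x. \<bar>scaling l m x\<bar>) \<le> (LINT x:unit_cube|lborel. g x * \<bar>scaling l m x\<bar>) + f.threshold n"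
      using good l' m unfolding good_sample_def f_functional_def by (fastforce simp: abs_le_iff)
    also have "(LINT x:unit_cube|lborel. g x * \<bar>scaling l m x\<bar>) \<le> (LINT x:unit_cube|lborel. U * \<bar>scaling l m x\<bar>)"
      using g_bounded by (intro set_integral_mono unit_cube_integrable continuous_intros g_continuous wavelet_continuous Jl m mult_right_mono) auto
    also have "(LINT x:unit_cube|lborel. U * \<bar>scaling l m x\<bar>) = U * (LINT x:unit_cube|lborel. \<bar>scaling l m x\<bar>)" by simp
    also have "\<dots> \<le> U * (Q ^ CARD('d) * ?r)"
      using U_pos by (intro mult_left_mono wavelet_L1 Jl m) auto
    \<comment> \<open>The fluctuation of the mass is no larger than its mean bound:
      \<open>threshold * 2 powr (L * d / 2) \<le> U\<close> at the top level implies the same at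
      \<open>l\<close>.\<close>
    also have "f.threshold n \<le> U * ?r"
    proof -
      have "2 powr (real l * real CARD('d) / 2) \<le> 2 powr (real (f.level n) * real CARD('d) / 2)"
        using l by (intro powr_mono divide_right_mono mult_right_mono) auto
      then have "f.threshold n * 2 powr (real l * real CARD('d) / 2) \<le> f.threshold n * 2 powr (real (f.level n) * real CARD('d) / 2)"
        using thr(3) by (intro mult_left_mono) auto
      then have "f.threshold n * 2 powr (real l * real CARD('d) / 2) \<le> U" using thr(6) by linarith
      then show ?thesis by (simp add: powr_minus field_simps)
    qed
    finally have "f_functional n \<omega> (\<lambda>x. \<bar>scaling l m x\<bar>) \<le> U * (Q ^ CARD('d) + 1) * ?r"
      by (simp add: algebra_simps)
    also have "\<dots> \<le> (U + 1) * (Q ^ CARD('d) + 1) * ?r"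
      using Q_ge_1 by (intro mult_right_mono) auto
    finally show "f_functional n \<omega> (\<lambda>x. \<bar>scaling l m x\<bar>) \<le> (U + 1) * (Q ^ CARD('d) + 1) * ?r" .
    \<comment> \<open>The test of the true \<open>f\<close> is exactly an average of residuals, so
      only noise remains.\<close>
    have "f_data n \<omega> l m - f_functional n \<omega> (\<lambda>x. f x * scaling l m x)
        = empirical n (\<lambda>z. (fst z - f (snd z)) * (indicator unit_cube (snd z) * scaling l m (snd z))) \<omega>"
      by (simp add: f_data_def f_functional_def empirical_def diff_divide_distrib[symmetric] sum_subtractf[symmetric] algebra_simps)
    then show "\<bar>f_data n \<omega> l m - f_functional n \<omega> (\<lambda>x. f x * scaling l m x)\<bar> \<le> f.threshold n"
      using good l' m by (auto simp: good_sample_def)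
    fix m' :: "nat ^ 'd" assume m': "m' \<in> level_indices l"
    show "\<bar>f_functional n \<omega> (\<lambda>x. scaling l m x * scaling l m' x) - (LINT x:unit_cube|lborel. g x * (scaling l m x * scaling l m' x))\<bar> \<le> \<epsilon>"
      using good l' m m' by (auto simp: good_sample_def f_functional_def)
  qed (use g g_bounded in auto)
qed

text \<open>With the Lebesgue integral and weight 1 the Gram entries are exact and nothing
  oscillates; randomness enters only through the empirical averages of the scaling
  functions.\<close>

lemma suitable_g:
  assumes n: "2 \<le> n" and good: "good_sample f g n (f.level n) \<epsilon> (f.threshold n) \<omega>"
  shows "g.suitable (f.level n) (f.threshold n) (g_data n \<omega>) (g_functional \<omega>) (\<lambda>_. 1) g"
  unfolding g.suitable_def
proof (intro conjI ballI allI impI)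
  show "positive_functional (g_functional \<omega>)"
    using positive_functional_integral by (simp add: g_functional_def[abs_def])
  fix l and m :: "nat ^ 'd" assume l: "l \<in> {l0..f.level n}" and m: "m \<in> level_indices l"
  have l': "l \<in> {J0..f.level n}" using l l0 by auto
  then have Jl: "J0 \<le> l" by simp
  have "g_functional \<omega> (\<lambda>x. \<bar>scaling l m x\<bar>) \<le> Q ^ CARD('d) * 2 powr (- (real l * real CARD('d) / 2))"
    unfolding g_functional_def by (rule wavelet_L1[OF Jl m])
  also have "\<dots> \<le> (U + 1) * (Q ^ CARD('d) + 1) * 2 powr (- (real l * real CARD('d) / 2))"
  proof (intro mult_right_mono)
    have "1 * Q ^ CARD('d) \<le> (U + 1) * (Q ^ CARD('d) + 1)" using U_pos Q_ge_1 by (intro mult_mono) auto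
    then show "Q ^ CARD('d) \<le> (U + 1) * (Q ^ CARD('d) + 1)" by simp
  qed auto
  finally show "g_functional \<omega> (\<lambda>x. \<bar>scaling l m x\<bar>) \<le> (U + 1) * (Q ^ CARD('d) + 1) * 2 powr (- (real l * real CARD('d) / 2))" .
  show "\<bar>g_data n \<omega> l m - g_functional \<omega> (\<lambda>x. g x * scaling l m x)\<bar> \<le> f.threshold n"
    using good l' m by (auto simp: good_sample_def g_data_def g_functional_def)
qed (use \<epsilon> in \<open>auto simp: g_functional_def\<close>)

lemma bad_event:
  assumes n: "2 \<le> n" and model: "model P f g U" and g: "coef_ball \<gamma> M g" "s0 \<le> \<gamma>" "\<And>x. x \<in> unit_cube \<Longrightarrow> BL \<le> g x"
  shows "\<exists>N\<in>sets (sample_law n P). measure (sample_law n P) N \<le> 1 / real n ^ 4 \<and> (\<forall>\<omega>\<in>space (sample_law n P) - N.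
    f.large n \<longrightarrow> f.suitable (f.level n) (f.threshold n) (f_data n \<omega>) (f_functional n \<omega>) g f \<and>
      g.suitable (f.level n) (f.threshold n) (g_data n \<omega>) (g_functional \<omega>) (\<lambda>_. 1) g)"
proof (cases "f.large n")
  case True
  note thr = threshold_facts[OF n True]
  obtain N where "N \<in> sets (sample_law n P)" "measure (sample_law n P) N \<le> 1 / real n ^ 4"
      "\<forall>\<omega>\<in>space (sample_law n P) - N. good_sample f g n (f.level n) \<epsilon> (f.threshold n) \<omega>"
    using good_sample_prob[OF model U_pos n thr(1,2) \<epsilon>(1,2) thr(4,3,5,6)] by blast
  then show ?thesis
    using suitable_f[OF n True model g] suitable_g[OF n, of f g] by (intro bexI[of _ N]) auto
next
  case False
  then show ?thesis by (intro bexI[of _ "{}"]) auto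
qed

text \<open>The second argument is the length of the prescribed range, the first the distance of the
  truth from its ends: \<open>|f| \<le> U\<close> within \<open>[- 2 U, 2 U]\<close>, and
  \<open>BL \<le> g \<le> U\<close> within \<open>[BL / 2, 2 U]\<close>.\<close>

definition Cf :: real where "Cf = f.C3 U (4 * U)"
definition Cg :: real where "Cg = g.C3 (BL / 2) (2 * U - BL / 2)"

text \<open>In the rates the constant appears with the exponent \<open>d / (2 * s + d)\<close>. The
  power \<open>(2 * \<gamma>m + d) / d\<close> undoes it for all \<open>s < \<gamma>m\<close> at
  once, since the base is at least 1, and the 1 in the base makes the inequality strict. The other
  entries are ball radii, doubled by the passage to \<open>holder_ball\<close>.\<close>

definition const :: real where
  "const = max ((Cf + Cg + 4 * U + 1) powr ((2 * \<gamma>m + real CARD('d)) / real CARD('d))) (max (2 * f.Mc 0) (2 * g.Mc U))"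

lemma Cf_nonneg: "0 \<le> Cf" and Cg_nonneg: "0 \<le> Cg"
  unfolding Cf_def Cg_def f.C3_def g.C3_def using f.C2_nonneg g.C2_nonneg BL U_pos c0
  by (auto intro!: add_nonneg_nonneg mult_nonneg_nonneg divide_nonneg_nonneg)

lemma const_pos: "0 < const"
proof -
  have "0 < Cf + Cg + 4 * U + 1" using Cf_nonneg Cg_nonneg U_pos by linarith
  then have "0 < (Cf + Cg + 4 * U + 1) powr ((2 * \<gamma>m + real CARD('d)) / real CARD('d))" by simp
  then show ?thesis by (simp add: const_def less_max_iff_disj)
qed

lemma const_powr:
  assumes s: "s0 \<le> s" "s < \<gamma>m"
  shows "Cf + Cg + 4 * U < const powr (real CARD('d) / (2 * s + real CARD('d)))"
proof -
  let ?d = "real CARD('d)" and ?K = "Cf + Cg + 4 * U + 1"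
  have K: "1 \<le> ?K" using Cf_nonneg Cg_nonneg U_pos by linarith
  have s': "0 < s" using s s0 by linarith
  have "Cf + Cg + 4 * U < ?K powr 1" using K by simp
  also have "\<dots> \<le> ?K powr ((2 * \<gamma>m + ?d) / ?d * (?d / (2 * s + ?d)))"
  proof (intro powr_mono K)
    have "(2 * \<gamma>m + ?d) / ?d * (?d / (2 * s + ?d)) = (2 * \<gamma>m + ?d) / (2 * s + ?d)" by simp
    then show "1 \<le> (2 * \<gamma>m + ?d) / ?d * (?d / (2 * s + ?d))" using s s' by (simp add: le_divide_eq)
  qed
  also have "\<dots> = (?K powr ((2 * \<gamma>m + ?d) / ?d)) powr (?d / (2 * s + ?d))" by (simp add: powr_powr)
  also have "\<dots> \<le> const powr (?d / (2 * s + ?d))"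
    unfolding const_def using s' by (intro powr_mono2) auto
  finally show ?thesis .
qed

text \<open>The flag \<open>b\<close> selects the target: \<open>False\<close> for \<open>f\<close>, \<open>True\<close> for \<open>g\<close>.\<close>

definition estimates :: "nat \<Rightarrow> bool \<Rightarrow> real \<Rightarrow> real \<Rightarrow> ((nat \<Rightarrow> real \<times> (real ^ 'd)) \<Rightarrow> real ^ 'd \<Rightarrow> real) \<Rightarrow> bool" where
  "estimates n b lo hi e \<longleftrightarrow> is_estimator n e \<and> (\<forall>\<omega>. \<forall>x\<in>unit_cube. lo \<le> e \<omega> x \<and> e \<omega> x \<le> hi) \<and>
    (\<forall>P f g s \<gamma>. model P f g U \<longrightarrow> coef_ball s M f \<longrightarrow> coef_ball \<gamma> M g \<longrightarrow> s0 \<le> s \<longrightarrow> s < \<gamma>m \<longrightarrow> s0 \<le> \<gamma> \<longrightarrow> \<gamma> < \<gamma>m \<longrightarrow>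
      (\<forall>x\<in>unit_cube. BL \<le> g x) \<longrightarrow>
      (let Pn = sample_law n P; \<beta> = (if b then \<gamma> else s); t = (if b then g else f);
           err = (\<lambda>\<omega>. sup_norm (\<lambda>x. e \<omega> x - t x)); d = real CARD('d) in
        integrable Pn err \<and> (LINT \<omega>|Pn. err \<omega>) \<le> rate d const n \<beta> \<and>
        \<P>(\<omega> in Pn. err \<omega> \<ge> rate d const n \<beta>) \<le> ln (real n) / real n ^ 3 \<and>
        Measurable.pred Pn (\<lambda>\<omega>. e \<omega> \<notin> holder_ball B \<beta> const) \<and>
        \<P>(\<omega> in Pn. e \<omega> \<notin> holder_ball B \<beta> const) \<le> 1 / real n ^ 2))"

lemma ex_f_estimator:
  assumes n: "2 \<le> n"
  shows "\<exists>e. estimates n False (- (2 * U)) (2 * U) e"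
proof -
  obtain idx H where idx: "idx \<in> measurable (sample_law n borel) (count_space UNIV)"
    and sel: "f.selected n (- (2 * U)) 0 (2 * U) (f_data n) (f_functional n) idx H"
    using f.ex_selected_estimator[where lo = "- (2 * U)" and c = 0 and hi = "2 * U" and Y = "f_data n" and
      T = "f_functional n" and Ms = "sample_law n borel", OF n _ _ f_measurable] U_pos by auto
  note H = f.selected_range[OF sel]
  show ?thesis
    unfolding estimates_def Let_def
  proof (intro exI[of _ "\<lambda>\<omega>. H (idx \<omega>)"] conjI[OF is_estimator_selected[OF idx H(1)]] conjI[of "\<forall>\<omega>. \<forall>x\<in>unit_cube. _ \<omega> x"] allI impI)
    fix P :: "(real \<times> (real ^ 'd)) measure" and f g :: "real ^ 'd \<Rightarrow> real" and s \<gamma>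
    assume mdl: "model P f g U" and f: "coef_ball s M f" and g: "coef_ball \<gamma> M g"
      and s: "s0 \<le> s" "s < \<gamma>m" and \<gamma>: "s0 \<le> \<gamma>" "\<gamma> < \<gamma>m" and gB: "\<forall>x\<in>unit_cube. BL \<le> g x"
    interpret model P f g U by fact
    obtain N where N: "N \<in> sets (sample_law n P)" "measure (sample_law n P) N \<le> 1 / real n ^ 4"
      and suit: "\<And>\<omega>. \<omega> \<in> space (sample_law n P) - N \<Longrightarrow> f.large n \<longrightarrow>
        f.suitable (f.level n) (f.threshold n) (f_data n \<omega>) (f_functional n \<omega>) g f"
      using bad_event[OF n mdl g \<gamma>(1)] gB by blast
    have fb: "- (2 * U) + U \<le> f x \<and> f x \<le> 2 * U - U" if "x \<in> unit_cube" for x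
      using f_bounded[OF that] by (simp add: abs_le_iff)
    have sl: "coef_ball s (f.Mc 0) (H (idx \<omega>))" "x \<in> unit_cube \<Longrightarrow> \<bar>H (idx \<omega>) x - f x\<bar>
        \<le> f.C3 U (2 * U - - (2 * U)) * (real n / ln (real n)) powr (- (s / (2 * s + real CARD('d))))"
      if w: "\<omega> \<in> space (sample_law n P) - N" for \<omega> x
      using f.selected_error(1)[OF sel s f U_pos fb, of \<omega> g] f.selected_error(2)[OF sel s f U_pos fb, of \<omega> g x]
        suit[OF w] by blast+
    have "H (idx \<omega>) \<in> holder_ball B s const" if "\<omega> \<in> space (sample_law n P) - N" for \<omega>
      using sl(1)[OF that] by (intro coef_ball_imp_holder_ball[of s "f.Mc 0"]) (auto simp: const_def)
    moreover have "\<bar>H (idx \<omega>) x - f x\<bar> \<le> Cf * (real n / ln (real n)) powr (- (s / (2 * s + real CARD('d))))"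
      if "\<omega> \<in> space (sample_law n P) - N" "x \<in> unit_cube" for \<omega> x
      using sl(2)[OF that(1,2)] by (simp add: Cf_def)
    moreover have "Cf + (2 * U - - (2 * U)) < const powr (real CARD('d) / (2 * s + real CARD('d)))"
      using const_powr[OF s] Cg_nonneg by simp
    moreover have "- (2 * U) \<le> f x \<and> f x \<le> 2 * U" if "x \<in> unit_cube" for x
      using fb[OF that] U_pos by linarith
    moreover have "idx \<in> measurable (sample_law n P) (count_space UNIV)"
      using idx by (simp only: measurable_sample_law_cong[OF sets_P])
    ultimately show "integrable (sample_law n P) (\<lambda>\<omega>. sup_norm (\<lambda>x. H (idx \<omega>) x - (if False then g else f) x)) \<and>
       (LINT \<omega>|sample_law n P. sup_norm (\<lambda>x. H (idx \<omega>) x - (if False then g else f) x)) \<le> rate (real CARD('d)) const n (if False then \<gamma> else s) \<and>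
       \<P>(\<omega> in sample_law n P. rate (real CARD('d)) const n (if False then \<gamma> else s) \<le> sup_norm (\<lambda>x. H (idx \<omega>) x - (if False then g else f) x)) \<le> ln (real n) / real n ^ 3 \<and>
       Measurable.pred (sample_law n P) (\<lambda>\<omega>. H (idx \<omega>) \<notin> holder_ball B (if False then \<gamma> else s) const) \<and>
       \<P>(\<omega> in sample_law n P. H (idx \<omega>) \<notin> holder_ball B (if False then \<gamma> else s) const) \<le> 1 / real n ^ 2"
      using risk_bounds[OF prob_space_sample_law[OF prob_P, of n], of idx "- (2 * U)" H "2 * U" f N n "holder_ball B s const" Cf s const]
        H(2) N n s s0 Cf_nonneg by auto
  qed (use H(2) in auto)
qed

lemma ex_g_estimator:
  assumes n: "2 \<le> n"
  shows "\<exists>e. estimates n True (BL / 2) (2 * U) e"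
proof -
  obtain idx H where idx: "idx \<in> measurable (sample_law n borel) (count_space UNIV)"
    and sel: "g.selected n (BL / 2) U (2 * U) (g_data n) g_functional idx H"
    using g.ex_selected_estimator[where lo = "BL / 2" and c = U and hi = "2 * U" and Y = "g_data n" and
      T = g_functional and Ms = "sample_law n borel", OF n _ _ g_measurable] U_pos BL by auto
  note H = g.selected_range[OF sel]
  show ?thesis
    unfolding estimates_def Let_def
  proof (intro exI[of _ "\<lambda>\<omega>. H (idx \<omega>)"] conjI[OF is_estimator_selected[OF idx H(1)]] conjI[of "\<forall>\<omega>. \<forall>x\<in>unit_cube. _ \<omega> x"] allI impI)
    fix P :: "(real \<times> (real ^ 'd)) measure" and f g :: "real ^ 'd \<Rightarrow> real" and s \<gamma>
    assume mdl: "model P f g U" and f: "coef_ball s M f" and g: "coef_ball \<gamma> M g"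
      and s: "s0 \<le> s" "s < \<gamma>m" and \<gamma>: "s0 \<le> \<gamma>" "\<gamma> < \<gamma>m" and gB: "\<forall>x\<in>unit_cube. BL \<le> g x"
    interpret model P f g U by fact
    obtain N where N: "N \<in> sets (sample_law n P)" "measure (sample_law n P) N \<le> 1 / real n ^ 4"
      and suit: "\<And>\<omega>. \<omega> \<in> space (sample_law n P) - N \<Longrightarrow> f.large n \<longrightarrow>
        g.suitable (f.level n) (f.threshold n) (g_data n \<omega>) (g_functional \<omega>) (\<lambda>_. 1) g"
      using bad_event[OF n mdl g \<gamma>(1)] gB by blast
    have gb: "BL / 2 + BL / 2 \<le> g x \<and> g x \<le> 2 * U - BL / 2" if "x \<in> unit_cube" for x
      using g_bounded[OF that] gB that BL by fastforce
    have BL2: "0 < BL / 2" using BL by simp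
    have sl: "coef_ball \<gamma> (g.Mc U) (H (idx \<omega>))" "x \<in> unit_cube \<Longrightarrow> \<bar>H (idx \<omega>) x - g x\<bar>
        \<le> g.C3 (BL / 2) (2 * U - BL / 2) * (real n / ln (real n)) powr (- (\<gamma> / (2 * \<gamma> + real CARD('d))))"
      if w: "\<omega> \<in> space (sample_law n P) - N" for \<omega> x
      using g.selected_error(1)[OF sel \<gamma> g BL2 gb, of \<omega> "\<lambda>_. 1"]
        g.selected_error(2)[OF sel \<gamma> g BL2 gb, of \<omega> "\<lambda>_. 1" x] suit[OF w] by blast+
    have "H (idx \<omega>) \<in> holder_ball B \<gamma> const" if "\<omega> \<in> space (sample_law n P) - N" for \<omega>
      using sl(1)[OF that] by (intro coef_ball_imp_holder_ball[of \<gamma> "g.Mc U"]) (auto simp: const_def)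
    moreover have "\<bar>H (idx \<omega>) x - g x\<bar> \<le> Cg * (real n / ln (real n)) powr (- (\<gamma> / (2 * \<gamma> + real CARD('d))))"
      if "\<omega> \<in> space (sample_law n P) - N" "x \<in> unit_cube" for \<omega> x
      using sl(2)[OF that(1,2)] by (simp add: Cg_def)
    moreover have "Cg + (2 * U - BL / 2) < const powr (real CARD('d) / (2 * \<gamma> + real CARD('d)))"
      using const_powr[OF \<gamma>] Cf_nonneg BL U_pos by simp
    moreover have "BL / 2 \<le> g x \<and> g x \<le> 2 * U" if "x \<in> unit_cube" for x
      using gb[OF that] U_pos BL by linarith
    moreover have "idx \<in> measurable (sample_law n P) (count_space UNIV)"
      using idx by (simp only: measurable_sample_law_cong[OF sets_P])
    ultimately show "integrable (sample_law n P) (\<lambda>\<omega>. sup_norm (\<lambda>x. H (idx \<omega>) x - (if True then g else f) x)) \<and>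
       (LINT \<omega>|sample_law n P. sup_norm (\<lambda>x. H (idx \<omega>) x - (if True then g else f) x)) \<le> rate (real CARD('d)) const n (if True then \<gamma> else s) \<and>
       \<P>(\<omega> in sample_law n P. rate (real CARD('d)) const n (if True then \<gamma> else s) \<le> sup_norm (\<lambda>x. H (idx \<omega>) x - (if True then g else f) x)) \<le> ln (real n) / real n ^ 3 \<and>
       Measurable.pred (sample_law n P) (\<lambda>\<omega>. H (idx \<omega>) \<notin> holder_ball B (if True then \<gamma> else s) const) \<and>
       \<P>(\<omega> in sample_law n P. H (idx \<omega>) \<notin> holder_ball B (if True then \<gamma> else s) const) \<le> 1 / real n ^ 2"
      using risk_bounds[OF prob_space_sample_law[OF prob_P, of n], of idx "BL / 2" H "2 * U" g N n "holder_ball B \<gamma> const" Cg \<gamma> const]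
        H(2) N n \<gamma> s0 Cg_nonneg by auto
  qed (use H(2) in auto)
qed

lemma model_classD:
  assumes "(P, f, g) \<in> model_class B M BL U s \<gamma>"
  shows "model P f g U" "coef_ball s M f" "coef_ball \<gamma> M g" "\<forall>x\<in>unit_cube. BL \<le> g x"
proof -
  have c: "coef_ball s M f" "coef_ball \<gamma> M g"
    using assms by (auto simp: model_class_def intro: holder_ball_imp_coef_ball)
  then show "coef_ball s M f" "coef_ball \<gamma> M g" .
  show "\<forall>x\<in>unit_cube. BL \<le> g x" using assms by (auto simp: model_class_def)
  show "model P f g U"
    using assms BL c[THEN coef_ball_continuous] by (auto simp: model_class_def model_def intro: order_trans)
qed

end

text \<open>The order of choice avoids circularity: \<open>\<epsilon>\<close> from \<open>BL\<close>
  and \<open>Q\<close>, \<open>\<kappa>\<close> from \<open>U\<close> and \<open>Q\<close>,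
  \<open>c0\<close> from both, and \<open>l0\<close> from \<open>\<epsilon>\<close> by
  equicontinuity.\<close>

lemma (in cdv_bounded) ex_regression:
  fixes s0 M BL U :: real
  assumes s0: "0 < s0" and M: "0 \<le> M" and BL: "0 < BL" "BL \<le> U"
  shows "\<exists>\<epsilon> \<kappa> c0 l0. regression TYPE('d::finite) B Q s0 M BL U \<epsilon> \<kappa> c0 l0"
proof -
  define F where "F = Q ^ CARD('d)"
  have F: "1 \<le> F" unfolding F_def by (rule Q_power_ge_1)
  have U: "0 < U" using BL by linarith
  define G where "G = 2 * (F ^ 3 + F\<^sup>2)"
  have G: "1 \<le> G" using one_le_power[OF F, of 3] one_le_power[OF F, of 2] by (simp add: G_def)
  define \<epsilon> where "\<epsilon> = min BL 1 / G"
  have e: "0 < \<epsilon>" using BL G by (simp add: \<epsilon>_def)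
  have eG: "G * \<epsilon> = min BL 1" using G by (simp add: \<epsilon>_def)
  have eU: "\<epsilon> \<le> U"
  proof -
    have "\<epsilon> \<le> G * \<epsilon>" using G e by simp
    then show ?thesis using eG BL by linarith
  qed
  define V where "V = 40 * (F\<^sup>2 * U * (1 + 2 * U)\<^sup>2)"
  have V: "0 \<le> V" using U F by (simp add: V_def)
  \<comment> \<open>Adding 1 makes the square of \<open>\<kappa>\<close> dominate \<open>V\<close>
    and keeps \<open>\<kappa>\<close> positive.\<close>
  define \<kappa> where "\<kappa> = 1 + V"
  have k: "0 < \<kappa>" "V \<le> \<kappa>\<^sup>2" using V by (auto simp: \<kappa>_def power2_eq_square algebra_simps)
  define W where "W = 40 * F ^ 4 * U"
  have W: "0 < W" using U F by (simp add: W_def)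
  \<comment> \<open>One entry per requirement: level within the sample size, Gram entries within
    \<open>\<epsilon>\<close>, noise times height within \<open>U\<close>.\<close>
  define c0 where "c0 = min (1 / 2) (min (\<epsilon>\<^sup>2 / W) ((U / \<kappa>)\<^sup>2))"
  have "c0 \<le> 1 / 2" unfolding c0_def by (rule min.cobounded1)
  moreover have "0 < c0" using e W U k by (simp add: c0_def)
  ultimately have c0: "0 < c0" "c0 \<le> 1 / 2" by simp_all
  have c1: "W * c0 \<le> \<epsilon>\<^sup>2"
  proof -
    have "c0 \<le> \<epsilon>\<^sup>2 / W" by (simp add: c0_def)
    then show ?thesis using W by (simp add: field_simps)
  qed
  have c2: "\<kappa>\<^sup>2 * c0 \<le> U\<^sup>2"
  proof -
    have "c0 \<le> U\<^sup>2 / \<kappa>\<^sup>2" by (simp add: c0_def power_divide)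
    then show ?thesis using k by (simp add: field_simps)
  qed
  obtain l0 where l0: "J0 \<le> l0" "\<forall>l\<ge>l0. \<forall>s\<ge>s0. \<forall>h :: real ^ 'd \<Rightarrow> real. coef_ball s M h \<longrightarrow> (\<forall>x\<in>unit_cube. \<bar>h x\<bar> \<le> U) \<longrightarrow>
    (\<forall>x\<in>unit_cube. \<forall>y\<in>unit_cube. (\<forall>j. \<bar>x $ j - y $ j\<bar> \<le> Q / 2 ^ l) \<longrightarrow> \<bar>h x - h y\<bar> \<le> \<epsilon>)"
    using coef_ball_equicontinuous[OF s0 e M less_imp_le[OF U]] by blast
  have "regression TYPE('d) B Q s0 M BL U \<epsilon> \<kappa> c0 l0"
  proof
    show "2 * ((Q ^ CARD('d)) ^ 3 + (Q ^ CARD('d))\<^sup>2) * \<epsilon> \<le> BL" "2 * ((Q ^ CARD('d)) ^ 3 + (Q ^ CARD('d))\<^sup>2) * \<epsilon> \<le> 1"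
      using eG unfolding G_def F_def by auto
    show "40 * ((Q ^ CARD('d))\<^sup>2 * U * (1 + 2 * U)\<^sup>2) \<le> \<kappa>\<^sup>2" using k(2) by (simp only: V_def F_def)
    show "40 * (Q ^ CARD('d)) ^ 4 * U * c0 \<le> \<epsilon>\<^sup>2" using c1 by (simp only: W_def F_def)
  qed (use s0 M BL e eU k c0 c2 l0 in blast)+
  then show ?thesis by blast
qed

theorem theorem2p7:
  fixes B :: wavelet_system and M B\<^sub>L B\<^sub>U s_min \<gamma>_max :: real
  assumes "cdv_wavelets B" and "\<gamma>_max < real (regularity B)"
    and "0 < M" and "0 < B\<^sub>L" and "B\<^sub>L \<le> B\<^sub>U" and "0 < s_min" and "0 < \<gamma>_max"
  shows "\<exists>C>0. \<forall>s_max \<gamma>_min. 0 < s_max \<and> s_max < \<gamma>_min \<longrightarrow>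
    (\<exists>(fhat :: nat \<Rightarrow> (nat \<Rightarrow> real \<times> (real ^ 'd)) \<Rightarrow> real ^ 'd \<Rightarrow> real)
      (ghat :: nat \<Rightarrow> (nat \<Rightarrow> real \<times> (real ^ 'd)) \<Rightarrow> real ^ 'd \<Rightarrow> real).
      \<forall>n\<ge>2.
        is_estimator n (fhat n) \<and> is_estimator n (ghat n) \<and>
        (\<forall>\<omega>\<in>space (sample_law n borel). \<forall>x\<in>unit_cube.
           \<bar>fhat n \<omega> x\<bar> \<le> 2 * B\<^sub>U \<and> B\<^sub>L / 2 \<le> ghat n \<omega> x \<and> ghat n \<omega> x \<le> 2 * B\<^sub>U) \<and>
        (\<forall>s\<in>{s_min<..<s_max}. \<forall>\<gamma>\<in>{\<gamma>_min<..<\<gamma>_max}.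
         \<forall>(P, f, g)\<in>model_class B M B\<^sub>L B\<^sub>U s \<gamma>.
          let Pn = sample_law n P;
              errf = (\<lambda>\<omega>. sup_norm (\<lambda>x. fhat n \<omega> x - f x));
              errg = (\<lambda>\<omega>. sup_norm (\<lambda>x. ghat n \<omega> x - g x));
              d = real CARD('d)
          in
            integrable Pn errg \<and> (LINT \<omega>|Pn. errg \<omega>) \<le> rate d C n \<gamma> \<and>
            \<P>(\<omega> in Pn. errg \<omega> \<ge> rate d C n \<gamma>) \<le> ln (real n) / real n ^ 3 \<and>
            Measurable.pred Pn (\<lambda>\<omega>. ghat n \<omega> \<notin> holder_ball B \<gamma> C) \<and>
            \<P>(\<omega> in Pn. ghat n \<omega> \<notin> holder_ball B \<gamma> C) \<le> 1 / real n ^ 2 \<and>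
            integrable Pn errf \<and> (LINT \<omega>|Pn. errf \<omega>) \<le> rate d C n s \<and>
            \<P>(\<omega> in Pn. errf \<omega> \<ge> rate d C n s) \<le> ln (real n) / real n ^ 3 \<and>
            Measurable.pred Pn (\<lambda>\<omega>. fhat n \<omega> \<notin> holder_ball B s C) \<and>
            \<P>(\<omega> in Pn. fhat n \<omega> \<notin> holder_ball B s C) \<le> 1 / real n ^ 2))"
proof -
  have "0 < regularity B" using assms(2,7) by (cases "regularity B") auto
  then interpret cdv B using assms(1) by unfold_locales
  obtain Q where "cdv_bounded B Q" using ex_cdv_bounded by blast
  then interpret cdv_bounded B Q .
  obtain \<epsilon> \<kappa> c0 l0 where "regression TYPE('d) B Q s_min M B\<^sub>L B\<^sub>U \<epsilon> \<kappa> c0 l0"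
    using ex_regression[OF assms(6) less_imp_le[OF assms(3)] assms(4,5)] by blast
  then interpret regression B Q "TYPE('d)" s_min \<gamma>_max M B\<^sub>L B\<^sub>U \<epsilon> \<kappa> c0 l0 .
  have "\<forall>n. \<exists>e. 2 \<le> n \<longrightarrow> estimates n False (- (2 * B\<^sub>U)) (2 * B\<^sub>U) e" using ex_f_estimator by blast
  then obtain fhat where fhat: "\<And>n. 2 \<le> n \<Longrightarrow> estimates n False (- (2 * B\<^sub>U)) (2 * B\<^sub>U) (fhat n)" by metis
  have "\<forall>n. \<exists>e. 2 \<le> n \<longrightarrow> estimates n True (B\<^sub>L / 2) (2 * B\<^sub>U) e" using ex_g_estimator by blast
  then obtain ghat where ghat: "\<And>n. 2 \<le> n \<Longrightarrow> estimates n True (B\<^sub>L / 2) (2 * B\<^sub>U) (ghat n)" by metis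
  show ?thesis
  \<comment> \<open>Constant and estimators are in place before \<open>s_max\<close> and
    \<open>\<gamma>_min\<close> are fixed; of the smoothness limits they involve
    \<open>s_min\<close> and \<open>\<gamma>_max\<close>.\<close>
  proof (intro exI[of _ const] conjI const_pos allI impI, rule exI[of _ fhat], rule exI[of _ ghat], intro allI impI)
    fix s_max \<gamma>_min :: real and n :: nat
    assume sg: "0 < s_max \<and> s_max < \<gamma>_min" and n: "2 \<le> n"
    note fe = fhat[OF n, unfolded estimates_def Let_def if_False]
    note ge = ghat[OF n, unfolded estimates_def Let_def if_True]
    have bounds: "\<bar>fhat n \<omega> x\<bar> \<le> 2 * B\<^sub>U \<and> B\<^sub>L / 2 \<le> ghat n \<omega> x \<and> ghat n \<omega> x \<le> 2 * B\<^sub>U" if "x \<in> unit_cube" for \<omega> x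
    proof -
      have "- (2 * B\<^sub>U) \<le> fhat n \<omega> x \<and> fhat n \<omega> x \<le> 2 * B\<^sub>U" using fe that by blast
      moreover have "B\<^sub>L / 2 \<le> ghat n \<omega> x \<and> ghat n \<omega> x \<le> 2 * B\<^sub>U" using ge that by blast
      ultimately show ?thesis by linarith
    qed
    show "is_estimator n (fhat n) \<and> is_estimator n (ghat n) \<and>
        (\<forall>\<omega>\<in>space (sample_law n borel). \<forall>x\<in>unit_cube.
           \<bar>fhat n \<omega> x\<bar> \<le> 2 * B\<^sub>U \<and> B\<^sub>L / 2 \<le> ghat n \<omega> x \<and> ghat n \<omega> x \<le> 2 * B\<^sub>U) \<and>
        (\<forall>s\<in>{s_min<..<s_max}. \<forall>\<gamma>\<in>{\<gamma>_min<..<\<gamma>_max}.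
         \<forall>(P, f, g)\<in>model_class B M B\<^sub>L B\<^sub>U s \<gamma>.
          let Pn = sample_law n P;
              errf = (\<lambda>\<omega>. sup_norm (\<lambda>x. fhat n \<omega> x - f x));
              errg = (\<lambda>\<omega>. sup_norm (\<lambda>x. ghat n \<omega> x - g x));
              d = real CARD('d)
          in
            integrable Pn errg \<and> (LINT \<omega>|Pn. errg \<omega>) \<le> rate d const n \<gamma> \<and>
            \<P>(\<omega> in Pn. errg \<omega> \<ge> rate d const n \<gamma>) \<le> ln (real n) / real n ^ 3 \<and>
            Measurable.pred Pn (\<lambda>\<omega>. ghat n \<omega> \<notin> holder_ball B \<gamma> const) \<and>
            \<P>(\<omega> in Pn. ghat n \<omega> \<notin> holder_ball B \<gamma> const) \<le> 1 / real n ^ 2 \<and>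
            integrable Pn errf \<and> (LINT \<omega>|Pn. errf \<omega>) \<le> rate d const n s \<and>
            \<P>(\<omega> in Pn. errf \<omega> \<ge> rate d const n s) \<le> ln (real n) / real n ^ 3 \<and>
            Measurable.pred Pn (\<lambda>\<omega>. fhat n \<omega> \<notin> holder_ball B s const) \<and>
            \<P>(\<omega> in Pn. fhat n \<omega> \<notin> holder_ball B s const) \<le> 1 / real n ^ 2)"
    proof (intro conjI ballI, goal_cases)
      case 1 then show ?case using fe by blast
    next
      case 2 then show ?case using ge by blast
    next
      case (3 \<omega> x) then show ?case using bounds by blast
    next
      case (4 \<omega> x) then show ?case using bounds by blast
    next
      case (5 \<omega> x) then show ?case using bounds by blast
    next
      case (6 s \<gamma> p)
      obtain P f g where p: "p = (P, f, g)" by (cases p)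
      \<comment> \<open>The chain
        \<open>s_min < s < s_max < \<gamma>_min < \<gamma> < \<gamma>_max\<close> puts both
        smoothness indices into the single range on which \<open>estimates\<close> is
        stated.\<close>
      have r: "s_min \<le> s" "s < \<gamma>_max" "s_min \<le> \<gamma>" "\<gamma> < \<gamma>_max" using 6 sg by auto
      note m = model_classD[OF 6(3)[unfolded p]]
      show ?case
        unfolding p prod.case Let_def
        using fe[THEN conjunct2, THEN conjunct2, rule_format, OF m(1-3) r m(4)[rule_format]]
          ge[THEN conjunct2, THEN conjunct2, rule_format, OF m(1-3) r m(4)[rule_format]]
        by blast
    qed
  qed
qed

end
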